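(* Let $\mathscr{H}$ be a complex Hilbert space, let $f$ be a non-negative operator monotone function on $[0,\infty)$, and let $A$ and $A_i$ $(1\leq i\leq n)$ be positive operators in $\mathbb{B}(\mathscr{H})$ with spectra in $[\lambda,(1+2\sqrt{2})\lambda]$ for some $\lambda\in\mathbb{R}_+$. Then: (i) For every isometry $C\in\mathbb{B}(\mathscr{H})$, $$f(C^*AC)\leq 2\,C^*f\left(\frac{A}{2}\right)C.$$ (ii) For all operators $C_i\in\mathbb{B}(\mathscr{H})$ $(i=1,\dots,n)$ with $\sum_{i=1}^n C_i^*C_i=I$, $$f\left(\sum_{i=1}^n C_i^*A_iC_i\right)\leq 2\sum_{i=1}^n C_i^*f\left(\frac{A_i}{2}\right)C_i.$$
   Context: $\mathbb{B}(\mathscr{H})$ is the algebra of bounded linear operators on the complex Hilbert space $\mathscr{H}$, $I$ is the identity operator, and $\mathbb{R}_+=(0,\infty)$. An operator $A\in\mathbb{B}(\mathscr{H})$ is positive ($A\geq 0$) if $\langle Ax,x\rangle\geq 0$ for all $x\in\mathscr{H}$; for self-adjoint $A,B$, $A\leq B$ means $B-A\geq 0$. All functions are assumed continuous, and $f(A)$ is defined by the continuous functional calculus. A real-valued continuous function $f$ on an interval $J$ is operator monotone if, for all self-adjoint bounded operators $A,B$ with spectra in $J$ on any complex Hilbert space, $A\leq B$ implies $f(A)\leq f(B)$. An isometry is an operator $C$ with $C^*C=I$. *)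

theory Defs
  imports "HOL-Analysis.Analysis" "HOL-Algebra.Algebraic_Closure_Type"
begin

text \<open>
  Hilbert spaces are structures with an explicit carrier set rather than members of a type class,
  because operator monotonicity quantifies over all Hilbert spaces and a formula cannot quantify
  over types. The vector space part is a module over the ring of complex numbers; the ring
  multiplication and unit that the record \<^type>\<open>module\<close> inherits play no role.
\<close>

record 'a inner_space = "(complex, 'a) module" +
  ip :: "'a \<Rightarrow> 'a \<Rightarrow> complex"

definition hnorm :: "'a inner_space \<Rightarrow> 'a \<Rightarrow> real"
  where "hnorm H x = sqrt (Re (ip H x x))"

text \<open>The inner product is linear in its first argument.\<close>

locale hilbert_space = Module.module "ring_of_type_algebra :: complex ring" H
  for H :: "'a inner_space" (structure) +
  assumes ip_add_left: "\<lbrakk>x \<in> carrier H; y \<in> carrier H; z \<in> carrier H\<rbrakk>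
      \<Longrightarrow> ip H (x \<oplus> y) z = ip H x z + ip H y z"
    and ip_smult_left: "\<lbrakk>x \<in> carrier H; y \<in> carrier H\<rbrakk> \<Longrightarrow> ip H (c \<odot> x) y = c * ip H x y"
    and ip_commute: "\<lbrakk>x \<in> carrier H; y \<in> carrier H\<rbrakk> \<Longrightarrow> ip H y x = cnj (ip H x y)"
    and ip_nonneg: "x \<in> carrier H \<Longrightarrow> ip H x x \<in> \<real>\<^sub>\<ge>\<^sub>0"
    and ip_definite: "\<lbrakk>x \<in> carrier H; ip H x x = 0\<rbrakk> \<Longrightarrow> x = \<zero>"
    and complete: "\<lbrakk>\<And>n. s n \<in> carrier H;
        \<And>e. e > 0 \<Longrightarrow> \<exists>N. \<forall>m\<ge>N. \<forall>n\<ge>N. hnorm H (s m \<ominus> s n) < e\<rbrakk>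
      \<Longrightarrow> \<exists>l\<in>carrier H. (\<lambda>n. hnorm H (s n \<ominus> l)) \<longlonglongrightarrow> 0"

text \<open>
  Operators are extensional functions (equal to \<^const>\<open>undefined\<close> off the carrier), so that equality
  of operators is equality of functions.
\<close>

definition bounded_ops :: "'a inner_space \<Rightarrow> ('a \<Rightarrow> 'a) set"
  where "bounded_ops H = {T \<in> carrier H \<rightarrow>\<^sub>E carrier H.
    (\<forall>x\<in>carrier H. \<forall>y\<in>carrier H. T (x \<oplus>\<^bsub>H\<^esub> y) = T x \<oplus>\<^bsub>H\<^esub> T y) \<and>
    (\<forall>c. \<forall>x\<in>carrier H. T (c \<odot>\<^bsub>H\<^esub> x) = c \<odot>\<^bsub>H\<^esub> T x) \<and>
    (\<exists>K. \<forall>x\<in>carrier H. hnorm H (T x) \<le> K * hnorm H x)}"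

definition BH :: "'a inner_space \<Rightarrow> (complex, 'a \<Rightarrow> 'a) module"
  where "BH H = \<lparr> carrier = bounded_ops H,
    mult = compose (carrier H), one = (\<lambda>x\<in>carrier H. x),
    zero = (\<lambda>x\<in>carrier H. \<zero>\<^bsub>H\<^esub>), add = (\<lambda>S T. \<lambda>x\<in>carrier H. S x \<oplus>\<^bsub>H\<^esub> T x),
    smult = (\<lambda>c T. \<lambda>x\<in>carrier H. c \<odot>\<^bsub>H\<^esub> T x) \<rparr>"

definition op_norm :: "'a inner_space \<Rightarrow> ('a \<Rightarrow> 'a) \<Rightarrow> real"
  where "op_norm H T = (SUP x\<in>{x \<in> carrier H. hnorm H x \<le> 1}. hnorm H (T x))"

definition adj :: "'a inner_space \<Rightarrow> ('a \<Rightarrow> 'a) \<Rightarrow> ('a \<Rightarrow> 'a)"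
  where "adj H T = (THE S. S \<in> carrier (BH H) \<and>
    (\<forall>x\<in>carrier H. \<forall>y\<in>carrier H. ip H (T x) y = ip H x (S y)))"

definition selfadjoint_op :: "'a inner_space \<Rightarrow> ('a \<Rightarrow> 'a) \<Rightarrow> bool"
  where "selfadjoint_op H T \<longleftrightarrow> T \<in> carrier (BH H) \<and> adj H T = T"

definition positive_op :: "'a inner_space \<Rightarrow> ('a \<Rightarrow> 'a) \<Rightarrow> bool"
  where "positive_op H T \<longleftrightarrow> T \<in> carrier (BH H) \<and> (\<forall>x\<in>carrier H. ip H (T x) x \<in> \<real>\<^sub>\<ge>\<^sub>0)"

definition op_le :: "'a inner_space \<Rightarrow> ('a \<Rightarrow> 'a) \<Rightarrow> ('a \<Rightarrow> 'a) \<Rightarrow> bool"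
  where "op_le H S T \<longleftrightarrow> positive_op H (T \<ominus>\<^bsub>BH H\<^esub> S)"

definition isometry_op :: "'a inner_space \<Rightarrow> ('a \<Rightarrow> 'a) \<Rightarrow> bool"
  where "isometry_op H C \<longleftrightarrow> C \<in> carrier (BH H) \<and> adj H C \<otimes>\<^bsub>BH H\<^esub> C = \<one>\<^bsub>BH H\<^esub>"

definition spectrum :: "'a inner_space \<Rightarrow> ('a \<Rightarrow> 'a) \<Rightarrow> complex set"
  where "spectrum H T = {z. T \<ominus>\<^bsub>BH H\<^esub> (z \<odot>\<^bsub>BH H\<^esub> \<one>\<^bsub>BH H\<^esub>) \<notin> Units (BH H)}"

abbreviation spectrum_in :: "'a inner_space \<Rightarrow> ('a \<Rightarrow> 'a) \<Rightarrow> real set \<Rightarrow> bool"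
  where "spectrum_in H T J \<equiv> spectrum H T \<subseteq> complex_of_real ` J"

definition op_poly :: "'a inner_space \<Rightarrow> real poly \<Rightarrow> ('a \<Rightarrow> 'a) \<Rightarrow> ('a \<Rightarrow> 'a)"
  where "op_poly H p T = (\<Oplus>\<^bsub>BH H\<^esub>i\<in>{..Polynomial.degree p}.
    complex_of_real (Polynomial.coeff p i) \<odot>\<^bsub>BH H\<^esub> (T [^]\<^bsub>BH H\<^esub> i))"

text \<open>
  The continuous functional calculus, meant for self-adjoint \<open>T\<close> and for \<open>f\<close> continuous on the
  (compact, real) spectrum of \<open>T\<close>: the operator \<open>f(T)\<close> is the limit in operator norm of \<open>p\<^sub>n(T)\<close> for
  any real polynomials \<open>p\<^sub>n\<close> that converge to \<open>f\<close> uniformly on the spectrum. Only the values of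
  \<open>f\<close> on the spectrum matter.
\<close>

definition cfc :: "'a inner_space \<Rightarrow> (real \<Rightarrow> real) \<Rightarrow> ('a \<Rightarrow> 'a) \<Rightarrow> ('a \<Rightarrow> 'a)"
  where "cfc H f T = (THE S. S \<in> carrier (BH H) \<and>
    (\<forall>p :: nat \<Rightarrow> real poly.
      uniform_limit {t. complex_of_real t \<in> spectrum H T} (\<lambda>n. poly (p n)) f sequentially \<longrightarrow>
      (\<lambda>n. op_norm H (op_poly H (p n) T \<ominus>\<^bsub>BH H\<^esub> S)) \<longlonglongrightarrow> 0))"

text \<open>
  The type argument is the universe in which the carriers of the Hilbert spaces live. If some
  nonzero Hilbert space has its carrier in \<open>'a\<close>, then \<open>'a\<close> has at least the cardinality of the
  continuum and every Hilbert space whose cardinality is at most that of \<open>'a\<close> has an isomorphic copy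
  with carrier in \<open>'a\<close>. This covers all finite-dimensional spaces, all separable ones, and all finite
  direct sums of spaces in the universe.
\<close>

definition operator_monotone :: "'a itself \<Rightarrow> real set \<Rightarrow> (real \<Rightarrow> real) \<Rightarrow> bool"
  where "operator_monotone (_ :: 'a itself) J f \<longleftrightarrow> continuous_on J f \<and>
    (\<forall>(H :: 'a inner_space) A B. hilbert_space H \<and>
      selfadjoint_op H A \<and> selfadjoint_op H B \<and> spectrum_in H A J \<and> spectrum_in H B J \<and>
      op_le H A B \<longrightarrow> op_le H (cfc H f A) (cfc H f B))"

end

theory Submission
  imports Defs
begin

text \<open>
  No integral representation of \<open>f\<close> is needed. Let \<open>V\<close> be the isometry \<open>x \<mapsto> (C\<^sub>i x)\<^sub>i\<close> into the
  \<open>n\<close>-fold sum and \<open>Q\<close> the diagonal operator with entries \<open>A\<^sub>i\<close>, so that \<open>P = V\<^sup>*QV = \<Sum> C\<^sub>i\<^sup>*A\<^sub>iC\<^sub>i\<close>. From \<open>(Q - m)(M - Q) \<ge> 0\<close> one gets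
  \<open>\<parallel>QVx\<parallel>\<^sup>2 \<le> 2\<parallel>Px\<parallel>\<^sup>2\<close> as soon as \<open>(m + M)\<^sup>2 \<le> 8mM\<close>, which holds for \<open>M \<le> (1 + 2\<surd>2)m\<close>. Hence
  \<open>G = P\<^sup>-\<^sup>1V\<^sup>*Q/\<surd>2\<close> is a contraction; it satisfies \<open>GV = 1/\<surd>2\<close> and \<open>G\<^sup>*PG \<le> Q/2\<close>. For a contraction,
  operator monotonicity on an orthogonal sum of two spaces gives \<open>G\<^sup>*f(P)G \<le> f(Q/2)\<close>, and compressing
  with \<open>V\<close> yields \<open>f(P)/2 \<le> V\<^sup>*f(Q/2)V\<close>.
\<close>

section \<open>Hilbert space geometry\<close>

text \<open>The bound on the ratio \<open>M / m\<close> enters through a Kantorovich-type constant: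
  applying Cauchy-Schwarz to \<open><Px, x>\<close> and optimising over \<open>|x|\<close> turns
  \<open>|QVx|^2 <= (m + M) <Px, x> - m M |x|^2\<close> into
  \<open>|QVx|^2 <= (m + M)^2 / (4 m M) |Px|^2\<close>. The condition says that this constant is at
  most 2; for \<open>M = s m\<close> it reads \<open>s^2 - 6 s + 1 <= 0\<close>, that is
  \<open>3 - 2 sqrt 2 <= s <= 3 + 2 sqrt 2\<close>. The choice of \<open>G\<close> comes from the
  projection \<open>V P^-1 V' Q\<close> onto the range of \<open>V\<close>, with \<open>V'\<close>
  the adjoint of \<open>V\<close>. It is orthogonal for the form \<open><Qx, y>\<close>, whence the
  bound by \<open>Q / 2\<close>; for the original inner product it is oblique, so its norm has to be
  paid for by the ratio. The factor \<open>1 / sqrt 2\<close> does two jobs: it halves the argument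
  on the right side and halves \<open>f(P)\<close> on the left. The obstacle is the universe:
  monotonicity speaks only of spaces with carrier in \<open>'a\<close>, so every auxiliary sum is
  encoded there again, and the calculus, given by a definite description, has to be built up from
  polynomials.\<close>

context hilbert_space
begin

lemma scale_closed [simp, intro]: "x \<in> carrier H \<Longrightarrow> c \<odot> x \<in> carrier H"
  using smult_closed[of c x] by (simp add: ring_of_type_algebra_def)

lemma ip_add_right:
  assumes "x \<in> carrier H" "y \<in> carrier H" "z \<in> carrier H"
  shows "ip H x (y \<oplus> z) = ip H x y + ip H x z"
proof -
  have "ip H x (y \<oplus> z) = cnj (ip H (y \<oplus> z) x)"
    using assms by (intro ip_commute) auto
  also have "\<dots> = cnj (ip H y x) + cnj (ip H z x)"
    using assms by (simp add: ip_add_left)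
  finally show ?thesis using assms ip_commute[of y x] ip_commute[of z x] by simp
qed

lemma ip_smult_right:
  assumes "x \<in> carrier H" "y \<in> carrier H"
  shows "ip H x (c \<odot> y) = cnj c * ip H x y"
proof -
  have "ip H x (c \<odot> y) = cnj (ip H (c \<odot> y) x)"
    using assms by (intro ip_commute) auto
  then show ?thesis using assms ip_commute[of y x] by (simp add: ip_smult_left)
qed

lemma ip_zero_left: "x \<in> carrier H \<Longrightarrow> ip H \<zero> x = 0"
  using ip_add_left[of \<zero> \<zero> x] by simp

lemma ip_zero_right: "x \<in> carrier H \<Longrightarrow> ip H x \<zero> = 0"
  using ip_add_right[of x \<zero> \<zero>] by simp

lemma ip_uminus_left: "x \<in> carrier H \<Longrightarrow> y \<in> carrier H \<Longrightarrow> ip H (\<ominus> x) y = - ip H x y"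
  using ip_add_left[of x "\<ominus> x" y] by (simp add: r_neg ip_zero_left add_eq_0_iff)

lemma ip_minus_left:
  "x \<in> carrier H \<Longrightarrow> y \<in> carrier H \<Longrightarrow> z \<in> carrier H \<Longrightarrow> ip H (x \<ominus> y) z = ip H x z - ip H y z"
  by (simp add: a_minus_def ip_add_left ip_uminus_left)

lemma ip_minus_right:
  assumes "x \<in> carrier H" "y \<in> carrier H" "z \<in> carrier H"
  shows "ip H x (y \<ominus> z) = ip H x y - ip H x z"
  using assms ip_commute[of "y \<ominus> z" x] ip_commute[of y x] ip_commute[of z x]
  by (simp add: ip_minus_left)

lemmas ip_simps = ip_add_left ip_add_right ip_smult_left ip_smult_right ip_zero_left ip_zero_right
  ip_minus_left ip_minus_right

lemma Re_ip_nonneg: "x \<in> carrier H \<Longrightarrow> 0 \<le> Re (ip H x x)"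
  using ip_nonneg[of x] by (auto simp: nonneg_Reals_def)

lemma hnorm_nonneg [simp]: "x \<in> carrier H \<Longrightarrow> 0 \<le> hnorm H x"
  by (simp add: hnorm_def Re_ip_nonneg)

lemma hnorm_sq: "x \<in> carrier H \<Longrightarrow> (hnorm H x)\<^sup>2 = Re (ip H x x)"
  by (simp add: hnorm_def Re_ip_nonneg)

lemma ip_self: "x \<in> carrier H \<Longrightarrow> ip H x x = complex_of_real ((hnorm H x)\<^sup>2)"
  using ip_nonneg[of x] by (auto simp: nonneg_Reals_def hnorm_sq)

lemma Re_ip_commute: "x \<in> carrier H \<Longrightarrow> y \<in> carrier H \<Longrightarrow> Re (ip H y x) = Re (ip H x y)"
  using ip_commute[of x y] by simp

lemma hnorm_eq_0: "x \<in> carrier H \<Longrightarrow> hnorm H x = 0 \<longleftrightarrow> x = \<zero>"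
  using ip_self[of x] ip_definite[of x] ip_zero_left[of \<zero>] by (auto simp: hnorm_def)

lemma hnorm_zero [simp]: "hnorm H \<zero> = 0"
  by (simp add: hnorm_eq_0)

text \<open>Many vector identities below are proved by testing against all \<open>z\<close>:
  \<open>ip_simps\<close> then reduces them to complex arithmetic, which replaces computation in the
  module.\<close>

lemma ip_eqI:
  assumes "x \<in> carrier H" "y \<in> carrier H" "\<And>z. z \<in> carrier H \<Longrightarrow> ip H x z = ip H y z"
  shows "x = y"
proof -
  have "ip H (x \<ominus> y) (x \<ominus> y) = 0"
    using assms by (simp add: ip_minus_left)
  then have "x \<ominus> y = \<zero>"
    using assms by (intro ip_definite) auto
  then show ?thesis
    using assms by (metis a_minus_def add.inv_closed minus_equality minus_minus add.m_comm)
qed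

lemma hnorm_smult: "x \<in> carrier H \<Longrightarrow> hnorm H (c \<odot> x) = cmod c * hnorm H x"
proof -
  assume x: "x \<in> carrier H"
  have "ip H (c \<odot> x) (c \<odot> x) = complex_of_real ((cmod c)\<^sup>2) * ip H x x"
    using x by (simp add: ip_simps complex_norm_square mult_ac del: of_real_power)
  then show ?thesis
    using x by (simp add: hnorm_def real_sqrt_mult)
qed

lemma cauchy_schwarz:
  assumes x: "x \<in> carrier H" and y: "y \<in> carrier H"
  shows "cmod (ip H x y) \<le> hnorm H x * hnorm H y"
proof (cases "hnorm H y = 0")
  case True
  then show ?thesis using x y by (simp add: hnorm_eq_0 ip_zero_right)
next
  case False
  define N where "N = (hnorm H y)\<^sup>2"
  have N: "N > 0" using False by (simp add: N_def)
  have yy: "ip H y y = of_real N" using ip_self[OF y] by (simp add: N_def)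
  define c where "c = ip H x y"
  have yx: "ip H y x = cnj c" using ip_commute[OF x y] by (simp add: c_def)
  have "0 \<le> Re (ip H (x \<ominus> (c / N) \<odot> y) (x \<ominus> (c / N) \<odot> y))"
    using x y by (intro Re_ip_nonneg) auto
  also have "\<dots> = Re (ip H x x) - (cmod c)\<^sup>2 / N"
  proof -
    have "ip H (x \<ominus> (c / N) \<odot> y) (x \<ominus> (c / N) \<odot> y) = ip H x x - c * cnj c / N"
      using x y N yy by (simp add: ip_simps yx c_def[symmetric] field_simps)
    then show ?thesis by (simp add: complex_norm_square[symmetric] del: of_real_power)
  qed
  also have "\<dots> = (hnorm H x)\<^sup>2 - (cmod c)\<^sup>2 / N"
    using x by (simp add: hnorm_sq)
  finally have "(cmod c)\<^sup>2 \<le> (hnorm H x)\<^sup>2 * N"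
    using N by (simp add: field_simps)
  then have "(cmod c)\<^sup>2 \<le> (hnorm H x * hnorm H y)\<^sup>2"
    by (simp add: N_def power_mult_distrib)
  then show ?thesis
    using x y by (simp add: c_def abs_le_square_iff[symmetric])
qed

lemma Re_cauchy_schwarz:
  "x \<in> carrier H \<Longrightarrow> y \<in> carrier H \<Longrightarrow> Re (ip H x y) \<le> hnorm H x * hnorm H y"
  using order_trans[OF complex_Re_le_cmod cauchy_schwarz] .

lemma hnorm_add_sq:
  assumes "x \<in> carrier H" "y \<in> carrier H"
  shows "(hnorm H (x \<oplus> y))\<^sup>2 = (hnorm H x)\<^sup>2 + 2 * Re (ip H x y) + (hnorm H y)\<^sup>2"
  using assms by (simp add: hnorm_sq ip_simps Re_ip_commute[of x y])

lemma hnorm_minus_sq: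
  assumes "x \<in> carrier H" "y \<in> carrier H"
  shows "(hnorm H (x \<ominus> y))\<^sup>2 = (hnorm H x)\<^sup>2 - 2 * Re (ip H x y) + (hnorm H y)\<^sup>2"
  using assms by (simp add: hnorm_sq ip_simps Re_ip_commute[of x y])

lemma hnorm_triangle:
  assumes "x \<in> carrier H" "y \<in> carrier H"
  shows "hnorm H (x \<oplus> y) \<le> hnorm H x + hnorm H y"
proof -
  have "Re (ip H x y) \<le> hnorm H x * hnorm H y"
    using cauchy_schwarz[OF assms] complex_Re_le_cmod order_trans by blast
  then have "(hnorm H (x \<oplus> y))\<^sup>2 \<le> (hnorm H x + hnorm H y)\<^sup>2"
    using assms by (simp add: hnorm_add_sq power2_sum)
  from power2_le_imp_le[OF this] assms show ?thesis by simp
qed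

lemma hnorm_minus_commute:
  assumes "x \<in> carrier H" "y \<in> carrier H"
  shows "hnorm H (x \<ominus> y) = hnorm H (y \<ominus> x)"
  using assms by (simp add: hnorm_def ip_simps)

lemma hnorm_diff_triangle:
  assumes "x \<in> carrier H" "y \<in> carrier H" "z \<in> carrier H"
  shows "hnorm H (x \<ominus> z) \<le> hnorm H (x \<ominus> y) + hnorm H (y \<ominus> z)"
proof -
  have "x \<ominus> z = (x \<ominus> y) \<oplus> (y \<ominus> z)"
    using assms by (intro ip_eqI) (auto simp: ip_simps)
  then show ?thesis
    using assms hnorm_triangle[of "x \<ominus> y" "y \<ominus> z"] by simp
qed

lemma hnorm_triangle_minus:
  assumes "x \<in> carrier H" "y \<in> carrier H"
  shows "hnorm H x \<le> hnorm H y + hnorm H (x \<ominus> y)"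
proof -
  have "x = y \<oplus> (x \<ominus> y)"
    using assms by (intro ip_eqI) (auto simp: ip_simps)
  then show ?thesis
    using assms hnorm_triangle[of y "x \<ominus> y"] by simp
qed

end

text \<open>Unlike \<open>bounded_ops\<close> this covers maps between two spaces and constrains
  nothing off the carrier, so compositions can be written as plain lambda terms;
  \<open>restrict_BH\<close> leads back to \<open>BH H\<close>.\<close>

definition blin :: "'a inner_space \<Rightarrow> 'b inner_space \<Rightarrow> ('a \<Rightarrow> 'b) \<Rightarrow> bool"
  where "blin H K T \<longleftrightarrow> T \<in> carrier H \<rightarrow> carrier K \<and>
    (\<forall>x\<in>carrier H. \<forall>y\<in>carrier H. T (x \<oplus>\<^bsub>H\<^esub> y) = T x \<oplus>\<^bsub>K\<^esub> T y) \<and>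
    (\<forall>c. \<forall>x\<in>carrier H. T (c \<odot>\<^bsub>H\<^esub> x) = c \<odot>\<^bsub>K\<^esub> T x) \<and>
    (\<exists>M\<ge>0. \<forall>x\<in>carrier H. hnorm K (T x) \<le> M * hnorm H x)"

text \<open>A relation in place of a chosen adjoint: it makes sense between two spaces, and
  \<open>adjoint_pair H H T T\<close> expresses self-adjointness also for maps that are not
  extensional.\<close>

definition adjoint_pair :: "'a inner_space \<Rightarrow> 'b inner_space \<Rightarrow> ('a \<Rightarrow> 'b) \<Rightarrow> ('b \<Rightarrow> 'a) \<Rightarrow> bool"
  where "adjoint_pair H K T S \<longleftrightarrow> blin H K T \<and> blin K H S \<and>
    (\<forall>x\<in>carrier H. \<forall>y\<in>carrier K. ip K (T x) y = ip H x (S y))"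

lemma blin_closed: "blin H K T \<Longrightarrow> x \<in> carrier H \<Longrightarrow> T x \<in> carrier K"
  by (auto simp: blin_def)

lemma blin_add: "blin H K T \<Longrightarrow> x \<in> carrier H \<Longrightarrow> y \<in> carrier H \<Longrightarrow> T (x \<oplus>\<^bsub>H\<^esub> y) = T x \<oplus>\<^bsub>K\<^esub> T y"
  by (auto simp: blin_def)

lemma blin_smult: "blin H K T \<Longrightarrow> x \<in> carrier H \<Longrightarrow> T (c \<odot>\<^bsub>H\<^esub> x) = c \<odot>\<^bsub>K\<^esub> T x"
  by (auto simp: blin_def)

lemma blin_bound:
  assumes "blin H K T"
  obtains M where "M \<ge> 0" "\<And>x. x \<in> carrier H \<Longrightarrow> hnorm K (T x) \<le> M * hnorm H x"
  using assms by (auto simp: blin_def)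

lemma adjoint_pairD:
  assumes "adjoint_pair H K T S"
  shows "blin H K T" "blin K H S"
    "\<And>x y. x \<in> carrier H \<Longrightarrow> y \<in> carrier K \<Longrightarrow> ip K (T x) y = ip H x (S y)"
  using assms by (auto simp: adjoint_pair_def)

lemma (in hilbert_space) scale_minus_one_zero:
  assumes "x \<in> carrier H"
  shows "(- 1) \<odot> x = \<ominus> x" "0 \<odot> x = \<zero>"
  using assms by (auto intro!: ip_eqI simp: ip_simps ip_uminus_left)

lemma blin_zero:
  assumes "hilbert_space H" "hilbert_space K" "blin H K T"
  shows "T \<zero>\<^bsub>H\<^esub> = \<zero>\<^bsub>K\<^esub>"
proof -
  interpret H: hilbert_space H by fact
  interpret K: hilbert_space K by fact
  have "T (0 \<odot>\<^bsub>H\<^esub> \<zero>\<^bsub>H\<^esub>) = 0 \<odot>\<^bsub>K\<^esub> T \<zero>\<^bsub>H\<^esub>"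
    using blin_smult[OF assms(3)] by simp
  then show ?thesis
    using blin_closed[OF assms(3), of "\<zero>\<^bsub>H\<^esub>"] by (simp add: H.scale_minus_one_zero K.scale_minus_one_zero)
qed

lemma blin_minus:
  assumes "hilbert_space H" "hilbert_space K" "blin H K T" and x: "x \<in> carrier H" "y \<in> carrier H"
  shows "T (x \<ominus>\<^bsub>H\<^esub> y) = T x \<ominus>\<^bsub>K\<^esub> T y"
proof -
  interpret H: hilbert_space H by fact
  interpret K: hilbert_space K by fact
  have "T (x \<ominus>\<^bsub>H\<^esub> y) = T (x \<oplus>\<^bsub>H\<^esub> (- 1) \<odot>\<^bsub>H\<^esub> y)"
    using x by (simp add: a_minus_def H.scale_minus_one_zero)
  also have "\<dots> = T x \<oplus>\<^bsub>K\<^esub> (- 1) \<odot>\<^bsub>K\<^esub> T y"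
    using x by (simp add: blin_add[OF assms(3)] blin_smult[OF assms(3)])
  finally show ?thesis
    using x blin_closed[OF assms(3)] by (simp add: a_minus_def K.scale_minus_one_zero)
qed

text \<open>Minimising the quadratic functional \<open>\<langle>Qx, x\<rangle> - 2 Re \<phi>(x)\<close> along a Cauchy sequence yields the
  Riesz representation (for \<open>Q = I\<close>) and the surjectivity of coercive operators at once.\<close>

lemma (in hilbert_space) lax_milgram:
  assumes Q: "adjoint_pair H H Q Q" and c: "c > 0"
    and coercive: "\<And>x. x \<in> carrier H \<Longrightarrow> c * (hnorm H x)\<^sup>2 \<le> Re (ip H (Q x) x)"
    and add: "\<And>x y. x \<in> carrier H \<Longrightarrow> y \<in> carrier H \<Longrightarrow> \<phi> (x \<oplus> y) = \<phi> x + \<phi> y"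
    and smult: "\<And>a x. x \<in> carrier H \<Longrightarrow> \<phi> (a \<odot> x) = a * \<phi> x"
    and bound: "\<And>x. x \<in> carrier H \<Longrightarrow> cmod (\<phi> x) \<le> k * hnorm H x"
  shows "\<exists>u\<in>carrier H. \<forall>z\<in>carrier H. \<phi> z = ip H z (Q u)"
proof -
  note QD = adjoint_pairD[OF Q]
  note Qcl [simp] = blin_closed[OF QD(1)]
  note Qadd = blin_add[OF QD(1)] and Qsm = blin_smult[OF QD(1)]
  define F where "F x = Re (ip H (Q x) x) - 2 * Re (\<phi> x)" for x
  \<comment> \<open>Completing the square in \<open>hnorm H x\<close> bounds \<open>F\<close> below,
    so its infimum \<open>d\<close> is meaningful.\<close>
  have low: "- (k\<^sup>2 / c) \<le> F x" if x: "x \<in> carrier H" for x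
  proof -
    have "Re (\<phi> x) \<le> k * hnorm H x"
      using bound[OF x] complex_Re_le_cmod order_trans by blast
    then have "F x \<ge> c * (hnorm H x)\<^sup>2 - 2 * k * hnorm H x"
      using coercive[OF x] by (simp add: F_def)
    moreover have "c * (hnorm H x)\<^sup>2 - 2 * k * hnorm H x + k\<^sup>2 / c = (c * hnorm H x - k)\<^sup>2 / c"
    proof -
      have "(c * hnorm H x - k)\<^sup>2 = c * (c * (hnorm H x)\<^sup>2 - 2 * k * hnorm H x) + k\<^sup>2"
        by (simp add: power2_eq_square algebra_simps)
      then show ?thesis using c by (simp add: add_divide_distrib)
    qed
    moreover have "0 \<le> (c * hnorm H x - k)\<^sup>2 / c"
      using c by simp
    ultimately show ?thesis by linarith
  qed
  define d where "d = Inf (F ` carrier H)"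
  have bdd: "bdd_below (F ` carrier H)"
    using low by (auto intro!: bdd_belowI)
  have dle: "d \<le> F x" if "x \<in> carrier H" for x
    using bdd that by (auto simp: d_def intro: cInf_lower)
  have "\<exists>x\<in>carrier H. F x < d + 1 / real (Suc n)" for n
  proof -
    have "Inf (F ` carrier H) < d + 1 / real (Suc n)"
      by (simp add: d_def[symmetric])
    then show ?thesis
      using cInf_lessD[of "F ` carrier H" "d + 1 / real (Suc n)"] by force
  qed
  then obtain s where s [simp]: "\<And>n. s n \<in> carrier H" and sF: "\<And>n. F (s n) < d + 1 / real (Suc n)"
    by metis
  have var: "F (x \<oplus> complex_of_real t \<odot> z) = F x + t\<^sup>2 * Re (ip H (Q z) z) + 2 * t * (Re (ip H (Q x) z) - Re (\<phi> z))"
    if x: "x \<in> carrier H" and z: "z \<in> carrier H" for x z t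
  proof -
    have "Re (ip H (Q z) x) = Re (ip H (Q x) z)"
      using x z QD(3)[of z x] Re_ip_commute[of "Q x" z] by simp
    then show ?thesis
      using x z by (simp add: F_def Qadd Qsm ip_simps add smult power2_eq_square algebra_simps)
  qed
  \<comment> \<open>\<open>F\<close> is exactly quadratic: its value at the midpoint of
    \<open>x\<close> and \<open>y\<close> is the mean of the two values minus a quarter of the form
    at the difference. As the midpoint value is at least \<open>d\<close>, near-minimisers are close
    to each other.\<close>
  have par: "c / 4 * (hnorm H (x \<ominus> y))\<^sup>2 \<le> (F x + F y) / 2 - d"
    if x: "x \<in> carrier H" and y: "y \<in> carrier H" for x y
  proof -
    have "y = x \<oplus> complex_of_real (- 1) \<odot> (x \<ominus> y)"
      using x y by (intro ip_eqI) (auto simp: ip_simps)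
    then have 1: "F y = F x + Re (ip H (Q (x \<ominus> y)) (x \<ominus> y)) - 2 * (Re (ip H (Q x) (x \<ominus> y)) - Re (\<phi> (x \<ominus> y)))"
      using var[of x "x \<ominus> y" "- 1"] x y by simp
    have 2: "d \<le> F x + 1/4 * Re (ip H (Q (x \<ominus> y)) (x \<ominus> y)) - (Re (ip H (Q x) (x \<ominus> y)) - Re (\<phi> (x \<ominus> y)))"
      using var[of x "x \<ominus> y" "- 1/2"] dle[of "x \<oplus> complex_of_real (- 1/2) \<odot> (x \<ominus> y)"] x y
      by (simp add: power2_eq_square)
    have "c * (hnorm H (x \<ominus> y))\<^sup>2 \<le> Re (ip H (Q (x \<ominus> y)) (x \<ominus> y))"
      using x y by (intro coercive) auto
    then show ?thesis using 1 2 by (simp add: algebra_simps)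
  qed
  have "\<exists>N. \<forall>m\<ge>N. \<forall>n\<ge>N. hnorm H (s m \<ominus> s n) < e" if e: "e > 0" for e
  proof -
    obtain N where N: "1 / real (Suc N) < c / 4 * e\<^sup>2"
      using reals_Archimedean[of "c / 4 * e\<^sup>2"] c e by (auto simp: field_simps)
    have "hnorm H (s m \<ominus> s n) < e" if "m \<ge> N" "n \<ge> N" for m n
    proof -
      have "1 / real (Suc m) \<le> 1 / real (Suc N)" "1 / real (Suc n) \<le> 1 / real (Suc N)"
        using that by (simp_all add: frac_le)
      then have "c / 4 * (hnorm H (s m \<ominus> s n))\<^sup>2 < c / 4 * e\<^sup>2"
        using par[of "s m" "s n"] sF[of m] sF[of n] N by (simp add: add_divide_distrib)
      then have "(hnorm H (s m \<ominus> s n))\<^sup>2 < e\<^sup>2"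
        using c by simp
      then show ?thesis
        using e by (meson power_less_imp_less_base less_imp_le)
    qed
    then show ?thesis by blast
  qed
  then obtain u where u [simp]: "u \<in> carrier H" and su: "(\<lambda>n. hnorm H (s n \<ominus> u)) \<longlonglongrightarrow> 0"
    using complete[of s] by auto
  have Qs: "(\<lambda>n. Re (ip H (Q (s n)) z)) \<longlonglongrightarrow> Re (ip H (Q u) z)" if z: "z \<in> carrier H" for z
  proof -
    have "(\<lambda>n. Re (ip H (Q (s n)) z) - Re (ip H (Q u) z)) \<longlonglongrightarrow> 0"
    proof (rule Lim_null_comparison)
      show "(\<lambda>n. hnorm H (s n \<ominus> u) * hnorm H (Q z)) \<longlonglongrightarrow> 0"
        using tendsto_mult_left_zero[OF su] by simp
      have "\<bar>Re (ip H (Q (s n)) z) - Re (ip H (Q u) z)\<bar> \<le> hnorm H (s n \<ominus> u) * hnorm H (Q z)" for n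
      proof -
        have "Re (ip H (Q (s n)) z) - Re (ip H (Q u) z) = Re (ip H (s n \<ominus> u) (Q z))"
          using z by (simp add: QD(3) ip_simps)
        then show ?thesis
          using cauchy_schwarz[of "s n \<ominus> u" "Q z"] abs_Re_le_cmod[of "ip H (s n \<ominus> u) (Q z)"] z by simp
      qed
      then show "\<forall>\<^sub>F n in sequentially. norm (Re (ip H (Q (s n)) z) - Re (ip H (Q u) z)) \<le> hnorm H (s n \<ominus> u) * hnorm H (Q z)"
        by simp
    qed
    then show ?thesis by (simp add: LIM_zero_iff)
  qed
  \<comment> \<open>Along the minimising sequence
    \<open>F (s n + t z) >= d > F (s n) - 1 / (n + 1)\<close>; passing to the limit gives the
    variational inequality at \<open>u\<close>.\<close>
  have opt: "0 \<le> t\<^sup>2 * Re (ip H (Q z) z) + 2 * t * (Re (ip H (Q u) z) - Re (\<phi> z))"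
    if z: "z \<in> carrier H" for z t
  proof (rule LIMSEQ_le)
    show "(\<lambda>n. - (1 / real (Suc n))) \<longlonglongrightarrow> 0"
      using tendsto_minus[OF LIMSEQ_inverse_real_of_nat] by (simp add: inverse_eq_divide)
    show "(\<lambda>n. t\<^sup>2 * Re (ip H (Q z) z) + 2 * t * (Re (ip H (Q (s n)) z) - Re (\<phi> z)))
       \<longlonglongrightarrow> t\<^sup>2 * Re (ip H (Q z) z) + 2 * t * (Re (ip H (Q u) z) - Re (\<phi> z))"
      by (intro tendsto_intros Qs z)
    have "- (1 / real (Suc n)) \<le> t\<^sup>2 * Re (ip H (Q z) z) + 2 * t * (Re (ip H (Q (s n)) z) - Re (\<phi> z))" for n
      using var[of "s n" z t] dle[of "s n \<oplus> complex_of_real t \<odot> z"] sF[of n] z by simp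
    then show "\<exists>N. \<forall>n\<ge>N. - (1 / real (Suc n)) \<le> t\<^sup>2 * Re (ip H (Q z) z) + 2 * t * (Re (ip H (Q (s n)) z) - Re (\<phi> z))"
      by blast
  qed
  have lin0: "b = 0" if "\<And>t. 0 \<le> t\<^sup>2 * a + 2 * t * b" for a b :: real
  proof (rule ccontr)
    assume b: "b \<noteq> 0"
    \<comment> \<open>A step against the sign of \<open>b\<close>, short enough for the linear term
      to outweigh \<open>t^2 * a\<close>.\<close>
    define t where "t = - b / (\<bar>a\<bar> + 1)"
    have t: "b = - t * (\<bar>a\<bar> + 1)" by (simp add: t_def field_simps)
    have "t \<noteq> 0" using b by (simp add: t_def add_nonneg_eq_0_iff)
    have "t\<^sup>2 * a + 2 * t * b = t\<^sup>2 * (a - 2 * \<bar>a\<bar> - 2)"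
      by (subst t) (simp add: power2_eq_square algebra_simps)
    also have "\<dots> < 0"
      using \<open>t \<noteq> 0\<close> by (intro mult_pos_neg) auto
    finally show False using that[of t] by simp
  qed
  \<comment> \<open>\<open>F\<close> sees only real parts; the imaginary parts follow by replacing
    \<open>z\<close> with its multiple by the imaginary unit.\<close>
  have re: "Re (\<phi> z) = Re (ip H z (Q u))" if z: "z \<in> carrier H" for z
    using lin0[OF opt[OF z]] z Re_ip_commute[of "Q u" z] by simp
  have "\<phi> z = ip H z (Q u)" if z: "z \<in> carrier H" for z
  proof (rule complex_eqI)
    show "Re (\<phi> z) = Re (ip H z (Q u))" using re z .
    have "Re (\<phi> (\<i> \<odot> z)) = Re (ip H (\<i> \<odot> z) (Q u))" using re z by simp
    then show "Im (\<phi> z) = Im (ip H z (Q u))" using z by (simp add: smult ip_simps)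
  qed
  then show ?thesis using u by (intro bexI[of _ u]) auto
qed

section \<open>Bounded operators and adjoints\<close>

lemma adjoint_pair_sym:
  assumes "hilbert_space H" "hilbert_space K" "adjoint_pair H K T S"
  shows "adjoint_pair K H S T"
proof -
  interpret H: hilbert_space H by fact
  interpret K: hilbert_space K by fact
  note D = adjoint_pairD[OF assms(3)]
  have "ip H (S y) x = ip K y (T x)" if "x \<in> carrier H" "y \<in> carrier K" for x y
    using D(3)[OF that] H.ip_commute[of x "S y"] K.ip_commute[of "T x" y] that
      blin_closed[OF D(1)] blin_closed[OF D(2)] by simp
  then show ?thesis using D by (simp add: adjoint_pair_def)
qed

text \<open>Linearity of \<open>S\<close> follows from the adjoint identity by testing against
  vectors, and its bound from \<open>|S y|^2 = <T (S y), y> <= M |S y| |y|\<close>.\<close>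

lemma adjoint_pairI:
  assumes "hilbert_space H" "hilbert_space K" "blin H K T"
    and S: "\<And>y. y \<in> carrier K \<Longrightarrow> S y \<in> carrier H"
    and adj: "\<And>x y. x \<in> carrier H \<Longrightarrow> y \<in> carrier K \<Longrightarrow> ip K (T x) y = ip H x (S y)"
  shows "adjoint_pair H K T S"
proof -
  interpret H: hilbert_space H by fact
  interpret K: hilbert_space K by fact
  note [simp] = S blin_closed[OF assms(3)]
  have adj': "ip H (S y) x = ip K y (T x)" if "x \<in> carrier H" "y \<in> carrier K" for x y
    using adj[OF that] H.ip_commute[of x "S y"] K.ip_commute[of "T x" y] that by simp
  obtain M where M: "M \<ge> 0" "\<And>x. x \<in> carrier H \<Longrightarrow> hnorm K (T x) \<le> M * hnorm H x"
    using blin_bound[OF assms(3)] by blast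
  have "hnorm H (S y) \<le> M * hnorm K y" if y: "y \<in> carrier K" for y
  proof (cases "hnorm H (S y) = 0")
    case False
    have "(hnorm H (S y))\<^sup>2 = Re (ip K (T (S y)) y)"
      using y by (simp add: H.hnorm_sq adj)
    also have "\<dots> \<le> hnorm K (T (S y)) * hnorm K y"
      using y K.cauchy_schwarz[of "T (S y)" y] complex_Re_le_cmod order_trans S blin_closed[OF assms(3)] by blast
    also have "\<dots> \<le> M * hnorm H (S y) * hnorm K y"
      using y M by (intro mult_right_mono) auto
    finally have "hnorm H (S y) * hnorm H (S y) \<le> hnorm H (S y) * (M * hnorm K y)"
      by (simp add: power2_eq_square mult_ac)
    moreover have "hnorm H (S y) > 0"
      using False y H.hnorm_nonneg[of "S y"] S[of y] by linarith
    ultimately show ?thesis by simp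
  qed (use y M in simp)
  then have "blin K H S"
    unfolding blin_def using M(1)
    by (auto intro!: H.ip_eqI exI[of _ M] simp: H.ip_simps K.ip_simps adj')
  then show ?thesis using assms by (simp add: adjoint_pair_def)
qed

text \<open>This is the Riesz representation of the functionals \<open>z -> <T z, y>\<close>,
  obtained from \<open>lax_milgram\<close> with the identity as coercive operator.\<close>

lemma adjoint_exists:
  assumes "hilbert_space H" "hilbert_space K" "blin H K T"
  obtains S where "adjoint_pair H K T S"
proof -
  interpret H: hilbert_space H by fact
  interpret K: hilbert_space K by fact
  note [simp] = blin_closed[OF assms(3)]
  obtain M where M: "M \<ge> 0" "\<And>x. x \<in> carrier H \<Longrightarrow> hnorm K (T x) \<le> M * hnorm H x"
    using blin_bound[OF assms(3)] by blast
  have id: "adjoint_pair H H (\<lambda>x. x) (\<lambda>x. x)"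
    by (auto simp: adjoint_pair_def blin_def intro!: exI[of _ 1])
  have "\<exists>u\<in>carrier H. \<forall>z\<in>carrier H. ip K (T z) y = ip H z u" if y: "y \<in> carrier K" for y
  proof (rule H.lax_milgram[OF id, of 1])
    show "cmod (ip K (T x) y) \<le> (M * hnorm K y) * hnorm H x" if x: "x \<in> carrier H" for x
    proof -
      have "cmod (ip K (T x) y) \<le> hnorm K (T x) * hnorm K y"
        using x y by (intro K.cauchy_schwarz) auto
      also have "\<dots> \<le> M * hnorm H x * hnorm K y"
        using x y M by (intro mult_right_mono) auto
      finally show ?thesis by (simp add: mult_ac)
    qed
  qed (use y in \<open>auto simp: H.hnorm_sq blin_add[OF assms(3)] blin_smult[OF assms(3)] K.ip_simps\<close>)
  then obtain S where "\<And>y. y \<in> carrier K \<Longrightarrow> S y \<in> carrier H \<and> (\<forall>z\<in>carrier H. ip K (T z) y = ip H z (S y))"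
    by metis
  then have "adjoint_pair H K T S"
    by (intro adjoint_pairI[OF assms]) auto
  then show thesis by (rule that)
qed

lemma blin_comp:
  assumes "hilbert_space H" "hilbert_space K" "hilbert_space L" "blin H K T" "blin K L S"
  shows "blin H L (\<lambda>x. S (T x))"
proof -
  interpret H: hilbert_space H by fact
  interpret K: hilbert_space K by fact
  interpret L: hilbert_space L by fact
  obtain M N where M: "M \<ge> 0" "\<And>x. x \<in> carrier H \<Longrightarrow> hnorm K (T x) \<le> M * hnorm H x"
    and N: "N \<ge> 0" "\<And>x. x \<in> carrier K \<Longrightarrow> hnorm L (S x) \<le> N * hnorm K x"
    using blin_bound[OF assms(4)] blin_bound[OF assms(5)] by metis
  have "hnorm L (S (T x)) \<le> (N * M) * hnorm H x" if x: "x \<in> carrier H" for x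
    using N(2)[of "T x"] mult_left_mono[OF M(2)[OF x] N(1)] x blin_closed[OF assms(4)]
    by (simp add: mult.assoc)
  then show ?thesis
    using assms(4,5) M(1) N(1) unfolding blin_def
    by (auto simp: Pi_iff intro!: exI[of _ "N * M"])
qed

lemma blin_lincomb:
  assumes "hilbert_space H" "hilbert_space K" "blin H K T" "blin H K S"
  shows "blin H K (\<lambda>x. a \<odot>\<^bsub>K\<^esub> T x \<oplus>\<^bsub>K\<^esub> b \<odot>\<^bsub>K\<^esub> S x)"
proof -
  interpret H: hilbert_space H by fact
  interpret K: hilbert_space K by fact
  note [simp] = blin_closed[OF assms(3)] blin_closed[OF assms(4)]
  obtain M N where M: "M \<ge> 0" "\<And>x. x \<in> carrier H \<Longrightarrow> hnorm K (T x) \<le> M * hnorm H x"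
    and N: "N \<ge> 0" "\<And>x. x \<in> carrier H \<Longrightarrow> hnorm K (S x) \<le> N * hnorm H x"
    using blin_bound[OF assms(3)] blin_bound[OF assms(4)] by metis
  have "hnorm K (a \<odot>\<^bsub>K\<^esub> T x \<oplus>\<^bsub>K\<^esub> b \<odot>\<^bsub>K\<^esub> S x) \<le> (cmod a * M + cmod b * N) * hnorm H x"
    if x: "x \<in> carrier H" for x
    using K.hnorm_triangle[of "a \<odot>\<^bsub>K\<^esub> T x" "b \<odot>\<^bsub>K\<^esub> S x"] x
      mult_left_mono[OF M(2)[OF x], of "cmod a"] mult_left_mono[OF N(2)[OF x], of "cmod b"]
    by (simp add: K.hnorm_smult algebra_simps)
  moreover have "0 \<le> cmod a * M + cmod b * N" using M N by simp
  ultimately show ?thesis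
    using assms unfolding blin_def
    by (auto simp: Pi_iff K.ip_simps algebra_simps intro!: K.ip_eqI exI[of _ "cmod a * M + cmod b * N"])
qed

lemma blin_id: "blin H H (\<lambda>x. x)"
  by (auto simp: blin_def intro!: exI[of _ 1])

lemma blin_const_zero: "hilbert_space H \<Longrightarrow> hilbert_space K \<Longrightarrow> blin H K (\<lambda>x. \<zero>\<^bsub>K\<^esub>)"
proof -
  assume "hilbert_space H" "hilbert_space K"
  then interpret H: hilbert_space H + K: hilbert_space K by auto
  show ?thesis
    by (auto simp: blin_def K.ip_simps intro!: exI[of _ 0] K.ip_eqI)
qed

lemma blin_cong: "hilbert_space H \<Longrightarrow> (\<And>x. x \<in> carrier H \<Longrightarrow> T x = S x) \<Longrightarrow> blin H K T \<longleftrightarrow> blin H K S"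
proof -
  assume "hilbert_space H" and *: "\<And>x. x \<in> carrier H \<Longrightarrow> T x = S x"
  then interpret H: hilbert_space H by auto
  show ?thesis using * by (simp add: blin_def Pi_iff)
qed

lemma adjoint_pair_comp:
  assumes "hilbert_space H" "hilbert_space K" "hilbert_space L" "adjoint_pair H K T T'" "adjoint_pair K L S S'"
  shows "adjoint_pair H L (\<lambda>x. S (T x)) (\<lambda>y. T' (S' y))"
  using assms blin_comp[OF assms(1-3) adjoint_pairD(1)[OF assms(4)] adjoint_pairD(1)[OF assms(5)]]
    blin_comp[OF assms(3,2,1) adjoint_pairD(2)[OF assms(5)] adjoint_pairD(2)[OF assms(4)]]
  by (auto simp: adjoint_pair_def blin_closed)

section \<open>Operators on one space: algebra, adjoints, positivity and order\<close>

context hilbert_space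
begin

lemma carrier_BH: "T \<in> carrier (BH H) \<longleftrightarrow> T \<in> extensional (carrier H) \<and> blin H H T"
proof -
  have "\<exists>M\<ge>0. \<forall>x\<in>carrier H. hnorm H (T x) \<le> M * hnorm H x"
    if K: "\<forall>x\<in>carrier H. hnorm H (T x) \<le> M * hnorm H x" for M
    \<comment> \<open>The constant in \<open>bounded_ops\<close> may be negative, which is possible
      on the zero space; \<open>blin\<close> demands a nonnegative one.\<close>
    by (rule exI[of _ "max M 0"]) (use K in \<open>auto intro!: order_trans[OF _ mult_right_mono[of M "max M 0"]]\<close>)
  then show ?thesis
    by (auto simp: BH_def bounded_ops_def blin_def PiE_def)
qed

lemma restrict_BH: "blin H H T \<Longrightarrow> restrict T (carrier H) \<in> carrier (BH H)"
  by (simp add: carrier_BH blin_cong[OF hilbert_space_axioms, of "restrict T (carrier H)" T])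

lemma BH_eqI:
  assumes "S \<in> carrier (BH H)" "T \<in> carrier (BH H)" "\<And>x. x \<in> carrier H \<Longrightarrow> S x = T x"
  shows "S = T"
  using assms by (auto simp: carrier_BH intro: extensionalityI)

lemma BH_closed: "T \<in> carrier (BH H) \<Longrightarrow> x \<in> carrier H \<Longrightarrow> T x \<in> carrier H"
  using blin_closed[of H H T x] by (simp add: carrier_BH)

lemma BH_blin: "T \<in> carrier (BH H) \<Longrightarrow> blin H H T"
  by (simp add: carrier_BH)

lemma blin_scale:
  assumes "blin H H T"
  shows "blin H H (\<lambda>x. c \<odot> T x)"
  using blin_lincomb[OF hilbert_space_axioms hilbert_space_axioms assms assms, of c 0] blin_closed[OF assms]
  by (simp add: blin_cong[OF hilbert_space_axioms, of "\<lambda>x. c \<odot> T x \<oplus> 0 \<odot> T x" "\<lambda>x. c \<odot> T x"] scale_minus_one_zero)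

lemma blin_plus:
  assumes "blin H H T" "blin H H S"
  shows "blin H H (\<lambda>x. T x \<oplus> S x)"
proof -
  have one: "1 \<odot> x = x" if "x \<in> carrier H" for x
    using that by (intro ip_eqI) (auto simp: ip_simps)
  show ?thesis
    using blin_lincomb[OF hilbert_space_axioms hilbert_space_axioms assms, of 1 1] blin_closed[OF assms(1)] blin_closed[OF assms(2)]
    by (simp add: blin_cong[OF hilbert_space_axioms, of "\<lambda>x. 1 \<odot> T x \<oplus> 1 \<odot> S x" "\<lambda>x. T x \<oplus> S x"] one)
qed

lemma blin_diff:
  assumes "blin H H T" "blin H H S"
  shows "blin H H (\<lambda>x. T x \<ominus> S x)"
  using blin_plus[OF assms(1) blin_scale[OF assms(2), of "- 1"]] blin_closed[OF assms(2)]
  by (simp add: blin_cong[OF hilbert_space_axioms, of "\<lambda>x. T x \<oplus> (- 1) \<odot> S x" "\<lambda>x. T x \<ominus> S x"] scale_minus_one_zero a_minus_def)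

lemma BH_add: "S \<in> carrier (BH H) \<Longrightarrow> T \<in> carrier (BH H) \<Longrightarrow> S \<oplus>\<^bsub>BH H\<^esub> T \<in> carrier (BH H)"
  using restrict_BH[OF blin_plus] BH_blin by (auto simp: BH_def)

lemma BH_smult: "T \<in> carrier (BH H) \<Longrightarrow> c \<odot>\<^bsub>BH H\<^esub> T \<in> carrier (BH H)"
  using restrict_BH[OF blin_scale] BH_blin by (auto simp: BH_def)

lemma BH_mult:
  assumes "S \<in> carrier (BH H)" "T \<in> carrier (BH H)"
  shows "S \<otimes>\<^bsub>BH H\<^esub> T \<in> carrier (BH H)"
  using restrict_BH[OF blin_comp[OF hilbert_space_axioms hilbert_space_axioms hilbert_space_axioms BH_blin[OF assms(2)] BH_blin[OF assms(1)]]]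
  by (simp add: BH_def compose_def)

lemma BH_one: "\<one>\<^bsub>BH H\<^esub> \<in> carrier (BH H)"
  using restrict_BH[OF blin_id] by (simp add: BH_def)

lemma BH_zero: "\<zero>\<^bsub>BH H\<^esub> \<in> carrier (BH H)"
  using restrict_BH[OF blin_const_zero[OF hilbert_space_axioms hilbert_space_axioms]] by (simp add: BH_def)

lemma BH_apply:
  assumes "x \<in> carrier H"
  shows "(S \<oplus>\<^bsub>BH H\<^esub> T) x = S x \<oplus> T x" "(c \<odot>\<^bsub>BH H\<^esub> T) x = c \<odot> T x"
    "(S \<otimes>\<^bsub>BH H\<^esub> T) x = S (T x)" "\<one>\<^bsub>BH H\<^esub> x = x" "\<zero>\<^bsub>BH H\<^esub> x = \<zero>"
  using assms by (simp_all add: BH_def compose_def)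

lemma abelian_group_BH: "abelian_group (BH H)"
proof (rule abelian_groupI)
  fix T assume T: "T \<in> carrier (BH H)"
  show "\<exists>S\<in>carrier (BH H). S \<oplus>\<^bsub>BH H\<^esub> T = \<zero>\<^bsub>BH H\<^esub>"
  proof (rule bexI)
    show "(- 1) \<odot>\<^bsub>BH H\<^esub> T \<oplus>\<^bsub>BH H\<^esub> T = \<zero>\<^bsub>BH H\<^esub>"
      using T by (intro BH_eqI BH_add BH_smult BH_zero) (auto simp: BH_apply BH_closed scale_minus_one_zero l_neg)
  qed (use T in \<open>simp add: BH_smult\<close>)
qed (auto intro!: BH_eqI BH_add BH_zero simp: BH_apply BH_closed a_assoc a_comm a_lcomm)

sublocale BH: abelian_group "BH H"
  by (rule abelian_group_BH)

lemma BH_minus_closed: "S \<in> carrier (BH H) \<Longrightarrow> T \<in> carrier (BH H) \<Longrightarrow> S \<ominus>\<^bsub>BH H\<^esub> T \<in> carrier (BH H)"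
  by (rule BH.minus_closed)

lemma BH_minus_apply:
  assumes S: "S \<in> carrier (BH H)" and T: "T \<in> carrier (BH H)" and x: "x \<in> carrier H"
  shows "(S \<ominus>\<^bsub>BH H\<^esub> T) x = S x \<ominus> T x"
proof -
  have "\<ominus>\<^bsub>BH H\<^esub> T = (- 1) \<odot>\<^bsub>BH H\<^esub> T"
  proof (rule BH.minus_equality)
    show "(- 1) \<odot>\<^bsub>BH H\<^esub> T \<oplus>\<^bsub>BH H\<^esub> T = \<zero>\<^bsub>BH H\<^esub>"
      using T by (intro BH_eqI BH_add BH_smult BH_zero) (auto simp: BH_apply BH_closed scale_minus_one_zero l_neg)
  qed (use T in \<open>auto simp: BH_smult\<close>)
  then show ?thesis
    using assms by (simp add: a_minus_def BH_apply BH_closed scale_minus_one_zero)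
qed

lemma ip_finsum_BH:
  assumes "finite I" "\<And>i. i \<in> I \<Longrightarrow> F i \<in> carrier (BH H)" "x \<in> carrier H" "y \<in> carrier H"
  shows "ip H ((\<Oplus>\<^bsub>BH H\<^esub>i\<in>I. F i) x) y = (\<Sum>i\<in>I. ip H (F i x) y)"
  using assms
proof (induction I rule: finite_induct)
  case empty
  then show ?case by (simp add: BH_apply ip_zero_left)
next
  case (insert i I)
  then have "(\<Oplus>\<^bsub>BH H\<^esub>i\<in>insert i I. F i) = F i \<oplus>\<^bsub>BH H\<^esub> (\<Oplus>\<^bsub>BH H\<^esub>i\<in>I. F i)"
    by (intro BH.finsum_insert) auto
  moreover have "(\<Oplus>\<^bsub>BH H\<^esub>i\<in>I. F i) \<in> carrier (BH H)"
    using insert by (intro BH.finsum_closed) auto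
  ultimately show ?case
    using insert by (simp add: BH_apply ip_add_left BH_closed)
qed

lemma adj_eqI:
  assumes "T \<in> carrier (BH H)" "S \<in> carrier (BH H)" "adjoint_pair H H T S"
  shows "adj H T = S"
  unfolding adj_def
proof (rule the_equality)
  show "S \<in> carrier (BH H) \<and> (\<forall>x\<in>carrier H. \<forall>y\<in>carrier H. ip H (T x) y = ip H x (S y))"
    using assms by (simp add: adjoint_pairD)
  fix R assume R: "R \<in> carrier (BH H) \<and> (\<forall>x\<in>carrier H. \<forall>y\<in>carrier H. ip H (T x) y = ip H x (R y))"
  have "ip H (R y) x = ip H (S y) x" if "x \<in> carrier H" "y \<in> carrier H" for x y
    using that R assms ip_commute[of x "R y"] ip_commute[of x "S y"] adjoint_pairD(3)[OF assms(3), of x y]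
    by (simp add: BH_closed)
  then show "R = S"
    using R assms by (intro BH_eqI ip_eqI) (auto simp: BH_closed)
qed

lemma adj_BH:
  assumes T: "T \<in> carrier (BH H)"
  shows "adj H T \<in> carrier (BH H)" "adjoint_pair H H T (adj H T)"
proof -
  obtain S where S: "adjoint_pair H H T S"
    using adjoint_exists[OF hilbert_space_axioms hilbert_space_axioms BH_blin[OF T]] .
  define R where "R = restrict S (carrier H)"
  have R: "R \<in> carrier (BH H)" unfolding R_def using adjoint_pairD(2)[OF S] by (rule restrict_BH)
  moreover have "adjoint_pair H H T R"
    using S BH_blin[OF R] by (auto simp: adjoint_pair_def R_def)
  ultimately show "adj H T \<in> carrier (BH H)" "adjoint_pair H H T (adj H T)"
    using adj_eqI[OF T R] by auto
qed

lemma selfadjoint_op_iff: "selfadjoint_op H T \<longleftrightarrow> T \<in> carrier (BH H) \<and> adjoint_pair H H T T"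
  using adj_BH[of T] adj_eqI[of T T] by (auto simp: selfadjoint_op_def)

lemma ip_form_real:
  assumes "selfadjoint_op H T" "x \<in> carrier H"
  shows "ip H (T x) x = complex_of_real (Re (ip H (T x) x))"
proof -
  have "ip H (T x) x = cnj (ip H (T x) x)"
    using assms ip_commute[of "T x" x] adjoint_pairD(3)[of H H T T x x] BH_closed[of T x] by (simp add: selfadjoint_op_iff)
  then show ?thesis by (simp add: complex_eq_iff)
qed

text \<open>Over the complex numbers a real quadratic form forces symmetry: polarise once with
  \<open>x + y\<close> and once with \<open>y\<close> multiplied by the imaginary unit.\<close>

lemma positive_imp_selfadjoint:
  assumes "positive_op H T"
  shows "selfadjoint_op H T"
proof -
  have T: "T \<in> carrier (BH H)" and re: "\<And>x. x \<in> carrier H \<Longrightarrow> Im (ip H (T x) x) = 0"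
    using assms by (auto simp: positive_op_def nonneg_Reals_def)
  note [simp] = BH_closed[OF T] and Tadd = blin_add[OF BH_blin[OF T]] and Tsm = blin_smult[OF BH_blin[OF T]]
  have "ip H (T x) y = ip H x (T y)" if x: "x \<in> carrier H" and y: "y \<in> carrier H" for x y
  proof -
    have "Im (ip H (T x) y) + Im (ip H (T y) x) = 0"
      using re[of "x \<oplus> y"] re[of x] re[of y] x y by (simp add: Tadd ip_simps)
    moreover have "Re (ip H (T y) x) - Re (ip H (T x) y) = 0"
      using re[of "x \<oplus> \<i> \<odot> y"] re[of x] re[of y] x y by (simp add: Tadd Tsm ip_simps)
    ultimately have "ip H (T x) y = cnj (ip H (T y) x)"
      by (simp add: complex_eq_iff)
    then show ?thesis using ip_commute[of "T y" x] x y by simp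
  qed
  then show ?thesis
    using T BH_blin[OF T] by (simp add: selfadjoint_op_iff adjoint_pair_def)
qed

lemma positive_op_iff:
  "positive_op H T \<longleftrightarrow> selfadjoint_op H T \<and> (\<forall>x\<in>carrier H. 0 \<le> Re (ip H (T x) x))"
proof safe
  assume T: "selfadjoint_op H T" and *: "\<forall>x\<in>carrier H. 0 \<le> Re (ip H (T x) x)"
  show "positive_op H T"
    unfolding positive_op_def
  proof safe
    show "T \<in> carrier (BH H)" using T by (simp add: selfadjoint_op_def)
    show "ip H (T x) x \<in> \<real>\<^sub>\<ge>\<^sub>0" if "x \<in> carrier H" for x
      using ip_form_real[OF T that] * that by (metis nonneg_Reals_of_real_iff)
  qed
qed (auto simp: positive_imp_selfadjoint positive_op_def nonneg_Reals_def)

lemma selfadjoint_minus: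
  assumes "selfadjoint_op H S" "selfadjoint_op H T"
  shows "selfadjoint_op H (T \<ominus>\<^bsub>BH H\<^esub> S)"
proof -
  have BH: "S \<in> carrier (BH H)" "T \<in> carrier (BH H)"
    using assms by (auto simp: selfadjoint_op_def)
  note TD = adjoint_pairD(3)[of H H T T] adjoint_pairD(3)[of H H S S]
  show ?thesis
    unfolding selfadjoint_op_iff
  proof
    show "adjoint_pair H H (T \<ominus>\<^bsub>BH H\<^esub> S) (T \<ominus>\<^bsub>BH H\<^esub> S)"
      using assms BH BH_blin[OF BH_minus_closed[OF BH(2,1)]]
      by (auto simp: adjoint_pair_def selfadjoint_op_iff BH_minus_apply ip_simps BH_closed)
  qed (simp add: BH)
qed

text \<open>The bridge between the operator order and inequalities of real quadratic forms, in which
  the estimates below are carried out.\<close>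

lemma op_le_iff:
  assumes "selfadjoint_op H S" "selfadjoint_op H T"
  shows "op_le H S T \<longleftrightarrow> (\<forall>x\<in>carrier H. Re (ip H (S x) x) \<le> Re (ip H (T x) x))"
proof -
  have "S \<in> carrier (BH H)" "T \<in> carrier (BH H)"
    using assms by (auto simp: selfadjoint_op_def)
  then show ?thesis
    by (simp add: op_le_def positive_op_iff selfadjoint_minus[OF assms] BH_minus_apply ip_simps BH_closed)
qed

section \<open>Invertibility, quadratic forms and the spectrum\<close>

lemma Units_BHD:
  assumes "S \<in> Units (BH H)"
  obtains R where "R \<in> carrier (BH H)" "\<And>x. x \<in> carrier H \<Longrightarrow> R (S x) = x" "\<And>x. x \<in> carrier H \<Longrightarrow> S (R x) = x"
proof -
  obtain R where R: "R \<in> carrier (BH H)" and "R \<otimes>\<^bsub>BH H\<^esub> S = \<one>\<^bsub>BH H\<^esub>" "S \<otimes>\<^bsub>BH H\<^esub> R = \<one>\<^bsub>BH H\<^esub>"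
    using assms by (auto simp: Units_def)
  then have "\<And>x. x \<in> carrier H \<Longrightarrow> R (S x) = x" "\<And>x. x \<in> carrier H \<Longrightarrow> S (R x) = x"
    by (metis BH_apply(3,4))+
  with R show thesis by (rule that)
qed

lemma ip_eqI':
  assumes "x \<in> carrier H" "y \<in> carrier H" "\<And>z. z \<in> carrier H \<Longrightarrow> ip H z x = ip H z y"
  shows "x = y"
proof (rule ip_eqI[OF assms(1,2)])
  fix z assume z: "z \<in> carrier H"
  show "ip H x z = ip H y z"
    using ip_commute[OF z assms(1)] ip_commute[OF z assms(2)] assms(3)[OF z] by simp
qed

text \<open>The modulus of the form is the same for \<open>S\<close> and its adjoint
  \<open>S'\<close>, so Cauchy-Schwarz bounds both below. Hence \<open>S\<close> is injective and
  \<open>S S'\<close> is coercive, and \<open>lax_milgram\<close> makes it surjective. The modulus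
  in place of the real part admits shifts by non-real numbers.\<close>

lemma form_bounded_below_Units:
  assumes S: "S \<in> carrier (BH H)" and c: "c > 0"
    and below: "\<And>x. x \<in> carrier H \<Longrightarrow> c * (hnorm H x)\<^sup>2 \<le> cmod (ip H (S x) x)"
  shows "S \<in> Units (BH H)"
proof -
  define S' where "S' = adj H S"
  have S': "S' \<in> carrier (BH H)" "adjoint_pair H H S S'"
    using adj_BH[OF S] by (auto simp: S'_def)
  note D = adjoint_pairD[OF S'(2)]
  note [simp] = BH_closed[OF S] BH_closed[OF S'(1)]
  have nb: "c * hnorm H x \<le> hnorm H (R x)"
    if "x \<in> carrier H" "R x \<in> carrier H" "c * (hnorm H x)\<^sup>2 \<le> cmod (ip H (R x) x)" for R x
  proof (cases "hnorm H x = 0")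
    case False
    then have "hnorm H x > 0" using hnorm_nonneg[OF that(1)] by linarith
    moreover have "c * hnorm H x * hnorm H x \<le> hnorm H (R x) * hnorm H x"
      using that(3) cauchy_schwarz[OF that(2,1)] by (simp add: power2_eq_square mult_ac)
    ultimately show ?thesis by simp
  qed (use that in simp)
  have b1: "c * hnorm H x \<le> hnorm H (S x)" if "x \<in> carrier H" for x
    using nb[of x S] below[OF that] that by simp
  have b2: "c * hnorm H x \<le> hnorm H (S' x)" if "x \<in> carrier H" for x
  proof -
    have "cmod (ip H (S' x) x) = cmod (ip H (S x) x)"
      using D(3)[of x x] that ip_commute[of x "S' x"] by (metis BH_closed S'(1) complex_mod_cnj)
    then show ?thesis using nb[of x S'] below[OF that] that by simp
  qed
  have Q: "adjoint_pair H H (\<lambda>x. S (S' x)) (\<lambda>x. S (S' x))"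
    using adjoint_pair_comp[OF hilbert_space_axioms hilbert_space_axioms hilbert_space_axioms
        adjoint_pair_sym[OF hilbert_space_axioms hilbert_space_axioms S'(2)] S'(2)] .
  have surj: "\<exists>u\<in>carrier H. S u = w" if w: "w \<in> carrier H" for w
  proof -
    have "\<exists>u\<in>carrier H. \<forall>z\<in>carrier H. ip H z w = ip H z (S (S' u))"
    proof (rule lax_milgram[OF Q, of "c\<^sup>2" _ "hnorm H w"])
      show "c\<^sup>2 * (hnorm H x)\<^sup>2 \<le> Re (ip H (S (S' x)) x)" if "x \<in> carrier H" for x
        using power_mono[OF b2[OF that], of 2] c that by (simp add: D(3) hnorm_sq power_mult_distrib)
      show "cmod (ip H x w) \<le> hnorm H w * hnorm H x" if "x \<in> carrier H" for x
        using cauchy_schwarz[OF that w] by (simp add: mult_ac)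
    qed (use c w in \<open>auto simp: ip_simps\<close>)
    then obtain u where u: "u \<in> carrier H" and uz: "\<And>z. z \<in> carrier H \<Longrightarrow> ip H z w = ip H z (S (S' u))"
      by blast
    have "S (S' u) = w"
      using u w uz by (intro ip_eqI') auto
    then show ?thesis using u by auto
  qed
  have inj: "x = y" if "x \<in> carrier H" "y \<in> carrier H" "S x = S y" for x y
  proof -
    have "S (x \<ominus> y) = \<zero>"
      using that blin_minus[OF hilbert_space_axioms hilbert_space_axioms BH_blin[OF S], of x y]
      by (simp add: r_neg a_minus_def)
    then have "c * hnorm H (x \<ominus> y) \<le> 0" using b1[of "x \<ominus> y"] that by simp
    then have "hnorm H (x \<ominus> y) \<le> 0" using c by (simp add: mult_le_0_iff)
    then have "hnorm H (x \<ominus> y) = 0" using that by (intro antisym) auto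
    then have "x \<ominus> y = \<zero>" using that by (simp add: hnorm_eq_0)
    then show ?thesis
      using that ip_minus_left[of x y] by (intro ip_eqI) (auto simp: ip_zero_left)
  qed
  define R where "R = restrict (\<lambda>w. SOME u. u \<in> carrier H \<and> S u = w) (carrier H)"
  have R: "R w \<in> carrier H" "S (R w) = w" if "w \<in> carrier H" for w
    using someI_ex[of "\<lambda>u. u \<in> carrier H \<and> S u = w"] surj[OF that] that by (auto simp: R_def)
  have RS: "R (S x) = x" if "x \<in> carrier H" for x
    by (rule inj) (use that R in auto)
  note Slin = blin_add[OF BH_blin[OF S]] blin_smult[OF BH_blin[OF S]]
  have "blin H H R"
    unfolding blin_def
  proof (intro conjI ballI allI exI[of _ "1 / c"])
    show "hnorm H (R x) \<le> 1 / c * hnorm H x" if "x \<in> carrier H" for x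
      using b1[of "R x"] R that c by (simp add: field_simps)
    show "R (x \<oplus> y) = R x \<oplus> R y" if "x \<in> carrier H" "y \<in> carrier H" for x y
      by (rule inj) (use that R in \<open>auto simp: Slin\<close>)
    show "R (a \<odot> x) = a \<odot> R x" if "x \<in> carrier H" for a x
      by (rule inj) (use that R in \<open>auto simp: Slin\<close>)
  qed (use R c in auto)
  moreover have "R \<in> extensional (carrier H)" by (simp add: R_def)
  ultimately have RB: "R \<in> carrier (BH H)" by (simp add: carrier_BH)
  have "R \<otimes>\<^bsub>BH H\<^esub> S = \<one>\<^bsub>BH H\<^esub>" "S \<otimes>\<^bsub>BH H\<^esub> R = \<one>\<^bsub>BH H\<^esub>"
    using R RS RB S by (auto intro!: BH_eqI simp: BH_mult BH_one BH_apply)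
  then show ?thesis using RB S by (auto simp: Units_def)
qed

lemma shift_BH:
  assumes "T \<in> carrier (BH H)"
  shows "T \<ominus>\<^bsub>BH H\<^esub> (z \<odot>\<^bsub>BH H\<^esub> \<one>\<^bsub>BH H\<^esub>) \<in> carrier (BH H)"
    "x \<in> carrier H \<Longrightarrow> (T \<ominus>\<^bsub>BH H\<^esub> (z \<odot>\<^bsub>BH H\<^esub> \<one>\<^bsub>BH H\<^esub>)) x = T x \<ominus> z \<odot> x"
  using assms by (simp_all add: BH_smult BH_one BH_minus_apply BH_apply)

text \<open>If \<open>z\<close> is outside the interval, the form of \<open>T - z\<close> stays away
  from 0 by the margin \<open>|Im z|\<close>, or, for real \<open>z = t\<close>, by
  \<open>m - t\<close> or \<open>t - M\<close>; so \<open>T - z\<close> is invertible.\<close>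

lemma spectrum_in_form:
  assumes T: "selfadjoint_op H T"
    and low: "\<And>x. x \<in> carrier H \<Longrightarrow> m * (hnorm H x)\<^sup>2 \<le> Re (ip H (T x) x)"
    and upp: "\<And>x. x \<in> carrier H \<Longrightarrow> Re (ip H (T x) x) \<le> M * (hnorm H x)\<^sup>2"
  shows "spectrum_in H T {m..M}"
proof
  fix z assume z: "z \<in> spectrum H T"
  have TB: "T \<in> carrier (BH H)" using T by (simp add: selfadjoint_op_def)
  have no: False if c: "c > 0" and b: "\<And>x. x \<in> carrier H \<Longrightarrow> c * (hnorm H x)\<^sup>2 \<le> cmod (ip H (T x) x - z * (hnorm H x)\<^sup>2)" for c
  proof -
    have "T \<ominus>\<^bsub>BH H\<^esub> (z \<odot>\<^bsub>BH H\<^esub> \<one>\<^bsub>BH H\<^esub>) \<in> Units (BH H)"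
    proof (rule form_bounded_below_Units[OF shift_BH(1)[OF TB] c])
      fix x assume x: "x \<in> carrier H"
      then show "c * (hnorm H x)\<^sup>2 \<le> cmod (ip H ((T \<ominus>\<^bsub>BH H\<^esub> (z \<odot>\<^bsub>BH H\<^esub> \<one>\<^bsub>BH H\<^esub>)) x) x)"
        using b[OF x] BH_closed[OF TB x] by (simp add: shift_BH(2)[OF TB] ip_simps ip_self)
    qed
    then show False using z by (simp add: spectrum_def)
  qed
  have "Im z = 0"
  proof (rule ccontr)
    assume "Im z \<noteq> 0"
    then show False
    proof (intro no[of "\<bar>Im z\<bar>"])
      fix x assume x: "x \<in> carrier H"
      have "\<bar>Im (ip H (T x) x - z * (hnorm H x)\<^sup>2)\<bar> = \<bar>Im z\<bar> * (hnorm H x)\<^sup>2"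
        by (subst ip_form_real[OF T x]) (simp add: abs_mult del: of_real_power)
      then show "\<bar>Im z\<bar> * (hnorm H x)\<^sup>2 \<le> cmod (ip H (T x) x - z * (hnorm H x)\<^sup>2)"
        by (metis abs_Im_le_cmod)
    qed simp
  qed
  then obtain t where t: "z = complex_of_real t" by (metis complex_is_Real_iff Reals_cases)
  have form: "cmod (ip H (T x) x - z * (hnorm H x)\<^sup>2) = \<bar>Re (ip H (T x) x) - t * (hnorm H x)\<^sup>2\<bar>" if "x \<in> carrier H" for x
    by (subst ip_form_real[OF T that]) (metis t norm_of_real of_real_diff of_real_mult)
  have "m \<le> t"
  proof (rule ccontr)
    assume "\<not> m \<le> t"
    then show False
    proof (intro no[of "m - t"])
      fix x assume x: "x \<in> carrier H"
      show "(m - t) * (hnorm H x)\<^sup>2 \<le> cmod (ip H (T x) x - z * (hnorm H x)\<^sup>2)"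
        unfolding form[OF x] using low[OF x] by (simp add: algebra_simps)
    qed simp
  qed
  moreover have "t \<le> M"
  proof (rule ccontr)
    assume "\<not> t \<le> M"
    then show False
    proof (intro no[of "t - M"])
      fix x assume x: "x \<in> carrier H"
      show "(t - M) * (hnorm H x)\<^sup>2 \<le> cmod (ip H (T x) x - z * (hnorm H x)\<^sup>2)"
        unfolding form[OF x] using upp[OF x] by (simp add: algebra_simps)
    qed simp
  qed
  ultimately show "z \<in> complex_of_real ` {m..M}" using t by auto
qed

end

section \<open>Polynomials of an operator\<close>

text \<open>The Horner scheme on a vector. It applies to maps that are not extensional, and complex
  coefficients allow splitting into linear factors; \<open>op_poly_BH\<close> identifies it with
  \<open>op_poly\<close> for real coefficients.\<close>

definition poly_apply :: "'a inner_space \<Rightarrow> ('a \<Rightarrow> 'a) \<Rightarrow> complex poly \<Rightarrow> 'a \<Rightarrow> 'a"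
  where "poly_apply H T p x = fold_coeffs (\<lambda>a y. a \<odot>\<^bsub>H\<^esub> x \<oplus>\<^bsub>H\<^esub> T y) p \<zero>\<^bsub>H\<^esub>"

abbreviation cpoly :: "real poly \<Rightarrow> complex poly"
  where "cpoly \<equiv> map_poly complex_of_real"

lemma cpoly_hom:
  "cpoly (p * q) = cpoly p * cpoly q" "cpoly (p - q) = cpoly p - cpoly q"
  "cpoly (pCons a p) = pCons (complex_of_real a) (cpoly p)"
  "poly (cpoly p) (complex_of_real t) = complex_of_real (poly p t)"
  "cpoly p = 0 \<longleftrightarrow> p = 0"
proof -
  show "cpoly (pCons a p) = pCons (complex_of_real a) (cpoly p)" for a p
    by (simp add: map_poly_pCons)
  then show "poly (cpoly p) (complex_of_real t) = complex_of_real (poly p t)"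
    by (induction p) auto
qed (auto intro!: poly_eqI simp: coeff_map_poly coeff_mult map_poly_eq_0_iff)

lemma cpoly_pcompose: "cpoly (pcompose p q) = pcompose (cpoly p) (cpoly q)"
proof -
  have add: "cpoly (p + q) = cpoly p + cpoly q" for p q
    by (auto intro!: poly_eqI simp: coeff_map_poly)
  show ?thesis
    by (induction p) (simp_all add: cpoly_hom pcompose_pCons add)
qed

lemma weierstrass_poly:
  fixes f :: "real \<Rightarrow> real"
  assumes "continuous_on {a..b} f" "e > 0"
  obtains p :: "real poly" where "\<And>t. t \<in> {a..b} \<Longrightarrow> \<bar>poly p t - f t\<bar> \<le> e"
proof -
  obtain g where g: "real_polynomial_function g" "\<And>x. x \<in> {a..b} \<Longrightarrow> \<bar>f x - g x\<bar> < e"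
    using Stone_Weierstrass_real_polynomial_function[OF _ assms] by auto
  then obtain c n where "g = (\<lambda>x. \<Sum>i\<le>n. c i * x ^ i)"
    by (auto simp: real_polynomial_function_iff_sum)
  then have "poly (\<Sum>i\<le>n. Polynomial.monom (c i) i) t = g t" for t
    by (simp add: poly_sum poly_monom)
  with g(2) show thesis
    by (intro that[of "\<Sum>i\<le>n. Polynomial.monom (c i) i"]) (simp add: abs_minus_commute less_imp_le)
qed

context hilbert_space
begin

lemma poly_apply_0: "poly_apply H T 0 x = \<zero>"
  by (simp add: poly_apply_def)

text \<open>\<open>pCons 0 0\<close> is the zero polynomial, for which \<open>fold_coeffs\<close>
  performs no step; there the equation holds because \<open>T\<close> maps zero to zero.\<close>

lemma poly_apply_pCons:
  assumes "blin H H T" "x \<in> carrier H"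
  shows "poly_apply H T (pCons a p) x = a \<odot> x \<oplus> T (poly_apply H T p x)"
proof (cases "p = 0")
  case True
  show ?thesis
  proof (cases "a = 0")
    case a: True
    show ?thesis
      unfolding True a using assms blin_zero[OF hilbert_space_axioms hilbert_space_axioms assms(1)]
      by (simp add: poly_apply_def scale_minus_one_zero)
  qed (simp add: poly_apply_def True)
qed (simp add: poly_apply_def)

lemma poly_apply_closed:
  assumes "blin H H T" "x \<in> carrier H"
  shows "poly_apply H T p x \<in> carrier H"
  using assms by (induction p) (auto simp: poly_apply_0 poly_apply_pCons blin_closed[OF assms(1)])

lemma poly_apply_blin:
  assumes T: "blin H H T"
  shows "blin H H (poly_apply H T p)"
proof (induction p)
  case 0
  then show ?case
    using blin_const_zero[OF hilbert_space_axioms hilbert_space_axioms] by (simp add: poly_apply_0[abs_def])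
next
  case (pCons a p)
  have "blin H H (\<lambda>x. a \<odot> x \<oplus> T (poly_apply H T p x))"
    by (intro blin_plus blin_scale blin_id blin_comp[OF _ _ _ pCons(2) T] hilbert_space_axioms)
  then show ?case
    using blin_cong[OF hilbert_space_axioms, of "poly_apply H T (pCons a p)"] poly_apply_pCons[OF T] by simp
qed

lemma poly_apply_linear:
  assumes T: "blin H H T" and x: "x \<in> carrier H"
  shows "poly_apply H T [:a, b:] x = a \<odot> x \<oplus> b \<odot> T x"
proof -
  note [simp] = blin_closed[OF T] blin_zero[OF hilbert_space_axioms hilbert_space_axioms T]
  show ?thesis
    using x by (simp add: poly_apply_pCons[OF T] poly_apply_0 blin_smult[OF T])
qed

lemma poly_apply_add:
  assumes T: "blin H H T" and x: "x \<in> carrier H"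
  shows "poly_apply H T (p + q) x = poly_apply H T p x \<oplus> poly_apply H T q x"
proof (induction p q rule: poly_induct2)
  case (pCons a p b q)
  note [simp] = poly_apply_closed[OF T] blin_closed[OF T]
  show ?case
    using x by (auto intro!: ip_eqI simp: poly_apply_pCons[OF T] pCons blin_add[OF T] ip_simps algebra_simps)
qed (simp add: poly_apply_0)

lemma poly_apply_smult:
  assumes T: "blin H H T" and x: "x \<in> carrier H"
  shows "poly_apply H T (Polynomial.smult c p) x = c \<odot> poly_apply H T p x"
proof (induction p)
  case 0
  then show ?case by (auto intro!: ip_eqI simp: poly_apply_0 ip_simps)
next
  case (pCons a p)
  note [simp] = poly_apply_closed[OF T] blin_closed[OF T]
  show ?case
    using x by (auto intro!: ip_eqI simp: poly_apply_pCons[OF T] pCons blin_smult[OF T] ip_simps algebra_simps)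
qed

lemma poly_apply_diff:
  assumes T: "blin H H T" and x: "x \<in> carrier H"
  shows "poly_apply H T (p - q) x = poly_apply H T p x \<ominus> poly_apply H T q x"
proof -
  have "p - q = p + Polynomial.smult (- 1) q" by simp
  then show ?thesis
    using poly_apply_add[OF T x, of p "Polynomial.smult (- 1) q"] poly_apply_smult[OF T x, of "- 1" q] poly_apply_closed[OF T x]
    by (simp only: scale_minus_one_zero a_minus_def)
qed

lemma poly_apply_mult:
  assumes T: "blin H H T" and x: "x \<in> carrier H"
  shows "poly_apply H T (p * q) x = poly_apply H T p (poly_apply H T q x)"
proof (induction p)
  case 0
  then show ?case by (simp add: poly_apply_0)
next
  case (pCons a p)
  note [simp] = poly_apply_closed[OF T] blin_closed[OF T]
  show ?case
    using x by (auto intro!: ip_eqI simp: poly_apply_add[OF T] poly_apply_smult[OF T] poly_apply_pCons[OF T] pCons ip_simps)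
qed

text \<open>The choice \<open>W = T\<close> shows that \<open>T\<close> commutes with
  \<open>p(T)\<close>, the identity as \<open>W\<close> gives \<open>poly_apply_cong\<close>, and
  passing to limits gives \<open>cfc_intertwine\<close>.\<close>

lemma poly_apply_intertwine:
  assumes K: "hilbert_space K" and T: "blin H H T" and S: "blin K K S" and W: "blin H K W"
    and int: "\<And>x. x \<in> carrier H \<Longrightarrow> S (W x) = W (T x)" and x: "x \<in> carrier H"
  shows "poly_apply K S p (W x) = W (poly_apply H T p x)"
proof (induction p)
  case 0
  then show ?case
    using blin_zero[OF hilbert_space_axioms K W] by (simp add: poly_apply_0 hilbert_space.poly_apply_0[OF K])
next
  case (pCons a p)
  note [simp] = poly_apply_closed[OF T] blin_closed[OF T] blin_closed[OF W]
  show ?case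
    using x by (simp add: poly_apply_pCons[OF T] hilbert_space.poly_apply_pCons[OF K S] pCons int blin_add[OF W] blin_smult[OF W])
qed

lemma poly_apply_comp:
  assumes T: "blin H H T" and x: "x \<in> carrier H"
  shows "poly_apply H T (pcompose p q) x = poly_apply H (poly_apply H T q) p x"
proof (induction p)
  case 0
  then show ?case by (simp add: poly_apply_0)
next
  case (pCons a p)
  note [simp] = poly_apply_closed[OF T] blin_closed[OF T]
  show ?case
    using x blin_zero[OF hilbert_space_axioms hilbert_space_axioms T]
    by (simp add: pcompose_pCons poly_apply_add[OF T] poly_apply_mult[OF T] poly_apply_pCons[OF T] poly_apply_pCons[OF poly_apply_blin[OF T]] poly_apply_0 pCons)
qed

lemma poly_apply_cong:
  assumes T: "blin H H T" and S: "blin H H S" and "\<And>x. x \<in> carrier H \<Longrightarrow> T x = S x" and x: "x \<in> carrier H"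
  shows "poly_apply H T p x = poly_apply H S p x"
  using poly_apply_intertwine[OF hilbert_space_axioms T S blin_id _ x, of p] assms(3) by simp

lemma poly_apply_adjoint:
  assumes T: "adjoint_pair H H T T"
  shows "adjoint_pair H H (poly_apply H T (cpoly p)) (poly_apply H T (cpoly p))"
proof -
  note TD = adjoint_pairD[OF T]
  note [simp] = poly_apply_closed[OF TD(1)] blin_closed[OF TD(1)]
  have "ip H (poly_apply H T (cpoly p) x) y = ip H x (poly_apply H T (cpoly p) y)"
    if x: "x \<in> carrier H" and y: "y \<in> carrier H" for x y
    using x
  proof (induction p arbitrary: x)
    case (pCons a p)
    have "T (poly_apply H T (cpoly p) x) = poly_apply H T (cpoly p) (T x)"
      using poly_apply_intertwine[OF hilbert_space_axioms TD(1) TD(1) TD(1) _ pCons(3), of "cpoly p"] by simp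
    then show ?case
      using pCons y by (simp add: cpoly_hom poly_apply_pCons[OF TD(1)] ip_simps TD(3))
  qed (simp add: poly_apply_0 ip_simps y)
  then show ?thesis
    using poly_apply_blin[OF TD(1)] by (simp add: adjoint_pair_def)
qed

lemma pow_BH:
  assumes T: "T \<in> carrier (BH H)"
  shows "T [^]\<^bsub>BH H\<^esub> (i::nat) \<in> carrier (BH H)"
    "x \<in> carrier H \<Longrightarrow> (T [^]\<^bsub>BH H\<^esub> i) x = (T ^^ i) x"
proof -
  have "T [^]\<^bsub>BH H\<^esub> i \<in> carrier (BH H) \<and> (\<forall>x\<in>carrier H. (T [^]\<^bsub>BH H\<^esub> i) x = (T ^^ i) x)"
    by (induction i) (use T in \<open>auto simp: BH_one BH_mult BH_apply BH_closed simp flip: funpow_swap1\<close>)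
  then show "T [^]\<^bsub>BH H\<^esub> i \<in> carrier (BH H)" "x \<in> carrier H \<Longrightarrow> (T [^]\<^bsub>BH H\<^esub> i) x = (T ^^ i) x"
    by auto
qed

text \<open>The free bound \<open>n\<close> lets the result be used with the degree of a real
  polynomial \<open>p\<close> for \<open>cpoly p\<close>, where only the inequality of degrees is at
  hand.\<close>

lemma ip_poly_apply:
  assumes T: "blin H H T" and x: "x \<in> carrier H" and y: "y \<in> carrier H"
    and n: "Polynomial.degree p \<le> n"
  shows "ip H (poly_apply H T p x) y = (\<Sum>i\<le>n. Polynomial.coeff p i * ip H ((T ^^ i) x) y)"
  using x n
proof (induction p arbitrary: x n)
  case 0
  then show ?case using y by (simp add: poly_apply_0 ip_simps)
next
  case (pCons a p)
  note [simp] = poly_apply_closed[OF T] blin_closed[OF T]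
  have comm: "T (poly_apply H T p x) = poly_apply H T p (T x)"
    using poly_apply_intertwine[OF hilbert_space_axioms T T T _ pCons(3), of p] by simp
  show ?case
  proof (cases n)
    case 0
    then have "p = 0" using pCons(4) by (auto split: if_splits)
    then show ?thesis
      using 0 pCons y blin_zero[OF hilbert_space_axioms hilbert_space_axioms T] by (simp add: poly_apply_pCons[OF T] poly_apply_0 ip_simps)
  next
    case (Suc m)
    then have m: "Polynomial.degree p \<le> m" using pCons(4) by (auto split: if_splits)
    have "ip H (poly_apply H T p (T x)) y = (\<Sum>i\<le>m. Polynomial.coeff p i * ip H ((T ^^ i) (T x)) y)"
      using pCons by (intro pCons.IH[OF _ m]) auto
    then show ?thesis
      using pCons y unfolding Suc sum.atMost_Suc_shift
      by (simp add: poly_apply_pCons[OF T] comm ip_simps funpow_swap1)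
  qed
qed

lemma op_poly_BH:
  assumes T: "T \<in> carrier (BH H)"
  shows "op_poly H p T \<in> carrier (BH H)"
    "x \<in> carrier H \<Longrightarrow> op_poly H p T x = poly_apply H T (cpoly p) x"
proof -
  show 1: "op_poly H p T \<in> carrier (BH H)"
    unfolding op_poly_def using T by (intro BH.finsum_closed) (auto simp: BH_smult pow_BH)
  assume x: "x \<in> carrier H"
  have deg: "Polynomial.degree (cpoly p) \<le> Polynomial.degree p" by (rule map_poly_degree_leq)
  show "op_poly H p T x = poly_apply H T (cpoly p) x"
  proof (rule ip_eqI)
    fix z assume z: "z \<in> carrier H"
    have "ip H (op_poly H p T x) z = (\<Sum>i\<le>Polynomial.degree p. ip H ((complex_of_real (Polynomial.coeff p i) \<odot>\<^bsub>BH H\<^esub> (T [^]\<^bsub>BH H\<^esub> i)) x) z)"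
      unfolding op_poly_def using T x z by (intro ip_finsum_BH) (auto simp: BH_smult pow_BH)
    also have "\<dots> = (\<Sum>i\<le>Polynomial.degree p. Polynomial.coeff (cpoly p) i * ip H ((T ^^ i) x) z)"
    proof (intro sum.cong refl)
      fix i :: nat
      have "(T ^^ i) x \<in> carrier H"
        using pow_BH(1)[OF T, of i] pow_BH(2)[OF T x, of i] BH_closed[OF _ x] by metis
      then show "ip H ((complex_of_real (Polynomial.coeff p i) \<odot>\<^bsub>BH H\<^esub> (T [^]\<^bsub>BH H\<^esub> i)) x) z
          = Polynomial.coeff (cpoly p) i * ip H ((T ^^ i) x) z"
        using T x z by (simp add: BH_apply pow_BH ip_simps coeff_map_poly)
    qed
    also have "\<dots> = ip H (poly_apply H T (cpoly p) x) z"
      using ip_poly_apply[OF BH_blin[OF T] x z deg] by simp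
    finally show "ip H (op_poly H p T x) z = ip H (poly_apply H T (cpoly p) x) z" .
  qed (use 1 x T in \<open>auto simp: BH_closed poly_apply_closed BH_blin\<close>)
qed

section \<open>The norm of a polynomial of an operator in terms of the spectrum\<close>

lemma Units_bounded_below:
  assumes "S \<in> Units (BH H)"
  obtains c where "c > 0" "\<And>x. x \<in> carrier H \<Longrightarrow> c * hnorm H x \<le> hnorm H (S x)"
proof -
  obtain R where R: "R \<in> carrier (BH H)" "\<And>x. x \<in> carrier H \<Longrightarrow> R (S x) = x"
    using Units_BHD[OF assms] by metis
  have S: "S \<in> carrier (BH H)" using assms by (simp add: Units_def)
  obtain M where M: "M \<ge> 0" "\<And>x. x \<in> carrier H \<Longrightarrow> hnorm H (R x) \<le> M * hnorm H x"
    using blin_bound[OF BH_blin[OF R(1)]] by blast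
  \<comment> \<open>\<open>M\<close> itself may be zero, hence the denominator
    \<open>M + 1\<close>.\<close>
  have "1 / (M + 1) * hnorm H x \<le> hnorm H (S x)" if x: "x \<in> carrier H" for x
  proof -
    have "hnorm H x \<le> M * hnorm H (S x)"
      using M(2)[of "S x"] R(2)[OF x] BH_closed[OF S x] by simp
    also have "\<dots> \<le> (M + 1) * hnorm H (S x)"
      using BH_closed[OF S x] by (simp add: algebra_simps)
    finally show ?thesis using M(1) by (simp add: field_simps)
  qed
  then show thesis using M(1) by (intro that[of "1 / (M + 1)"]) auto
qed

text \<open>Half of the spectral mapping theorem, by factoring \<open>p\<close> into linear factors.\<close>

lemma poly_apply_bounded_below:
  assumes T: "T \<in> carrier (BH H)"
  shows "p \<noteq> 0 \<Longrightarrow> (\<And>z. z \<in> spectrum H T \<Longrightarrow> poly p z \<noteq> 0) \<Longrightarrow>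
    \<exists>c>0. \<forall>x\<in>carrier H. c * hnorm H x \<le> hnorm H (poly_apply H T p x)"
proof (induction "Polynomial.degree p" arbitrary: p)
  case 0
  then obtain a where a: "p = [:a:]" by (metis degree_eq_zeroE)
  have "poly_apply H T p x = a \<odot> x" if "x \<in> carrier H" for x
    using that BH_blin[OF T] blin_zero[OF hilbert_space_axioms hilbert_space_axioms BH_blin[OF T]]
    by (simp add: a poly_apply_pCons poly_apply_0)
  then show ?case
    using 0 a by (intro exI[of _ "cmod a"]) (auto simp: hnorm_smult)
next
  case (Suc n)
  have "\<not> constant (poly p)"
    using Suc(2) constant_degree[of p] by simp
  then obtain z where "poly p z = 0"
    using fundamental_theorem_of_algebra by blast
  then obtain q where q: "p = [:- z, 1:] * q"
    by (metis poly_eq_0_iff_dvd dvdE)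
  have "q \<noteq> 0" using Suc(3) q by auto
  have "Polynomial.degree p = Suc (Polynomial.degree q)"
    unfolding q using \<open>q \<noteq> 0\<close> by (subst degree_mult_eq) auto
  then obtain c where c: "c > 0" "\<And>x. x \<in> carrier H \<Longrightarrow> c * hnorm H x \<le> hnorm H (poly_apply H T q x)"
    using Suc(1)[of q] Suc(2,4) \<open>q \<noteq> 0\<close> q by auto
  have "z \<notin> spectrum H T" using Suc(4) \<open>poly p z = 0\<close> by auto
  then obtain d where d: "d > 0" "\<And>x. x \<in> carrier H \<Longrightarrow> d * hnorm H x \<le> hnorm H ((T \<ominus>\<^bsub>BH H\<^esub> (z \<odot>\<^bsub>BH H\<^esub> \<one>\<^bsub>BH H\<^esub>)) x)"
    using Units_bounded_below by (auto simp: spectrum_def)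
  note Tb = BH_blin[OF T]
  note [simp] = poly_apply_closed[OF Tb] blin_closed[OF Tb]
  have lin: "poly_apply H T [:- z, 1:] x = (T \<ominus>\<^bsub>BH H\<^esub> (z \<odot>\<^bsub>BH H\<^esub> \<one>\<^bsub>BH H\<^esub>)) x" if "x \<in> carrier H" for x
    using that blin_zero[OF hilbert_space_axioms hilbert_space_axioms Tb]
    by (intro ip_eqI) (auto simp: poly_apply_pCons[OF Tb] poly_apply_0 shift_BH(2)[OF T] blin_smult[OF Tb] blin_add[OF Tb] ip_simps)
  have "(d * c) * hnorm H x \<le> hnorm H (poly_apply H T p x)" if x: "x \<in> carrier H" for x
  proof -
    have "d * (c * hnorm H x) \<le> d * hnorm H (poly_apply H T q x)"
      using c(2)[OF x] d(1) by simp
    also have "\<dots> \<le> hnorm H (poly_apply H T p x)"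
      using d(2)[of "poly_apply H T q x"] x by (simp add: q poly_apply_mult[OF Tb] lin del: mult_pCons_left)
    finally show ?thesis by (simp add: mult.assoc)
  qed
  then show ?case using c(1) d(1) by (intro exI[of _ "d * c"]) auto
qed

lemma op_norm_le:
  assumes "\<And>x. x \<in> carrier H \<Longrightarrow> hnorm H (T x) \<le> e * hnorm H x" "e \<ge> 0"
  shows "op_norm H T \<le> e"
  unfolding op_norm_def
proof (rule cSUP_least)
  show "{x \<in> carrier H. hnorm H x \<le> 1} \<noteq> {}"
    using hnorm_zero by (auto intro!: exI[of _ \<zero>])
  fix x assume "x \<in> {x \<in> carrier H. hnorm H x \<le> 1}"
  then show "hnorm H (T x) \<le> e"
    using assms(1)[of x] mult_left_mono[of "hnorm H x" 1 e] assms(2) by auto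
qed

lemma op_norm_bound:
  assumes T: "blin H H T"
  shows "0 \<le> op_norm H T" "x \<in> carrier H \<Longrightarrow> hnorm H (T x) \<le> op_norm H T * hnorm H x"
proof -
  obtain M where M: "M \<ge> 0" "\<And>x. x \<in> carrier H \<Longrightarrow> hnorm H (T x) \<le> M * hnorm H x"
    using blin_bound[OF T] by blast
  have bdd: "bdd_above ((\<lambda>x. hnorm H (T x)) ` {x \<in> carrier H. hnorm H x \<le> 1})"
  proof (rule bdd_aboveI2)
    fix x assume "x \<in> {x \<in> carrier H. hnorm H x \<le> 1}"
    then show "hnorm H (T x) \<le> M"
      using M(2)[of x] mult_left_mono[of "hnorm H x" 1 M] M(1) by auto
  qed
  have up: "hnorm H (T x) \<le> op_norm H T" if "x \<in> carrier H" "hnorm H x \<le> 1" for x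
    unfolding op_norm_def using bdd that by (intro cSUP_upper) auto
  show "0 \<le> op_norm H T"
    using order_trans[OF hnorm_nonneg[OF blin_closed[OF T, of \<zero>]] up[of \<zero>]] by simp
  assume x: "x \<in> carrier H"
  show "hnorm H (T x) \<le> op_norm H T * hnorm H x"
  proof (cases "hnorm H x = 0")
    case True
    then show ?thesis using M(2)[OF x] by simp
  next
    case False
    then have pos: "hnorm H x > 0" using x hnorm_nonneg[of x] by linarith
    define c where "c = complex_of_real (1 / hnorm H x)"
    have "hnorm H (T (c \<odot> x)) \<le> op_norm H T"
      using x pos by (intro up) (auto simp: hnorm_smult c_def norm_divide)
    then have "1 / hnorm H x * hnorm H (T x) \<le> op_norm H T"
      using x pos blin_closed[OF T x] by (simp add: blin_smult[OF T] hnorm_smult c_def norm_divide)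
    then show ?thesis using pos by (simp add: field_simps)
  qed
qed

text \<open>If \<open>N > e\<close>, then \<open>N\<^sup>2 - p\<^sup>2\<close> has no root on the spectrum, so \<open>N\<^sup>2 - p(T)\<^sup>2\<close> is bounded below,
  which pushes the norm of \<open>p(T)\<close> strictly below \<open>N\<close>.\<close>

lemma poly_apply_norm_aux:
  assumes T: "selfadjoint_op H T" and e: "e \<ge> 0"
    and N: "N = op_norm H (poly_apply H T (cpoly p))" and nz: "[:N\<^sup>2:] - p * p \<noteq> 0"
    and sp: "\<And>z. z \<in> spectrum H T \<Longrightarrow> \<exists>t. z = complex_of_real t \<and> \<bar>poly p t\<bar> \<le> e"
  shows "N \<le> e"
proof (rule ccontr)
  assume "\<not> N \<le> e"
  then have Ne: "N > e" by simp
  then have N0: "N > 0" using e by simp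
  have TB: "T \<in> carrier (BH H)" and TT: "adjoint_pair H H T T" using T by (auto simp: selfadjoint_op_iff)
  note Tb = BH_blin[OF TB]
  define G where "G = poly_apply H T (cpoly p)"
  have G: "adjoint_pair H H G G" unfolding G_def by (rule poly_apply_adjoint[OF TT])
  note GD = adjoint_pairD[OF G]
  note [simp] = blin_closed[OF GD(1)]
  define q where "q = [:N\<^sup>2:] - p * p"
  have root: "poly (cpoly q) z \<noteq> 0" if z: "z \<in> spectrum H T" for z
  proof -
    obtain t where t: "z = complex_of_real t" "\<bar>poly p t\<bar> \<le> e" using sp[OF z] by blast
    have "\<bar>poly p t\<bar>\<^sup>2 \<le> e\<^sup>2" using t(2) by (intro power_mono) auto
    also have "\<dots> < N\<^sup>2" using Ne e by (intro power_strict_mono) auto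
    finally have "poly q t \<noteq> 0" by (simp add: q_def power2_eq_square)
    then show ?thesis by (simp add: t(1) cpoly_hom)
  qed
  obtain c where c: "c > 0" "\<And>x. x \<in> carrier H \<Longrightarrow> c * hnorm H x \<le> hnorm H (poly_apply H T (cpoly q) x)"
    using poly_apply_bounded_below[OF TB _ root] nz unfolding q_def[symmetric] cpoly_hom(5) by blast
  \<comment> \<open>Expanding \<open>|N^2 x - G (G x)|^2\<close> and using
    \<open>|G (G x)| <= N |G x|\<close> leaves
    \<open>c^2 |x|^2 <= N^2 (N^2 |x|^2 - |G x|^2)\<close>. This gives a bound smaller than
    \<open>N\<close> for the norm of \<open>G\<close>; \<open>max 0\<close> covers a negative value
    under the root.\<close>
  have "hnorm H (G x) \<le> sqrt (max 0 (N\<^sup>2 - (c / N)\<^sup>2)) * hnorm H x" if x: "x \<in> carrier H" for x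
  proof -
    have "poly_apply H T (cpoly [:N\<^sup>2:]) x = complex_of_real (N\<^sup>2) \<odot> x"
      using x blin_zero[OF hilbert_space_axioms hilbert_space_axioms Tb]
      by (simp add: poly_apply_pCons[OF Tb] cpoly_hom poly_apply_0)
    then have "poly_apply H T (cpoly q) x = complex_of_real (N\<^sup>2) \<odot> x \<ominus> G (G x)"
      unfolding q_def using x by (simp only: cpoly_hom poly_apply_diff[OF Tb] poly_apply_mult[OF Tb] G_def)
    then have "(c * hnorm H x)\<^sup>2 \<le> (hnorm H (complex_of_real (N\<^sup>2) \<odot> x \<ominus> G (G x)))\<^sup>2"
      using c(2)[OF x] c(1) x by (intro power_mono) auto
    also have "\<dots> = (N\<^sup>2 * hnorm H x)\<^sup>2 - 2 * N\<^sup>2 * (hnorm H (G x))\<^sup>2 + (hnorm H (G (G x)))\<^sup>2"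
      using x GD(3)[of x "G x"] by (simp add: hnorm_minus_sq hnorm_smult ip_simps hnorm_sq[of "G x"] norm_power)
    also have "(hnorm H (G (G x)))\<^sup>2 \<le> (N * hnorm H (G x))\<^sup>2"
      using op_norm_bound(2)[OF GD(1), of "G x"] x by (intro power_mono) (auto simp: N G_def[symmetric])
    finally have "(c * hnorm H x)\<^sup>2 \<le> N\<^sup>2 * (N\<^sup>2 * (hnorm H x)\<^sup>2 - (hnorm H (G x))\<^sup>2)"
      by (simp add: power_mult_distrib algebra_simps power2_eq_square)
    then have "(hnorm H (G x))\<^sup>2 \<le> (N\<^sup>2 - (c / N)\<^sup>2) * (hnorm H x)\<^sup>2"
      using N0 by (simp add: power_mult_distrib power_divide field_simps)
    also have "\<dots> \<le> max 0 (N\<^sup>2 - (c / N)\<^sup>2) * (hnorm H x)\<^sup>2"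
      by (intro mult_right_mono) auto
    also have "\<dots> = (sqrt (max 0 (N\<^sup>2 - (c / N)\<^sup>2)) * hnorm H x)\<^sup>2"
      by (simp add: power_mult_distrib)
    finally show ?thesis
      using x by (intro power2_le_imp_le[of "hnorm H (G x)"]) simp_all
  qed
  then have "N \<le> sqrt (max 0 (N\<^sup>2 - (c / N)\<^sup>2))"
    unfolding N G_def[symmetric] by (rule op_norm_le) auto
  moreover have "sqrt (max 0 (N\<^sup>2 - (c / N)\<^sup>2)) < N"
    using N0 c(1) by (intro real_less_lsqrt) auto
  ultimately show False by simp
qed

text \<open>The estimate that makes the calculus well defined. The auxiliary lemma leaves out the
  case \<open>p * p = N^2\<close>, where \<open>p\<close> is a constant \<open>a\<close>: a point of
  the spectrum then gives \<open>|a| <= e\<close>, and an empty spectrum forces \<open>x\<close> to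
  be zero.\<close>

lemma poly_apply_norm_le:
  assumes T: "selfadjoint_op H T" and e: "e \<ge> 0"
    and sp: "\<And>z. z \<in> spectrum H T \<Longrightarrow> \<exists>t. z = complex_of_real t \<and> \<bar>poly p t\<bar> \<le> e"
    and x: "x \<in> carrier H"
  shows "hnorm H (poly_apply H T (cpoly p) x) \<le> e * hnorm H x"
proof -
  have TB: "T \<in> carrier (BH H)" using T by (auto simp: selfadjoint_op_iff)
  note Tb = BH_blin[OF TB]
  note [simp] = blin_closed[OF Tb]
  note T0 = blin_zero[OF hilbert_space_axioms hilbert_space_axioms Tb]
  show ?thesis
  proof (cases "[:(op_norm H (poly_apply H T (cpoly p)))\<^sup>2:] - p * p = 0")
    case False
    have "op_norm H (poly_apply H T (cpoly p)) \<le> e"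
      using poly_apply_norm_aux[OF T e refl False sp] .
    then show ?thesis
      using op_norm_bound(2)[OF poly_apply_blin[OF Tb] x, of "cpoly p"] mult_right_mono[OF _ hnorm_nonneg[OF x]] order_trans by blast
  next
    case True
    then have "Polynomial.degree (p * p) = 0" by (metis degree_pCons_0 eq_iff_diff_eq_0)
    then have "Polynomial.degree p = 0" by (cases "p = 0") (auto simp: degree_mult_eq)
    then obtain a where a: "p = [:a:]" by (metis degree_eq_zeroE)
    have pa: "poly_apply H T (cpoly p) x = complex_of_real a \<odot> x"
      using x by (simp add: a poly_apply_pCons[OF Tb] cpoly_hom poly_apply_0 T0)
    show ?thesis
    proof (cases "spectrum H T = {}")
      case False
      then have "\<bar>a\<bar> \<le> e" using sp by (auto simp: a)
      then show ?thesis using x by (simp add: pa hnorm_smult mult_right_mono)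
    next
      \<comment> \<open>With empty spectrum the auxiliary lemma, applied to the polynomial
        \<open>[:0, 1:]\<close> and the bound 0, gives \<open>T x = 0\<close>. But 0 is outside the
        spectrum, so \<open>T\<close> is bounded below and \<open>x\<close> vanishes.\<close>
      case sp0: True
      have "[:M:] - [:0, 1:] * [:0, 1:] \<noteq> (0 :: real poly)" for M by simp
      then have "op_norm H (poly_apply H T (cpoly [:0, 1:])) \<le> 0"
        by (intro poly_apply_norm_aux[OF T order_refl refl]) (auto simp: sp0)
      then have "hnorm H (poly_apply H T (cpoly [:0, 1:]) x) \<le> 0"
        using op_norm_bound(2)[OF poly_apply_blin[OF Tb] x, of "cpoly [:0, 1:]"] hnorm_nonneg[OF x]
        by (meson mult_nonpos_nonneg order_trans)
      moreover have "poly_apply H T (cpoly [:0, 1:]) x = T x"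
        using x by (auto intro!: ip_eqI simp: poly_apply_pCons[OF Tb] cpoly_hom poly_apply_0 T0 blin_smult[OF Tb] blin_add[OF Tb] ip_simps)
      ultimately have "hnorm H (T x) = 0" using x by (intro antisym) auto
      then have Tx: "T x = \<zero>" using x by (simp add: hnorm_eq_0)
      have "0 \<notin> spectrum H T" using sp0 by simp
      then obtain c where c: "c > 0" "c * hnorm H x \<le> hnorm H ((T \<ominus>\<^bsub>BH H\<^esub> (0 \<odot>\<^bsub>BH H\<^esub> \<one>\<^bsub>BH H\<^esub>)) x)"
        using Units_bounded_below x unfolding spectrum_def by (metis (mono_tags, lifting) mem_Collect_eq)
      moreover have "(T \<ominus>\<^bsub>BH H\<^esub> (0 \<odot>\<^bsub>BH H\<^esub> \<one>\<^bsub>BH H\<^esub>)) x = \<zero>"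
        using x by (intro ip_eqI) (auto simp: shift_BH(2)[OF TB] Tx ip_simps)
      ultimately have "c * hnorm H x \<le> 0" by simp
      then have "hnorm H x = 0" using c(1) x by (intro antisym) (auto simp: mult_le_0_iff)
      then show ?thesis using x by (simp add: pa hnorm_smult)
    qed
  qed
qed

end

section \<open>The continuous functional calculus\<close>

context hilbert_space
begin

text \<open>The restriction to \<open>e <= 1\<close> lets \<open>cfc_square\<close> bound its
  approximating polynomials independently of \<open>e\<close>.\<close>

lemma hnorm_small_imp_eq:
  assumes "x \<in> carrier H" "y \<in> carrier H" "C \<ge> 0" "\<And>e. e > 0 \<Longrightarrow> e \<le> 1 \<Longrightarrow> hnorm H (x \<ominus> y) \<le> e * C"
  shows "x = y"
proof -
  have "hnorm H (x \<ominus> y) \<le> 0 + e" if "e > 0" for e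
  proof -
    define d where "d = min 1 (e / (C + 1))"
    have d: "d > 0" "d \<le> 1" "d \<le> e / (C + 1)" using that assms(3) by (auto simp: d_def)
    have "hnorm H (x \<ominus> y) \<le> d * C" using assms(4) d by auto
    also have "\<dots> \<le> e / (C + 1) * C" using d assms(3) by (intro mult_right_mono) auto
    also have "\<dots> \<le> e" using assms(3) that by (simp add: field_simps)
    finally show ?thesis by simp
  qed
  then have "hnorm H (x \<ominus> y) \<le> 0" by (rule field_le_epsilon)
  then have "hnorm H (x \<ominus> y) = 0" using assms by (intro antisym) auto
  then have "x \<ominus> y = \<zero>" using assms by (simp add: hnorm_eq_0)
  then show ?thesis
    using assms ip_minus_left[of x y] by (intro ip_eqI) (auto simp: ip_zero_left)
qed

lemma poly_apply_close:
  assumes T: "selfadjoint_op H T" and sp: "spectrum_in H T J"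
    and close: "\<And>t. t \<in> J \<Longrightarrow> complex_of_real t \<in> spectrum H T \<Longrightarrow> \<bar>poly p t - poly q t\<bar> \<le> e" and e: "e \<ge> 0"
    and x: "x \<in> carrier H"
  shows "hnorm H (poly_apply H T (cpoly p) x \<ominus> poly_apply H T (cpoly q) x) \<le> e * hnorm H x"
proof -
  have Tb: "blin H H T" using T BH_blin by (auto simp: selfadjoint_op_iff)
  have "hnorm H (poly_apply H T (cpoly (p - q)) x) \<le> e * hnorm H x"
  proof (rule poly_apply_norm_le[OF T e _ x])
    fix z assume z: "z \<in> spectrum H T"
    then obtain t where "t \<in> J" "z = complex_of_real t" using sp by blast
    then show "\<exists>t. z = complex_of_real t \<and> \<bar>poly (p - q) t\<bar> \<le> e"
      using close[of t] z by auto
  qed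
  then show ?thesis by (simp add: cpoly_hom poly_apply_diff[OF Tb x])
qed

text \<open>The description in \<open>cfc\<close> quantifies over all polynomial sequences
  converging on the spectrum. One good polynomial for each \<open>e\<close> is enough, since
  \<open>poly_apply_close\<close> compares any other polynomial with it through its values on the
  spectrum.\<close>

lemma cfc_eqI:
  assumes T: "selfadjoint_op H T" and sp: "spectrum_in H T {a..b}" and S: "S \<in> carrier (BH H)"
    and approx: "\<And>e. e > 0 \<Longrightarrow> \<exists>p. (\<forall>t\<in>{a..b}. \<bar>poly p t - f t\<bar> \<le> e) \<and>
      (\<forall>x\<in>carrier H. hnorm H (poly_apply H T (cpoly p) x \<ominus> S x) \<le> e * hnorm H x)"
  shows "cfc H f T = S"
proof -
  have TB: "T \<in> carrier (BH H)" using T by (auto simp: selfadjoint_op_iff)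
  note Tb = BH_blin[OF TB]
  note [simp] = poly_apply_closed[OF Tb] BH_closed[OF S]
  define sig where "sig = {t. complex_of_real t \<in> spectrum H T}"
  have sig: "sig \<subseteq> {a..b}" using sp by (auto simp: sig_def)
  show ?thesis
    unfolding cfc_def sig_def[symmetric]
  proof (rule the_equality)
    show "S \<in> carrier (BH H) \<and> (\<forall>p. uniform_limit sig (\<lambda>n. poly (p n)) f sequentially \<longrightarrow>
        (\<lambda>n. op_norm H (op_poly H (p n) T \<ominus>\<^bsub>BH H\<^esub> S)) \<longlonglongrightarrow> 0)"
    proof (intro conjI allI impI S LIMSEQ_I)
      fix p :: "nat \<Rightarrow> real poly" and r :: real
      assume lim: "uniform_limit sig (\<lambda>n. poly (p n)) f sequentially" and r: "r > 0"
      \<comment> \<open>The error is \<open>3 * e < r\<close>: twice \<open>e\<close> between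
        \<open>p n\<close> and \<open>q\<close> on the spectrum, and once between
        \<open>q(T)\<close> and \<open>S\<close>.\<close>
      define e where "e = r / 4"
      have e: "e > 0" using r by (simp add: e_def)
      obtain q where q: "\<And>t. t \<in> {a..b} \<Longrightarrow> \<bar>poly q t - f t\<bar> \<le> e"
        "\<And>x. x \<in> carrier H \<Longrightarrow> hnorm H (poly_apply H T (cpoly q) x \<ominus> S x) \<le> e * hnorm H x"
        using approx[OF e] by blast
      obtain N where N: "\<And>n t. n \<ge> N \<Longrightarrow> t \<in> sig \<Longrightarrow> \<bar>poly (p n) t - f t\<bar> < e"
        using uniform_limitD[OF lim e] by (auto simp: eventually_sequentially dist_real_def)
      have "norm (op_norm H (op_poly H (p n) T \<ominus>\<^bsub>BH H\<^esub> S) - 0) < r" if n: "n \<ge> N" for n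
      proof -
        have B: "op_poly H (p n) T \<ominus>\<^bsub>BH H\<^esub> S \<in> carrier (BH H)"
          using TB S by (simp add: op_poly_BH)
        have "op_norm H (op_poly H (p n) T \<ominus>\<^bsub>BH H\<^esub> S) \<le> 3 * e"
        proof (rule op_norm_le)
          fix x assume x: "x \<in> carrier H"
          have "hnorm H (poly_apply H T (cpoly (p n)) x \<ominus> poly_apply H T (cpoly q) x) \<le> (2 * e) * hnorm H x"
          proof (rule poly_apply_close[OF T sp])
            fix t assume "t \<in> {a..b}" "complex_of_real t \<in> spectrum H T"
            then show "\<bar>poly (p n) t - poly q t\<bar> \<le> 2 * e"
              using N[OF n, of t] q(1)[of t] by (simp add: sig_def)
          qed (use e x in auto)
          then show "hnorm H ((op_poly H (p n) T \<ominus>\<^bsub>BH H\<^esub> S) x) \<le> 3 * e * hnorm H x"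
            using q(2)[OF x] x hnorm_diff_triangle[of "poly_apply H T (cpoly (p n)) x" "poly_apply H T (cpoly q) x" "S x"] TB S
            by (simp add: BH_minus_apply op_poly_BH)
        qed (use e in auto)
        moreover have "0 \<le> op_norm H (op_poly H (p n) T \<ominus>\<^bsub>BH H\<^esub> S)"
          by (rule op_norm_bound[OF BH_blin[OF B]])
        ultimately show ?thesis using r by (simp add: e_def)
      qed
      then show "\<exists>N. \<forall>n\<ge>N. norm (op_norm H (op_poly H (p n) T \<ominus>\<^bsub>BH H\<^esub> S) - 0) < r" by blast
    qed
  next
    \<comment> \<open>Uniqueness: \<open>approx\<close> at \<open>1 / (n + 1)\<close> yields one
      sequence to which the property of \<open>R\<close> applies, and the same sequence converges to
      \<open>S\<close>.\<close>
    fix R assume R: "R \<in> carrier (BH H) \<and> (\<forall>p. uniform_limit sig (\<lambda>n. poly (p n)) f sequentially \<longrightarrow>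
        (\<lambda>n. op_norm H (op_poly H (p n) T \<ominus>\<^bsub>BH H\<^esub> R)) \<longlonglongrightarrow> 0)"
    have "\<exists>p. (\<forall>t\<in>{a..b}. \<bar>poly p t - f t\<bar> \<le> 1 / real (Suc n)) \<and>
      (\<forall>x\<in>carrier H. hnorm H (poly_apply H T (cpoly p) x \<ominus> S x) \<le> 1 / real (Suc n) * hnorm H x)" for n
      by (rule approx) simp
    then obtain p where p: "\<And>n t. t \<in> {a..b} \<Longrightarrow> \<bar>poly (p n) t - f t\<bar> \<le> 1 / real (Suc n)"
      and pS: "\<And>n x. x \<in> carrier H \<Longrightarrow> hnorm H (poly_apply H T (cpoly (p n)) x \<ominus> S x) \<le> 1 / real (Suc n) * hnorm H x"
      by metis
    have "uniform_limit sig (\<lambda>n. poly (p n)) f sequentially"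
    proof (rule uniform_limitI)
      fix e :: real assume "e > 0"
      then obtain N where N: "1 / real (Suc N) < e" using nat_approx_posE by blast
      have "dist (poly (p n) t) (f t) < e" if "n \<ge> N" "t \<in> sig" for n t
      proof -
        have "1 / real (Suc n) \<le> 1 / real (Suc N)" using that by (simp add: frac_le)
        then show ?thesis using p[of t n] that sig N by (auto simp: dist_real_def)
      qed
      then show "\<forall>\<^sub>F n in sequentially. \<forall>x\<in>sig. dist (poly (p n) x) (f x) < e"
        by (auto simp: eventually_sequentially)
    qed
    then have lim: "(\<lambda>n. op_norm H (op_poly H (p n) T \<ominus>\<^bsub>BH H\<^esub> R)) \<longlonglongrightarrow> 0" using R by blast
    have RB: "R \<in> carrier (BH H)" using R by blast
    note [simp] = BH_closed[OF RB]
    show "R = S"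
    proof (rule BH_eqI[OF RB S])
      fix x assume x: "x \<in> carrier H"
      have "hnorm H (R x \<ominus> S x) \<le> (op_norm H (op_poly H (p n) T \<ominus>\<^bsub>BH H\<^esub> R) + 1 / real (Suc n)) * hnorm H x" for n
      proof -
        have B: "op_poly H (p n) T \<ominus>\<^bsub>BH H\<^esub> R \<in> carrier (BH H)"
          using TB RB by (simp add: op_poly_BH)
        have "hnorm H (poly_apply H T (cpoly (p n)) x \<ominus> R x) \<le> op_norm H (op_poly H (p n) T \<ominus>\<^bsub>BH H\<^esub> R) * hnorm H x"
          using op_norm_bound(2)[OF BH_blin[OF B] x] x TB RB by (simp add: BH_minus_apply op_poly_BH)
        then show ?thesis
          using pS[OF x, of n] x hnorm_diff_triangle[of "R x" "poly_apply H T (cpoly (p n)) x" "S x"]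
            hnorm_minus_commute[of "R x" "poly_apply H T (cpoly (p n)) x"] by (simp add: distrib_right)
      qed
      moreover have "(\<lambda>n. (op_norm H (op_poly H (p n) T \<ominus>\<^bsub>BH H\<^esub> R) + 1 / real (Suc n)) * hnorm H x) \<longlonglongrightarrow> (0 + 0) * hnorm H x"
        using LIMSEQ_inverse_real_of_nat by (intro tendsto_intros lim) (simp add: inverse_eq_divide)
      ultimately have "hnorm H (R x \<ominus> S x) \<le> 0"
        using LIMSEQ_le_const[of _ "(0 + 0) * hnorm H x" "hnorm H (R x \<ominus> S x)"] by auto
      then show "R x = S x"
        using x by (intro hnorm_small_imp_eq[of _ _ 0]) auto
    qed
  qed
qed

text \<open>Completeness is available for vectors, so the limit of \<open>p_n(T) x\<close> is taken
  for each \<open>x\<close> separately. Letting \<open>m\<close> tend to infinity in the Cauchy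
  estimate \<open>Pd\<close> makes the error \<open>1 / (n + 1)\<close> uniform in \<open>x\<close>,
  and linearity of the limit is read off from inner products.\<close>

lemma cfc_exists:
  assumes T: "selfadjoint_op H T" and sp: "spectrum_in H T {a..b}" and f: "continuous_on {a..b} f"
  shows "\<exists>S. S \<in> carrier (BH H) \<and> (\<forall>e>0. \<exists>p. (\<forall>t\<in>{a..b}. \<bar>poly p t - f t\<bar> \<le> e) \<and>
      (\<forall>x\<in>carrier H. hnorm H (poly_apply H T (cpoly p) x \<ominus> S x) \<le> e * hnorm H x))"
proof -
  have TB: "T \<in> carrier (BH H)" using T by (auto simp: selfadjoint_op_iff)
  note Tb = BH_blin[OF TB]
  note [simp] = poly_apply_closed[OF Tb]
  have "\<exists>p. \<forall>t\<in>{a..b}. \<bar>poly p t - f t\<bar> \<le> 1 / real (Suc n)" for n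
    using weierstrass_poly[OF f, of "1 / real (Suc n)"] by (metis of_nat_0_less_iff zero_less_Suc zero_less_divide_1_iff)
  then obtain p where p: "\<And>n t. t \<in> {a..b} \<Longrightarrow> \<bar>poly (p n) t - f t\<bar> \<le> 1 / real (Suc n)"
    by metis
  define P where "P n x = poly_apply H T (cpoly (p n)) x" for n x
  have Pcl [simp]: "P n x \<in> carrier H" if "x \<in> carrier H" for n x using that by (simp add: P_def)
  have Pd: "hnorm H (P n x \<ominus> P m x) \<le> (1 / real (Suc n) + 1 / real (Suc m)) * hnorm H x" if x: "x \<in> carrier H" for n m x
    unfolding P_def
  proof (rule poly_apply_close[OF T sp _ _ x])
    fix t assume "t \<in> {a..b}"
    then show "\<bar>poly (p n) t - poly (p m) t\<bar> \<le> 1 / real (Suc n) + 1 / real (Suc m)"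
      using p[of t n] p[of t m] by linarith
  qed simp
  have "\<exists>l\<in>carrier H. (\<lambda>n. hnorm H (P n x \<ominus> l)) \<longlonglongrightarrow> 0" if x: "x \<in> carrier H" for x
  proof (rule complete)
    fix e :: real assume e: "e > 0"
    define C where "C = hnorm H x + 1"
    define d where "d = e / (2 * C)"
    have pos: "0 < C" using hnorm_nonneg[OF x] by (simp add: C_def)
    then have "d > 0" using e by (simp add: d_def)
    then obtain N where N: "1 / real (Suc N) < d" using nat_approx_posE by blast
    have "hnorm H (P m x \<ominus> P n x) < e" if "m \<ge> N" "n \<ge> N" for m n
    proof -
      have "1 / real (Suc m) \<le> 1 / real (Suc N)" "1 / real (Suc n) \<le> 1 / real (Suc N)"
        using that by (simp_all add: frac_le)
      then have "1 / real (Suc m) + 1 / real (Suc n) \<le> 2 * d" using N by linarith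
      then have "hnorm H (P m x \<ominus> P n x) \<le> 2 * d * hnorm H x"
        using Pd[OF x, of m n] x by (meson hnorm_nonneg mult_right_mono order_trans)
      also have "\<dots> < 2 * d * C" using \<open>d > 0\<close> by (simp add: C_def)
      also have "\<dots> = e" using pos by (simp add: d_def)
      finally show ?thesis .
    qed
    then show "\<exists>N. \<forall>m\<ge>N. \<forall>n\<ge>N. hnorm H (P m x \<ominus> P n x) < e" by blast
  qed (use x in simp)
  then obtain L where L [simp]: "\<And>x. x \<in> carrier H \<Longrightarrow> L x \<in> carrier H"
    and lim: "\<And>x. x \<in> carrier H \<Longrightarrow> (\<lambda>n. hnorm H (P n x \<ominus> L x)) \<longlonglongrightarrow> 0"
    by metis
  have PL: "hnorm H (P n x \<ominus> L x) \<le> 1 / real (Suc n) * hnorm H x" if x: "x \<in> carrier H" for n x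
  proof (rule LIMSEQ_le_const)
    show "(\<lambda>m. (1 / real (Suc n) + 1 / real (Suc m)) * hnorm H x + hnorm H (P m x \<ominus> L x)) \<longlonglongrightarrow> 1 / real (Suc n) * hnorm H x"
    proof -
      have "(\<lambda>m. (1 / real (Suc n) + 1 / real (Suc m)) * hnorm H x + hnorm H (P m x \<ominus> L x)) \<longlonglongrightarrow> (1 / real (Suc n) + 0) * hnorm H x + 0"
        using LIMSEQ_inverse_real_of_nat by (intro tendsto_intros lim x) (simp add: inverse_eq_divide)
      then show ?thesis by simp
    qed
    have "hnorm H (P n x \<ominus> L x) \<le> (1 / real (Suc n) + 1 / real (Suc m)) * hnorm H x + hnorm H (P m x \<ominus> L x)" for m
      using hnorm_diff_triangle[of "P n x" "P m x" "L x"] Pd[OF x, of n m] x by simp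
    then show "\<exists>N. \<forall>m\<ge>N. hnorm H (P n x \<ominus> L x) \<le> (1 / real (Suc n) + 1 / real (Suc m)) * hnorm H x + hnorm H (P m x \<ominus> L x)"
      by blast
  qed
  have iplim: "(\<lambda>n. ip H (P n x) z) \<longlonglongrightarrow> ip H (L x) z" if x: "x \<in> carrier H" and z: "z \<in> carrier H" for x z
  proof -
    have "(\<lambda>n. ip H (P n x) z - ip H (L x) z) \<longlonglongrightarrow> 0"
    proof (rule Lim_null_comparison)
      show "(\<lambda>n. hnorm H (P n x \<ominus> L x) * hnorm H z) \<longlonglongrightarrow> 0"
        using tendsto_mult_left_zero[OF lim[OF x]] by simp
      show "\<forall>\<^sub>F n in sequentially. norm (ip H (P n x) z - ip H (L x) z) \<le> hnorm H (P n x \<ominus> L x) * hnorm H z"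
        using cauchy_schwarz[of "P _ x \<ominus> L x" z] x z by (simp add: ip_minus_left)
    qed
    then show ?thesis by (simp add: LIM_zero_iff)
  qed
  note Pb = poly_apply_blin[OF Tb, of "cpoly (p _)", folded P_def[abs_def]]
  obtain M where M: "M \<ge> 0" "\<And>x. x \<in> carrier H \<Longrightarrow> hnorm H (P 0 x) \<le> M * hnorm H x"
    using blin_bound[OF Pb[of 0]] by (auto simp: P_def)
  have Lb: "blin H H L"
    unfolding blin_def
  proof (intro conjI ballI allI exI[of _ "M + 1"])
    show "L (x \<oplus> y) = L x \<oplus> L y" if xy: "x \<in> carrier H" "y \<in> carrier H" for x y
    proof (rule ip_eqI)
      fix z assume z: "z \<in> carrier H"
      have "(\<lambda>n. ip H (P n (x \<oplus> y)) z) \<longlonglongrightarrow> ip H (L x \<oplus> L y) z"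
        using tendsto_add[OF iplim[of x z] iplim[of y z]] xy z
        by (simp add: P_def blin_add[OF poly_apply_blin[OF Tb]] ip_simps)
      then show "ip H (L (x \<oplus> y)) z = ip H (L x \<oplus> L y) z"
        using iplim[of "x \<oplus> y" z] xy z LIMSEQ_unique by blast
    qed (use xy in auto)
    show "L (a \<odot> x) = a \<odot> L x" if x: "x \<in> carrier H" for a x
    proof (rule ip_eqI)
      fix z assume z: "z \<in> carrier H"
      have "(\<lambda>n. ip H (P n (a \<odot> x)) z) \<longlonglongrightarrow> ip H (a \<odot> L x) z"
        using tendsto_mult_left[OF iplim[of x z], of a] x z
        by (simp add: P_def blin_smult[OF poly_apply_blin[OF Tb]] ip_simps)
      then show "ip H (L (a \<odot> x)) z = ip H (a \<odot> L x) z"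
        using iplim[of "a \<odot> x" z] x z LIMSEQ_unique by blast
    qed (use x in auto)
    show "hnorm H (L x) \<le> (M + 1) * hnorm H x" if x: "x \<in> carrier H" for x
      using hnorm_triangle_minus[of "L x" "P 0 x"] hnorm_minus_commute[of "L x" "P 0 x"] PL[OF x, of 0] M(2)[OF x] x
      by (simp add: distrib_right)
  qed (use M in auto)
  define S where "S = restrict L (carrier H)"
  have "S \<in> carrier (BH H)" unfolding S_def by (rule restrict_BH[OF Lb])
  moreover have "\<exists>p. (\<forall>t\<in>{a..b}. \<bar>poly p t - f t\<bar> \<le> e) \<and>
      (\<forall>x\<in>carrier H. hnorm H (poly_apply H T (cpoly p) x \<ominus> S x) \<le> e * hnorm H x)" if "e > 0" for e
  proof -
    obtain N where N: "1 / real (Suc N) < e" using nat_approx_posE \<open>e > 0\<close> by blast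
    have "hnorm H (poly_apply H T (cpoly (p N)) x \<ominus> S x) \<le> e * hnorm H x" if x: "x \<in> carrier H" for x
      using order_trans[OF PL[OF x, of N] mult_right_mono[OF less_imp_le[OF N] hnorm_nonneg[OF x]]] x
      by (simp add: P_def S_def)
    moreover have "\<bar>poly (p N) t - f t\<bar> \<le> e" if "t \<in> {a..b}" for t
      using p[OF that, of N] N by linarith
    ultimately show ?thesis by blast
  qed
  ultimately show ?thesis by blast
qed

text \<open>Together with \<open>cfc_eqI\<close> this is the interface to the calculus; the definite
  description is not unfolded again.\<close>

lemma cfc_approx:
  assumes T: "selfadjoint_op H T" and sp: "spectrum_in H T {a..b}" and f: "continuous_on {a..b} f"
  shows "cfc H f T \<in> carrier (BH H)"
    "e > 0 \<Longrightarrow> \<exists>p. (\<forall>t\<in>{a..b}. \<bar>poly p t - f t\<bar> \<le> e) \<and>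
      (\<forall>x\<in>carrier H. hnorm H (poly_apply H T (cpoly p) x \<ominus> cfc H f T x) \<le> e * hnorm H x)"
proof -
  obtain S where S: "S \<in> carrier (BH H)" "\<And>e. e > 0 \<Longrightarrow> \<exists>p. (\<forall>t\<in>{a..b}. \<bar>poly p t - f t\<bar> \<le> e) \<and>
      (\<forall>x\<in>carrier H. hnorm H (poly_apply H T (cpoly p) x \<ominus> S x) \<le> e * hnorm H x)"
    using cfc_exists[OF assms] by blast
  have "cfc H f T = S" by (rule cfc_eqI[OF T sp S])
  then show "cfc H f T \<in> carrier (BH H)" "e > 0 \<Longrightarrow> \<exists>p. (\<forall>t\<in>{a..b}. \<bar>poly p t - f t\<bar> \<le> e) \<and>
      (\<forall>x\<in>carrier H. hnorm H (poly_apply H T (cpoly p) x \<ominus> cfc H f T x) \<le> e * hnorm H x)"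
    using S by auto
qed

lemma cfc_close:
  assumes T: "selfadjoint_op H T" and sp: "spectrum_in H T {a..b}"
    and f: "continuous_on {a..b} f" and g: "continuous_on {a..b} g"
    and e: "e \<ge> 0" and fg: "\<And>t. t \<in> {a..b} \<Longrightarrow> \<bar>f t - g t\<bar> \<le> e" and x: "x \<in> carrier H"
  shows "hnorm H (cfc H f T x \<ominus> cfc H g T x) \<le> e * hnorm H x"
proof -
  have Tb: "blin H H T" using T BH_blin by (auto simp: selfadjoint_op_iff)
  note [simp] = poly_apply_closed[OF Tb] BH_closed[OF cfc_approx(1)[OF T sp f]] BH_closed[OF cfc_approx(1)[OF T sp g]]
  \<comment> \<open>Of the slack \<open>4 * d\<close>, half replaces \<open>f\<close> and
    \<open>g\<close> by polynomials in the scalar bound, and one \<open>d\<close> goes to each of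
    the two operator errors.\<close>
  have *: "hnorm H (cfc H f T x \<ominus> cfc H g T x) \<le> (e + 4 * d) * hnorm H x" if d: "d > 0" for d
  proof -
    obtain p q where p: "\<And>t. t \<in> {a..b} \<Longrightarrow> \<bar>poly p t - f t\<bar> \<le> d" "hnorm H (poly_apply H T (cpoly p) x \<ominus> cfc H f T x) \<le> d * hnorm H x"
      and q: "\<And>t. t \<in> {a..b} \<Longrightarrow> \<bar>poly q t - g t\<bar> \<le> d" "hnorm H (poly_apply H T (cpoly q) x \<ominus> cfc H g T x) \<le> d * hnorm H x"
      using cfc_approx(2)[OF T sp f d] cfc_approx(2)[OF T sp g d] x by metis
    have "hnorm H (poly_apply H T (cpoly p) x \<ominus> poly_apply H T (cpoly q) x) \<le> (e + 2 * d) * hnorm H x"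
    proof (rule poly_apply_close[OF T sp _ _ x])
      fix t assume "t \<in> {a..b}"
      then show "\<bar>poly p t - poly q t\<bar> \<le> e + 2 * d" using p(1)[of t] q(1)[of t] fg[of t] by linarith
    qed (use e d in auto)
    then show ?thesis
      using p(2) q(2) x hnorm_diff_triangle[of "cfc H f T x" "poly_apply H T (cpoly p) x" "cfc H g T x"]
        hnorm_diff_triangle[of "poly_apply H T (cpoly p) x" "poly_apply H T (cpoly q) x" "cfc H g T x"]
        hnorm_minus_commute[of "poly_apply H T (cpoly p) x" "cfc H f T x"]
      by (simp add: distrib_right)
  qed
  show ?thesis
  proof (rule field_le_epsilon)
    fix r :: real assume r: "r > 0"
    define C where "C = hnorm H x + 1"
    have pos: "0 < C" using hnorm_nonneg[OF x] by (simp add: C_def)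
    define d where "d = r / (4 * C)"
    have "d > 0" using r pos by (simp add: d_def)
    then have "hnorm H (cfc H f T x \<ominus> cfc H g T x) \<le> e * hnorm H x + 4 * d * hnorm H x"
      using *[of d] by (simp add: distrib_right)
    also have "4 * d * hnorm H x \<le> 4 * d * C" using \<open>d > 0\<close> by (simp add: C_def)
    also have "\<dots> = r" using pos by (simp add: d_def)
    finally show "hnorm H (cfc H f T x \<ominus> cfc H g T x) \<le> e * hnorm H x + r" by simp
  qed
qed

section \<open>Rules of the calculus: self-adjointness, intertwining, substitution, squares,
  positivity\<close>

lemma cfc_poly:
  assumes T: "selfadjoint_op H T" and sp: "spectrum_in H T {a..b}" and x: "x \<in> carrier H"
  shows "cfc H (poly p) T x = poly_apply H T (cpoly p) x"
proof -
  have TB: "T \<in> carrier (BH H)" using T by (auto simp: selfadjoint_op_iff)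
  have "cfc H (poly p) T = op_poly H p T"
    using TB by (intro cfc_eqI[OF T sp] exI[of _ p]) (auto simp: op_poly_BH r_neg a_minus_def poly_apply_closed BH_blin)
  then show ?thesis using op_poly_BH[OF TB] x by simp
qed

lemma cfc_poly_apply_close:
  assumes T: "selfadjoint_op H T" and sp: "spectrum_in H T {a..b}" and f: "continuous_on {a..b} f"
    and e: "e \<ge> 0" and p: "\<And>t. t \<in> {a..b} \<Longrightarrow> \<bar>poly p t - f t\<bar> \<le> e" and x: "x \<in> carrier H"
  shows "hnorm H (poly_apply H T (cpoly p) x \<ominus> cfc H f T x) \<le> e * hnorm H x"
  using cfc_close[where f = "poly p" and g = f, OF T sp _ f e p x] by (simp add: cfc_poly[OF T sp x] continuous_intros)

lemma cfc_selfadjoint: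
  assumes T: "selfadjoint_op H T" and sp: "spectrum_in H T {a..b}" and f: "continuous_on {a..b} f"
  shows "selfadjoint_op H (cfc H f T)"
proof -
  have TT: "adjoint_pair H H T T" using T by (simp add: selfadjoint_op_iff)
  note S = cfc_approx(1)[OF T sp f]
  note [simp] = poly_apply_closed[OF adjoint_pairD(1)[OF TT]] BH_closed[OF S]
  have "ip H (cfc H f T x) y = ip H x (cfc H f T y)" if x: "x \<in> carrier H" and y: "y \<in> carrier H" for x y
  proof -
    have "cmod (ip H (cfc H f T x) y - ip H x (cfc H f T y)) \<le> 0 + r" if r: "r > 0" for r
    proof -
      define C where "C = hnorm H x * hnorm H y + 1"
      have pos: "0 < C" using hnorm_nonneg[OF x] hnorm_nonneg[OF y] by (simp add: C_def add_nonneg_pos)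
      define e where "e = r / (2 * C)"
      have e: "e > 0" using r pos by (simp add: e_def)
      obtain p where p: "\<And>x. x \<in> carrier H \<Longrightarrow> hnorm H (poly_apply H T (cpoly p) x \<ominus> cfc H f T x) \<le> e * hnorm H x"
        using cfc_approx(2)[OF T sp f e] by blast
      have 1: "cmod (ip H (poly_apply H T (cpoly p) x \<ominus> cfc H f T x) y) \<le> (e * hnorm H x) * hnorm H y"
        using x y p[OF x] by (intro order_trans[OF cauchy_schwarz] mult_right_mono) auto
      have 2: "cmod (ip H x (poly_apply H T (cpoly p) y \<ominus> cfc H f T y)) \<le> hnorm H x * (e * hnorm H y)"
        using x y p[OF y] by (intro order_trans[OF cauchy_schwarz] mult_left_mono) auto
      have "ip H (cfc H f T x) y - ip H x (cfc H f T y) =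
        ip H x (poly_apply H T (cpoly p) y \<ominus> cfc H f T y) - ip H (poly_apply H T (cpoly p) x \<ominus> cfc H f T x) y"
        using x y adjoint_pairD(3)[OF poly_apply_adjoint[OF TT, of p], of x y] by (simp add: ip_simps)
      then have "cmod (ip H (cfc H f T x) y - ip H x (cfc H f T y)) \<le> 2 * e * (hnorm H x * hnorm H y)"
        using 1 2 norm_triangle_ineq4[of "ip H x (poly_apply H T (cpoly p) y \<ominus> cfc H f T y)" "ip H (poly_apply H T (cpoly p) x \<ominus> cfc H f T x) y"]
        by (simp add: mult_ac)
      also have "\<dots> \<le> 2 * e * C" using e by (simp add: C_def)
      also have "\<dots> = r" using pos by (simp add: e_def)
      finally show ?thesis by simp
    qed
    then have "cmod (ip H (cfc H f T x) y - ip H x (cfc H f T y)) \<le> 0" by (rule field_le_epsilon)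
    then show ?thesis by simp
  qed
  then show ?thesis
    using S BH_blin[OF S] by (simp add: selfadjoint_op_iff adjoint_pair_def)
qed

text \<open>The common interval allows the same polynomial for \<open>T\<close> and
  \<open>S\<close>, and boundedness of \<open>W\<close> carries the limit. With \<open>W\<close> an
  inclusion this computes \<open>f\<close> of a block-diagonal operator; with the isometric dilation
  it gives \<open>f(B) W = W f(Z + e)\<close>.\<close>

lemma cfc_intertwine:
  assumes T: "selfadjoint_op H T" and sp: "spectrum_in H T {a..b}"
    and K: "hilbert_space K" and S: "selfadjoint_op K S" and spS: "spectrum_in K S {a..b}"
    and f: "continuous_on {a..b} f" and W: "blin H K W"
    and int: "\<And>x. x \<in> carrier H \<Longrightarrow> S (W x) = W (T x)" and x: "x \<in> carrier H"
  shows "cfc K f S (W x) = W (cfc H f T x)"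
proof -
  interpret K: hilbert_space K by fact
  have Tb: "blin H H T" using T BH_blin by (auto simp: selfadjoint_op_iff)
  have Sb: "blin K K S" using S K.BH_blin by (auto simp: K.selfadjoint_op_iff)
  note [simp] = poly_apply_closed[OF Tb] K.poly_apply_closed[OF Sb] BH_closed[OF cfc_approx(1)[OF T sp f]]
    K.BH_closed[OF K.cfc_approx(1)[OF S spS f]] blin_closed[OF W]
  obtain M where M: "M \<ge> 0" "\<And>x. x \<in> carrier H \<Longrightarrow> hnorm K (W x) \<le> M * hnorm H x"
    using blin_bound[OF W] by blast
  show ?thesis
  proof (rule K.hnorm_small_imp_eq)
    show "0 \<le> 2 * M * hnorm H x" using M x by simp
    fix e :: real assume e: "e > 0"
    obtain p where p: "\<And>t. t \<in> {a..b} \<Longrightarrow> \<bar>poly p t - f t\<bar> \<le> e"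
      using weierstrass_poly[OF f e] by blast
    have 1: "hnorm K (poly_apply K S (cpoly p) (W x) \<ominus>\<^bsub>K\<^esub> cfc K f S (W x)) \<le> e * (M * hnorm H x)"
      using K.cfc_poly_apply_close[OF S spS f less_imp_le[OF e] p, of "W x"] M(2)[OF x] x e
      by (smt (verit) blin_closed[OF W] mult_left_mono)
    have "hnorm K (W (poly_apply H T (cpoly p) x \<ominus> cfc H f T x)) \<le> M * hnorm H (poly_apply H T (cpoly p) x \<ominus> cfc H f T x)"
      using x by (intro M(2)) auto
    also have "\<dots> \<le> M * (e * hnorm H x)"
      using cfc_poly_apply_close[OF T sp f less_imp_le[OF e] p x] M(1) by (intro mult_left_mono) auto
    finally have "hnorm K (poly_apply K S (cpoly p) (W x) \<ominus>\<^bsub>K\<^esub> W (cfc H f T x)) \<le> M * (e * hnorm H x)"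
      using x by (simp add: blin_minus[OF hilbert_space_axioms K W] poly_apply_intertwine[OF K Tb Sb W int])
    then show "hnorm K (cfc K f S (W x) \<ominus>\<^bsub>K\<^esub> W (cfc H f T x)) \<le> e * (2 * M * hnorm H x)"
      using 1 x K.hnorm_diff_triangle[of "cfc K f S (W x)" "poly_apply K S (cpoly p) (W x)" "W (cfc H f T x)"]
        K.hnorm_minus_commute[of "cfc K f S (W x)" "poly_apply K S (cpoly p) (W x)"]
      by (simp add: mult_ac)
  qed (use x in auto)
qed

text \<open>Used with \<open>r = 0\<close> for scaling and with \<open>s = 1\<close> for the shift
  by \<open>e\<close>, which explains integrands written as \<open>f (0 + 1 / 2 * t)\<close> and
  \<open>f (e + 1 * t)\<close>.\<close>

lemma cfc_affine:
  assumes T: "selfadjoint_op H T" and sp: "spectrum_in H T {a..b}"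
    and S: "selfadjoint_op H S" and spS: "spectrum_in H S {a'..b'}"
    and f: "continuous_on {a'..b'} f"
    and Sx: "\<And>x. x \<in> carrier H \<Longrightarrow> S x = complex_of_real r \<odot> x \<oplus> complex_of_real s \<odot> T x"
    and ab: "\<And>t. t \<in> {a..b} \<Longrightarrow> r + s * t \<in> {a'..b'}" and x: "x \<in> carrier H"
  shows "cfc H f S x = cfc H (\<lambda>t. f (r + s * t)) T x"
proof -
  have Tb: "blin H H T" using T BH_blin by (auto simp: selfadjoint_op_iff)
  have Sb: "blin H H S" using S BH_blin by (auto simp: selfadjoint_op_iff)
  have g: "continuous_on {a..b} (\<lambda>t. f (r + s * t))"
    using ab by (intro continuous_on_compose2[OF f]) (auto intro!: continuous_intros)
  note [simp] = poly_apply_closed[OF Tb] poly_apply_closed[OF Sb] BH_closed[OF cfc_approx(1)[OF T sp g]]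
    BH_closed[OF cfc_approx(1)[OF S spS f]] blin_closed[OF Tb] blin_closed[OF Sb]
  have T0: "T \<zero> = \<zero>" by (rule blin_zero[OF hilbert_space_axioms hilbert_space_axioms Tb])
  show ?thesis
  proof (rule hnorm_small_imp_eq)
    show "0 \<le> 2 * hnorm H x" using x by simp
    fix e :: real assume e: "e > 0"
    obtain p where p: "\<And>t. t \<in> {a'..b'} \<Longrightarrow> \<bar>poly p t - f t\<bar> \<le> e"
      using weierstrass_poly[OF f e] by blast
    define q where "q = pcompose p [:r, s:]"
    have q: "\<bar>poly q t - f (r + s * t)\<bar> \<le> e" if "t \<in> {a..b}" for t
      using p[OF ab[OF that]] by (simp add: q_def poly_pcompose mult.commute)
    have lin: "poly_apply H T (cpoly [:r, s:]) y = S y" if y: "y \<in> carrier H" for y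
      using y by (intro ip_eqI) (auto simp: cpoly_hom poly_apply_pCons[OF Tb] poly_apply_0 Sx T0 blin_smult[OF Tb] blin_add[OF Tb] ip_simps)
    have "poly_apply H T (cpoly q) x = poly_apply H S (cpoly p) x"
      unfolding q_def cpoly_pcompose poly_apply_comp[OF Tb x]
      by (rule poly_apply_cong[OF poly_apply_blin[OF Tb] Sb lin x])
    then show "hnorm H (cfc H f S x \<ominus> cfc H (\<lambda>t. f (r + s * t)) T x) \<le> e * (2 * hnorm H x)"
      using cfc_poly_apply_close[OF T sp g less_imp_le[OF e] q x] cfc_poly_apply_close[OF S spS f less_imp_le[OF e] p x] x
        hnorm_diff_triangle[of "cfc H f S x" "poly_apply H S (cpoly p) x" "cfc H (\<lambda>t. f (r + s * t)) T x"]
        hnorm_minus_commute[of "cfc H f S x" "poly_apply H S (cpoly p) x"]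
      by simp
  qed (use x in auto)
qed

text \<open>This instance of multiplicativity turns a square root of a function into a square root
  of an operator, for \<open>cfc_nonneg\<close> and for the defect operator of a
  contraction.\<close>

lemma cfc_square:
  assumes T: "selfadjoint_op H T" and sp: "spectrum_in H T {a..b}" and f: "continuous_on {a..b} f"
    and x: "x \<in> carrier H"
  shows "cfc H (\<lambda>t. f t * f t) T x = cfc H f T (cfc H f T x)"
proof -
  have Tb: "blin H H T" using T BH_blin by (auto simp: selfadjoint_op_iff)
  have ff: "continuous_on {a..b} (\<lambda>t. f t * f t)" using f by (intro continuous_intros)
  note fB = cfc_approx(1)[OF T sp f]
  note [simp] = poly_apply_closed[OF Tb] BH_closed[OF fB] BH_closed[OF cfc_approx(1)[OF T sp ff]]
  have "bounded (f ` {a..b})" using f by (intro compact_imp_bounded compact_continuous_image) auto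
  then obtain M where M: "M \<ge> 0" "\<And>t. t \<in> {a..b} \<Longrightarrow> \<bar>f t\<bar> \<le> M"
    unfolding bounded_iff by (metis abs_ge_zero imageI order_trans real_norm_def abs_ge_self)
  obtain N where N: "N \<ge> 0" "\<And>x. x \<in> carrier H \<Longrightarrow> hnorm H (cfc H f T x) \<le> N * hnorm H x"
    using blin_bound[OF BH_blin[OF fB]] by blast
  show ?thesis
  proof (rule hnorm_small_imp_eq)
    show "0 \<le> ((2 * M + 1) + (M + 1) + N) * hnorm H x" using M N x by simp
    fix e :: real assume e: "e > 0" "e \<le> 1"
    obtain p where p: "\<And>t. t \<in> {a..b} \<Longrightarrow> \<bar>poly p t - f t\<bar> \<le> e"
      using weierstrass_poly[OF f e(1)] by blast
    have pM: "\<bar>poly p t\<bar> \<le> M + 1" if "t \<in> {a..b}" for t using p[OF that] M(2)[OF that] e by linarith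
    have pp: "\<bar>poly (p * p) t - f t * f t\<bar> \<le> e * (2 * M + 1)" if t: "t \<in> {a..b}" for t
    proof -
      have "poly (p * p) t - f t * f t = (poly p t - f t) * (poly p t + f t)" by (simp add: algebra_simps)
      also have "\<bar>\<dots>\<bar> \<le> e * (2 * M + 1)"
        unfolding abs_mult using p[OF t] pM[OF t] M(2)[OF t] e by (intro mult_mono) auto
      finally show ?thesis .
    qed
    define A where "A = poly_apply H T (cpoly p)"
    have [simp]: "A y \<in> carrier H" if "y \<in> carrier H" for y using that by (simp add: A_def)
    \<comment> \<open>Three errors: \<open>p * p\<close> against \<open>f * f\<close>, then
      \<open>f(T)\<close> for \<open>p(T)\<close> in the inner factor, where \<open>M + 1\<close>
      bounds the norm of the outer one, and last in the outer factor.\<close>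
    have 1: "hnorm H (A (A x) \<ominus> cfc H (\<lambda>t. f t * f t) T x) \<le> e * (2 * M + 1) * hnorm H x"
      using cfc_poly_apply_close[OF T sp ff _ pp x] e M(1) x by (simp add: cpoly_hom poly_apply_mult[OF Tb] A_def)
    have pe: "hnorm H (A y \<ominus> cfc H f T y) \<le> e * hnorm H y" if "y \<in> carrier H" for y
      using cfc_poly_apply_close[OF T sp f less_imp_le[OF e(1)] p that] by (simp add: A_def)
    have "hnorm H (A (A x \<ominus> cfc H f T x)) \<le> (M + 1) * hnorm H (A x \<ominus> cfc H f T x)"
      unfolding A_def
    proof (rule poly_apply_norm_le[OF T])
      fix z assume "z \<in> spectrum H T"
      then show "\<exists>t. z = complex_of_real t \<and> \<bar>poly p t\<bar> \<le> M + 1" using sp pM by blast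
    qed (use M(1) x in \<open>auto simp: A_def[symmetric]\<close>)
    also have "\<dots> \<le> (M + 1) * (e * hnorm H x)"
      using pe[OF x] M(1) by (intro mult_left_mono) auto
    finally have 2: "hnorm H (A (A x) \<ominus> A (cfc H f T x)) \<le> (M + 1) * (e * hnorm H x)"
      using x by (simp add: A_def blin_minus[OF hilbert_space_axioms hilbert_space_axioms poly_apply_blin[OF Tb]])
    have 3: "hnorm H (A (cfc H f T x) \<ominus> cfc H f T (cfc H f T x)) \<le> e * (N * hnorm H x)"
      using order_trans[OF pe[of "cfc H f T x"] mult_left_mono[OF N(2)[OF x] less_imp_le[OF e(1)]]] x by simp
    show "hnorm H (cfc H (\<lambda>t. f t * f t) T x \<ominus> cfc H f T (cfc H f T x)) \<le> e * (((2 * M + 1) + (M + 1) + N) * hnorm H x)"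
      using 1 2 3 x hnorm_diff_triangle[of "cfc H (\<lambda>t. f t * f t) T x" "A (A x)" "cfc H f T (cfc H f T x)"]
        hnorm_diff_triangle[of "A (A x)" "A (cfc H f T x)" "cfc H f T (cfc H f T x)"]
        hnorm_minus_commute[of "cfc H (\<lambda>t. f t * f t) T x" "A (A x)"]
      by (simp add: algebra_simps)
  qed (use x in auto)
qed

lemma cfc_cong:
  assumes T: "selfadjoint_op H T" and sp: "spectrum_in H T {a..b}" and f: "continuous_on {a..b} f"
    and fg: "\<And>t. t \<in> {a..b} \<Longrightarrow> f t = g t" and x: "x \<in> carrier H"
  shows "cfc H f T x = cfc H g T x"
proof -
  have g: "continuous_on {a..b} g" using f fg continuous_on_cong by metis
  note [simp] = BH_closed[OF cfc_approx(1)[OF T sp g]] BH_closed[OF cfc_approx(1)[OF T sp f]]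
  show ?thesis
    using cfc_close[OF T sp f g order_refl _ x] fg x by (intro hnorm_small_imp_eq[of _ _ 0]) auto
qed

text \<open>\<open>f(T)\<close> is the square of the self-adjoint operator obtained from
  \<open>sqrt (f t)\<close>, so its form at \<open>x\<close> is a squared norm.\<close>

lemma cfc_nonneg:
  assumes T: "selfadjoint_op H T" and sp: "spectrum_in H T {a..b}" and f: "continuous_on {a..b} f"
    and pos: "\<And>t. t \<in> {a..b} \<Longrightarrow> 0 \<le> f t" and x: "x \<in> carrier H"
  shows "0 \<le> Re (ip H (cfc H f T x) x)"
proof -
  have sf: "continuous_on {a..b} (\<lambda>t. sqrt (f t))" using f by (intro continuous_intros)
  note SA = cfc_selfadjoint[OF T sp sf]
  then have SA': "adjoint_pair H H (cfc H (\<lambda>t. sqrt (f t)) T) (cfc H (\<lambda>t. sqrt (f t)) T)"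
    by (simp add: selfadjoint_op_iff)
  have cl [simp]: "cfc H (\<lambda>t. sqrt (f t)) T x \<in> carrier H"
    using SA x BH_closed by (simp add: selfadjoint_op_iff)
  have "cfc H f T x = cfc H (\<lambda>t. sqrt (f t) * sqrt (f t)) T x"
    using pos by (intro cfc_cong[OF T sp f _ x]) auto
  also have "\<dots> = cfc H (\<lambda>t. sqrt (f t)) T (cfc H (\<lambda>t. sqrt (f t)) T x)"
    by (rule cfc_square[OF T sp sf x])
  finally have "ip H (cfc H f T x) x = ip H (cfc H (\<lambda>t. sqrt (f t)) T x) (cfc H (\<lambda>t. sqrt (f t)) T x)"
    using adjoint_pairD(3)[OF SA' cl x] by simp
  then show ?thesis using Re_ip_nonneg[OF cl] by simp
qed

text \<open>Positivity of the calculus for \<open>t - a\<close>, \<open>b - t\<close> and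
  \<open>(t - a) * (b - t)\<close>. The last one bounds \<open>|T x|\<close> by the form, and is
  where both ends of the spectrum act together.\<close>

lemma form_bounds:
  assumes T: "selfadjoint_op H T" and sp: "spectrum_in H T {a..b}" and x: "x \<in> carrier H"
  shows "a * (hnorm H x)\<^sup>2 \<le> Re (ip H (T x) x)" "Re (ip H (T x) x) \<le> b * (hnorm H x)\<^sup>2"
    "(hnorm H (T x))\<^sup>2 \<le> (a + b) * Re (ip H (T x) x) - a * b * (hnorm H x)\<^sup>2"
proof -
  have TB: "T \<in> carrier (BH H)" and TT: "adjoint_pair H H T T" using T by (auto simp: selfadjoint_op_iff)
  note Tb = BH_blin[OF TB]
  note [simp] = blin_closed[OF Tb] blin_zero[OF hilbert_space_axioms hilbert_space_axioms Tb]
  have nn: "0 \<le> Re (ip H (poly_apply H T (cpoly p) x) x)" if "\<And>t. t \<in> {a..b} \<Longrightarrow> 0 \<le> poly p t" for p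
    using cfc_nonneg[where f = "poly p", OF T sp _ that x] by (simp add: cfc_poly[OF T sp x] continuous_intros)
  note s = cpoly_hom poly_apply_pCons[OF Tb] poly_apply_0 blin_smult[OF Tb] blin_add[OF Tb] ip_simps hnorm_sq
  show "a * (hnorm H x)\<^sup>2 \<le> Re (ip H (T x) x)" using nn[of "[:- a, 1:]"] x by (simp add: s)
  show "Re (ip H (T x) x) \<le> b * (hnorm H x)\<^sup>2" using nn[of "[:b, - 1:]"] x by (simp add: s)
  have "0 \<le> poly [:- (a * b), a + b, - 1:] t" if "t \<in> {a..b}" for t
    using mult_nonneg_nonneg[of "t - a" "b - t"] that by (simp add: algebra_simps)
  from nn[OF this] show "(hnorm H (T x))\<^sup>2 \<le> (a + b) * Re (ip H (T x) x) - a * b * (hnorm H x)\<^sup>2"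
    using x adjoint_pairD(3)[OF TT, of x "T x"] adjoint_pairD(3)[OF TT, of "T x" x]
    by (simp add: s algebra_simps)
qed

end

section \<open>Orthogonal sums inside the universe\<close>

lemma hilbert_spaceI:
  fixes L :: "'a inner_space" (structure)
  assumes grp: "abelian_group L"
    and cl: "\<And>c x. x \<in> carrier L \<Longrightarrow> c \<odot> x \<in> carrier L"
    and ld: "\<And>c d x. x \<in> carrier L \<Longrightarrow> (c + d) \<odot> x = c \<odot> x \<oplus> d \<odot> x"
    and rd: "\<And>c x y. x \<in> carrier L \<Longrightarrow> y \<in> carrier L \<Longrightarrow> c \<odot> (x \<oplus> y) = c \<odot> x \<oplus> c \<odot> y"
    and assoc: "\<And>c d x. x \<in> carrier L \<Longrightarrow> (c * d) \<odot> x = c \<odot> (d \<odot> x)"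
    and one: "\<And>x. x \<in> carrier L \<Longrightarrow> 1 \<odot> x = x"
    and ax: "hilbert_space_axioms L"
  shows "hilbert_space L"
proof (rule hilbert_space.intro[OF _ ax])
  show "Module.module ring_of_type_algebra L"
    using cl ld rd assoc one
    by (intro moduleI cring_from_type_algebra grp) (auto simp: ring_of_type_algebra_def)
qed

lemma (in hilbert_space) scale_simps:
  assumes "x \<in> carrier H"
  shows "(c + d) \<odot> x = c \<odot> x \<oplus> d \<odot> x" "(c * d) \<odot> x = c \<odot> (d \<odot> x)" "1 \<odot> x = x"
    "y \<in> carrier H \<Longrightarrow> c \<odot> (x \<oplus> y) = c \<odot> x \<oplus> c \<odot> y"
  using assms by (auto intro!: ip_eqI simp: ip_simps algebra_simps)

text \<open>The pairs are transported along \<open>enc\<close>, so that the elements of the sum live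
  in a prescribed type instead of a product type.\<close>

definition direct_sum :: "('a \<times> 'b \<Rightarrow> 'c) \<Rightarrow> 'a inner_space \<Rightarrow> 'b inner_space \<Rightarrow> 'c inner_space"
  where "direct_sum enc H K =
    (let U = carrier H \<times> carrier K; fs = (\<lambda>u. fst (inv_into U enc u)); sn = (\<lambda>u. snd (inv_into U enc u)) in
    \<lparr> carrier = enc ` U, mult = undefined, one = undefined, zero = enc (\<zero>\<^bsub>H\<^esub>, \<zero>\<^bsub>K\<^esub>),
      add = (\<lambda>u v. enc (fs u \<oplus>\<^bsub>H\<^esub> fs v, sn u \<oplus>\<^bsub>K\<^esub> sn v)),
      smult = (\<lambda>c u. enc (c \<odot>\<^bsub>H\<^esub> fs u, c \<odot>\<^bsub>K\<^esub> sn u)),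
      ip = (\<lambda>u v. ip H (fs u) (fs v) + ip K (sn u) (sn v)) \<rparr>)"

lemma direct_sum_hilbert:
  fixes H :: "'a inner_space" and K :: "'b inner_space" and enc :: "'a \<times> 'b \<Rightarrow> 'c"
  assumes "hilbert_space H" "hilbert_space K" and inj: "inj_on enc (carrier H \<times> carrier K)"
  defines "L \<equiv> direct_sum enc H K"
  shows "hilbert_space L"
    and "carrier L = enc ` (carrier H \<times> carrier K)"
    and "\<And>x y x' y'. \<lbrakk>x \<in> carrier H; y \<in> carrier K; x' \<in> carrier H; y' \<in> carrier K\<rbrakk> \<Longrightarrow>
      enc (x, y) \<oplus>\<^bsub>L\<^esub> enc (x', y') = enc (x \<oplus>\<^bsub>H\<^esub> x', y \<oplus>\<^bsub>K\<^esub> y')"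
    and "\<And>c x y. \<lbrakk>x \<in> carrier H; y \<in> carrier K\<rbrakk> \<Longrightarrow> c \<odot>\<^bsub>L\<^esub> enc (x, y) = enc (c \<odot>\<^bsub>H\<^esub> x, c \<odot>\<^bsub>K\<^esub> y)"
    and "\<And>x y x' y'. \<lbrakk>x \<in> carrier H; y \<in> carrier K; x' \<in> carrier H; y' \<in> carrier K\<rbrakk> \<Longrightarrow>
      ip L (enc (x, y)) (enc (x', y')) = ip H x x' + ip K y y'"
proof -
  interpret H: hilbert_space H by fact
  interpret K: hilbert_space K by fact
  have dec: "inv_into (carrier H \<times> carrier K) enc (enc (x, y)) = (x, y)" if "x \<in> carrier H" "y \<in> carrier K" for x y
    using inj that by (intro inv_into_f_f) auto
  show car: "carrier L = enc ` (carrier H \<times> carrier K)"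
    by (simp add: L_def direct_sum_def Let_def)
  have zero: "\<zero>\<^bsub>L\<^esub> = enc (\<zero>\<^bsub>H\<^esub>, \<zero>\<^bsub>K\<^esub>)"
    by (simp add: L_def direct_sum_def Let_def)
  show add: "\<And>x y x' y'. \<lbrakk>x \<in> carrier H; y \<in> carrier K; x' \<in> carrier H; y' \<in> carrier K\<rbrakk> \<Longrightarrow>
      enc (x, y) \<oplus>\<^bsub>L\<^esub> enc (x', y') = enc (x \<oplus>\<^bsub>H\<^esub> x', y \<oplus>\<^bsub>K\<^esub> y')"
    by (simp add: L_def direct_sum_def Let_def dec)
  show sm: "\<And>c x y. \<lbrakk>x \<in> carrier H; y \<in> carrier K\<rbrakk> \<Longrightarrow> c \<odot>\<^bsub>L\<^esub> enc (x, y) = enc (c \<odot>\<^bsub>H\<^esub> x, c \<odot>\<^bsub>K\<^esub> y)"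
    by (simp add: L_def direct_sum_def Let_def dec)
  show ip: "\<And>x y x' y'. \<lbrakk>x \<in> carrier H; y \<in> carrier K; x' \<in> carrier H; y' \<in> carrier K\<rbrakk> \<Longrightarrow>
      ip L (enc (x, y)) (enc (x', y')) = ip H x x' + ip K y y'"
    by (simp add: L_def direct_sum_def Let_def dec)
  have encI: "enc (x, y) \<in> carrier L" if "x \<in> carrier H" "y \<in> carrier K" for x y
    using that by (auto simp: car)
  have encE: "thesis" if "u \<in> carrier L" "\<And>x y. \<lbrakk>x \<in> carrier H; y \<in> carrier K; u = enc (x, y)\<rbrakk> \<Longrightarrow> thesis" for u thesis
    using that by (auto simp: car)
  have grp: "abelian_group L"
  proof (rule abelian_groupI)
    fix u assume "u \<in> carrier L"
    then show "\<exists>v\<in>carrier L. v \<oplus>\<^bsub>L\<^esub> u = \<zero>\<^bsub>L\<^esub>"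
      by (elim encE) (auto intro!: bexI[of _ "enc (\<ominus>\<^bsub>H\<^esub> _, \<ominus>\<^bsub>K\<^esub> _)"] encI simp: add zero H.l_neg K.l_neg)
  qed (auto elim!: encE simp: zero add encI H.a_ac K.a_ac)
  interpret L: abelian_group L by (rule grp)
  have minus: "enc (x, y) \<ominus>\<^bsub>L\<^esub> enc (x', y') = enc (x \<ominus>\<^bsub>H\<^esub> x', y \<ominus>\<^bsub>K\<^esub> y')"
    if "x \<in> carrier H" "y \<in> carrier K" "x' \<in> carrier H" "y' \<in> carrier K" for x y x' y'
  proof -
    have "\<ominus>\<^bsub>L\<^esub> enc (x', y') = enc (\<ominus>\<^bsub>H\<^esub> x', \<ominus>\<^bsub>K\<^esub> y')"
      using that by (intro L.minus_equality) (auto simp: add zero encI H.l_neg K.l_neg)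
    then show ?thesis using that by (simp add: a_minus_def add)
  qed
  have nrm: "(hnorm L (enc (x, y)))\<^sup>2 = (hnorm H x)\<^sup>2 + (hnorm K y)\<^sup>2" if "x \<in> carrier H" "y \<in> carrier K" for x y
    using that by (simp add: hnorm_def ip H.Re_ip_nonneg K.Re_ip_nonneg)
  have nn: "0 \<le> hnorm L (enc (x, y))" if "x \<in> carrier H" "y \<in> carrier K" for x y
    using that by (simp add: hnorm_def ip H.Re_ip_nonneg K.Re_ip_nonneg)
  have ax: "hilbert_space_axioms L"
  proof
    show "ip L (x \<oplus>\<^bsub>L\<^esub> y) z = ip L x z + ip L y z" if "x \<in> carrier L" "y \<in> carrier L" "z \<in> carrier L" for x y z
      using that by (auto elim!: encE simp: add ip H.ip_simps K.ip_simps)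
    show "ip L (c \<odot>\<^bsub>L\<^esub> x) y = c * ip L x y" if "x \<in> carrier L" "y \<in> carrier L" for c x y
      using that by (auto elim!: encE simp: sm ip H.ip_simps K.ip_simps algebra_simps)
    show "ip L y x = cnj (ip L x y)" if xy: "x \<in> carrier L" "y \<in> carrier L" for x y
    proof -
      obtain a b where x: "a \<in> carrier H" "b \<in> carrier K" "x = enc (a, b)" using xy(1) by (rule encE)
      obtain c d where y: "c \<in> carrier H" "d \<in> carrier K" "y = enc (c, d)" using xy(2) by (rule encE)
      show ?thesis using x y H.ip_commute[of a c] K.ip_commute[of b d] by (simp add: ip)
    qed
    show "ip L x x \<in> \<real>\<^sub>\<ge>\<^sub>0" if "x \<in> carrier L" for x
      using that by (auto elim!: encE simp: ip H.ip_nonneg K.ip_nonneg intro: nonneg_Reals_add_I)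
    show "x = \<zero>\<^bsub>L\<^esub>" if x: "x \<in> carrier L" and 0: "ip L x x = 0" for x
    proof -
      obtain a b where ab: "a \<in> carrier H" "b \<in> carrier K" "x = enc (a, b)" using x by (rule encE)
      have "(hnorm H a)\<^sup>2 + (hnorm K b)\<^sup>2 = 0"
        using 0 ab by (simp add: ip H.hnorm_sq K.hnorm_sq complex_eq_iff)
      then have "hnorm H a = 0" "hnorm K b = 0"
        by (auto simp: add_nonneg_eq_0_iff)
      then show ?thesis using ab by (simp add: zero H.hnorm_eq_0 K.hnorm_eq_0)
    qed
    fix s :: "nat \<Rightarrow> 'c"
    assume sc: "\<And>n. s n \<in> carrier L"
      and cauchy: "\<And>e. e > 0 \<Longrightarrow> \<exists>N. \<forall>m\<ge>N. \<forall>n\<ge>N. hnorm L (s m \<ominus>\<^bsub>L\<^esub> s n) < e"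
    have "\<exists>x y. x \<in> carrier H \<and> y \<in> carrier K \<and> s n = enc (x, y)" for n
      using sc[of n] by (auto simp: car)
    then obtain a b where ab [simp]: "\<And>n. a n \<in> carrier H" "\<And>n. b n \<in> carrier K" and s: "\<And>n. s n = enc (a n, b n)"
      by metis
    have le: "hnorm H (a m \<ominus>\<^bsub>H\<^esub> a n) \<le> hnorm L (s m \<ominus>\<^bsub>L\<^esub> s n)" "hnorm K (b m \<ominus>\<^bsub>K\<^esub> b n) \<le> hnorm L (s m \<ominus>\<^bsub>L\<^esub> s n)" for m n
    proof -
      have eq: "s m \<ominus>\<^bsub>L\<^esub> s n = enc (a m \<ominus>\<^bsub>H\<^esub> a n, b m \<ominus>\<^bsub>K\<^esub> b n)" by (simp add: s minus)
      show "hnorm H (a m \<ominus>\<^bsub>H\<^esub> a n) \<le> hnorm L (s m \<ominus>\<^bsub>L\<^esub> s n)" "hnorm K (b m \<ominus>\<^bsub>K\<^esub> b n) \<le> hnorm L (s m \<ominus>\<^bsub>L\<^esub> s n)"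
        unfolding eq by (rule power2_le_imp_le; simp add: nrm nn)+
    qed
    have "\<exists>l\<in>carrier H. (\<lambda>n. hnorm H (a n \<ominus>\<^bsub>H\<^esub> l)) \<longlonglongrightarrow> 0"
    proof (rule H.complete)
      fix e :: real assume "e > 0"
      then obtain N where "\<And>m n. m \<ge> N \<Longrightarrow> n \<ge> N \<Longrightarrow> hnorm L (s m \<ominus>\<^bsub>L\<^esub> s n) < e" using cauchy by blast
      then have "\<forall>m\<ge>N. \<forall>n\<ge>N. hnorm H (a m \<ominus>\<^bsub>H\<^esub> a n) < e" using le(1) le_less_trans by blast
      then show "\<exists>N. \<forall>m\<ge>N. \<forall>n\<ge>N. hnorm H (a m \<ominus>\<^bsub>H\<^esub> a n) < e" ..
    qed simp
    then obtain l1 where l1: "l1 \<in> carrier H" "(\<lambda>n. hnorm H (a n \<ominus>\<^bsub>H\<^esub> l1)) \<longlonglongrightarrow> 0" by blast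
    have "\<exists>l\<in>carrier K. (\<lambda>n. hnorm K (b n \<ominus>\<^bsub>K\<^esub> l)) \<longlonglongrightarrow> 0"
    proof (rule K.complete)
      fix e :: real assume "e > 0"
      then obtain N where "\<And>m n. m \<ge> N \<Longrightarrow> n \<ge> N \<Longrightarrow> hnorm L (s m \<ominus>\<^bsub>L\<^esub> s n) < e" using cauchy by blast
      then have "\<forall>m\<ge>N. \<forall>n\<ge>N. hnorm K (b m \<ominus>\<^bsub>K\<^esub> b n) < e" using le(2) le_less_trans by blast
      then show "\<exists>N. \<forall>m\<ge>N. \<forall>n\<ge>N. hnorm K (b m \<ominus>\<^bsub>K\<^esub> b n) < e" ..
    qed simp
    then obtain l2 where l2: "l2 \<in> carrier K" "(\<lambda>n. hnorm K (b n \<ominus>\<^bsub>K\<^esub> l2)) \<longlonglongrightarrow> 0" by blast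
    have "hnorm L (s n \<ominus>\<^bsub>L\<^esub> enc (l1, l2)) = sqrt ((hnorm H (a n \<ominus>\<^bsub>H\<^esub> l1))\<^sup>2 + (hnorm K (b n \<ominus>\<^bsub>K\<^esub> l2))\<^sup>2)" for n
      using l1(1) l2(1) nrm[of "a n \<ominus>\<^bsub>H\<^esub> l1" "b n \<ominus>\<^bsub>K\<^esub> l2"] nn[of "a n \<ominus>\<^bsub>H\<^esub> l1" "b n \<ominus>\<^bsub>K\<^esub> l2"]
      by (simp add: s minus real_sqrt_unique)
    moreover have "(\<lambda>n. sqrt ((hnorm H (a n \<ominus>\<^bsub>H\<^esub> l1))\<^sup>2 + (hnorm K (b n \<ominus>\<^bsub>K\<^esub> l2))\<^sup>2)) \<longlonglongrightarrow> sqrt (0\<^sup>2 + 0\<^sup>2)"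
      by (intro tendsto_intros l1 l2)
    ultimately show "\<exists>l\<in>carrier L. (\<lambda>n. hnorm L (s n \<ominus>\<^bsub>L\<^esub> l)) \<longlonglongrightarrow> 0"
      using l1(1) l2(1) by (intro bexI[of _ "enc (l1, l2)"]) (auto simp: encI)
  qed
  show "hilbert_space L"
    by (rule hilbert_spaceI[OF grp _ _ _ _ _ ax])
      (auto elim!: encE simp: sm add encI H.scale_simps K.scale_simps)
qed

text \<open>A nonzero space has an infinite carrier \<open>U\<close>, and then \<open>U \<times> U\<close> embeds into \<open>U\<close>: orthogonal sums
  stay inside the type over which operator monotonicity quantifies.\<close>

lemma pair_encoding_exists:
  fixes H K :: "'a inner_space"
  assumes "hilbert_space H" "hilbert_space K"
  obtains enc :: "'a \<times> 'a \<Rightarrow> 'a" where "inj_on enc (carrier H \<times> carrier K)"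
proof (cases "finite (carrier H \<union> carrier K)")
  case True
  \<comment> \<open>A nonzero vector has infinitely many scalar multiples. With finite carriers both
    spaces are therefore zero, there is only one pair, and a constant map is injective on
    it.\<close>
  have triv: "x = \<zero>\<^bsub>G\<^esub>" if G: "hilbert_space G" "finite (carrier G)" and x: "x \<in> carrier G" for G :: "'a inner_space" and x
  proof (rule ccontr)
    interpret G: hilbert_space G by fact
    assume x0: "x \<noteq> \<zero>\<^bsub>G\<^esub>"
    then have ne: "ip G x x \<noteq> 0" using x G.ip_definite by blast
    have "inj (\<lambda>c. c \<odot>\<^bsub>G\<^esub> x)"
    proof (rule injI)
      fix c d assume "c \<odot>\<^bsub>G\<^esub> x = d \<odot>\<^bsub>G\<^esub> x"
      then have "ip G (c \<odot>\<^bsub>G\<^esub> x) x = ip G (d \<odot>\<^bsub>G\<^esub> x) x" by simp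
      then show "c = d" using ne x by (simp add: G.ip_simps)
    qed
    moreover have "range (\<lambda>c. c \<odot>\<^bsub>G\<^esub> x) \<subseteq> carrier G" using x by auto
    ultimately have "finite (UNIV :: complex set)"
      using G(2) by (meson finite_imageD finite_subset)
    then show False by (simp add: infinite_UNIV_char_0)
  qed
  have "inj_on (\<lambda>_. undefined) (carrier H \<times> carrier K)"
    using True triv[OF assms(1)] triv[OF assms(2)] by (auto simp: inj_on_def)
  then show thesis by (rule that)
next
  case False
  let ?U = "carrier H \<union> carrier K"
  have "(card_of (?U \<times> ?U), card_of ?U) \<in> ordLeq"
    using False by (intro ordIso_imp_ordLeq card_of_Times_same_infinite)
  then obtain enc :: "'a \<times> 'a \<Rightarrow> 'a" where "inj_on enc (?U \<times> ?U)"
    unfolding card_of_ordLeq[symmetric] by blast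
  then have "inj_on enc (carrier H \<times> carrier K)" by (rule inj_on_subset) auto
  then show thesis by (rule that)
qed

text \<open>Inclusions and projections in place of pairs: since \<open>p1\<close> is both the
  adjoint and a left inverse of \<open>i1\<close>, and likewise \<open>p2\<close> of
  \<open>i2\<close>, later proofs compute with adjoints and never see the encoding.\<close>

definition orthogonal_sum ::
    "'a inner_space \<Rightarrow> 'b inner_space \<Rightarrow> 'c inner_space \<Rightarrow> ('a \<Rightarrow> 'c) \<Rightarrow> ('c \<Rightarrow> 'a) \<Rightarrow> ('b \<Rightarrow> 'c) \<Rightarrow> ('c \<Rightarrow> 'b) \<Rightarrow> bool"
  where "orthogonal_sum H K L i1 p1 i2 p2 \<longleftrightarrow>
    hilbert_space L \<and> adjoint_pair H L i1 p1 \<and> adjoint_pair K L i2 p2 \<and>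
    (\<forall>x\<in>carrier H. p1 (i1 x) = x \<and> p2 (i1 x) = \<zero>\<^bsub>K\<^esub>) \<and>
    (\<forall>y\<in>carrier K. p2 (i2 y) = y \<and> p1 (i2 y) = \<zero>\<^bsub>H\<^esub>) \<and>
    (\<forall>z\<in>carrier L. i1 (p1 z) \<oplus>\<^bsub>L\<^esub> i2 (p2 z) = z)"

lemma orthogonal_sumD:
  assumes "orthogonal_sum H K L i1 p1 i2 p2"
  shows "hilbert_space L" "adjoint_pair H L i1 p1" "adjoint_pair K L i2 p2"
    "\<And>x. x \<in> carrier H \<Longrightarrow> p1 (i1 x) = x" "\<And>y. y \<in> carrier K \<Longrightarrow> p2 (i2 y) = y"
    "\<And>y. y \<in> carrier K \<Longrightarrow> p1 (i2 y) = \<zero>\<^bsub>H\<^esub>" "\<And>x. x \<in> carrier H \<Longrightarrow> p2 (i1 x) = \<zero>\<^bsub>K\<^esub>"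
    "\<And>z. z \<in> carrier L \<Longrightarrow> i1 (p1 z) \<oplus>\<^bsub>L\<^esub> i2 (p2 z) = z"
  using assms by (auto simp: orthogonal_sum_def)

lemma direct_sum_exists:
  fixes H K :: "'a inner_space"
  assumes H: "hilbert_space H" and K: "hilbert_space K"
  obtains L :: "'a inner_space" and i1 p1 i2 p2 where "orthogonal_sum H K L i1 p1 i2 p2"
proof -
  interpret H: hilbert_space H by fact
  interpret K: hilbert_space K by fact
  obtain enc :: "'a \<times> 'a \<Rightarrow> 'a" where inj: "inj_on enc (carrier H \<times> carrier K)"
    using pair_encoding_exists[OF assms] .
  define L where "L = direct_sum enc H K"
  note LL = direct_sum_hilbert[OF assms inj, folded L_def]
  interpret L: hilbert_space L by (rule LL(1))
  define dec where "dec = inv_into (carrier H \<times> carrier K) enc"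
  have dec [simp]: "dec (enc (x, y)) = (x, y)" if "x \<in> carrier H" "y \<in> carrier K" for x y
    using inj that unfolding dec_def by (intro inv_into_f_f) auto
  define i1 where "i1 x = enc (x, \<zero>\<^bsub>K\<^esub>)" for x
  define i2 where "i2 y = enc (\<zero>\<^bsub>H\<^esub>, y)" for y
  define p1 where "p1 z = fst (dec z)" for z
  define p2 where "p2 z = snd (dec z)" for z
  note defs = i1_def i2_def p1_def p2_def
  have "orthogonal_sum H K L i1 p1 i2 p2"
    unfolding orthogonal_sum_def
  proof (intro conjI)
    show "hilbert_space L" by (rule LL(1))
    have b1: "blin H L i1"
      unfolding blin_def
      by (auto simp: LL(2-5) defs hnorm_def H.ip_simps K.ip_simps K.scale_simps(4)[symmetric] intro!: exI[of _ 1] arg_cong[of _ _ enc] K.ip_eqI)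
    show "adjoint_pair H L i1 p1"
      by (rule adjoint_pairI[OF H LL(1) b1]) (auto simp: LL(2-5) defs H.ip_simps K.ip_simps)
    have b2: "blin K L i2"
      unfolding blin_def
      by (auto simp: LL(2-5) defs hnorm_def H.ip_simps K.ip_simps intro!: exI[of _ 1] arg_cong[of _ _ enc] H.ip_eqI)
    show "adjoint_pair K L i2 p2"
      by (rule adjoint_pairI[OF K LL(1) b2]) (auto simp: LL(2-5) defs H.ip_simps K.ip_simps)
  qed (auto simp: LL(2-5) defs)
  then show thesis by (rule that)
qed

lemma (in hilbert_space) selfadjoint_restrict:
  assumes T: "adjoint_pair H H T T"
  shows "selfadjoint_op H (restrict T (carrier H))"
  using restrict_BH[OF adjoint_pairD(1)[OF T]] adjoint_pairD(3)[OF T] BH_blin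
  by (auto simp: selfadjoint_op_iff adjoint_pair_def)

lemma (in hilbert_space) form_le_norm:
  assumes "blin H H T" "\<And>x. x \<in> carrier H \<Longrightarrow> hnorm H (T x) \<le> N * hnorm H x" "x \<in> carrier H"
  shows "Re (ip H (T x) x) \<le> N * (hnorm H x)\<^sup>2"
proof -
  have "Re (ip H (T x) x) \<le> hnorm H (T x) * hnorm H x"
    using cauchy_schwarz[OF blin_closed[OF assms(1,3)] assms(3)] complex_Re_le_cmod order_trans by blast
  also have "\<dots> \<le> N * hnorm H x * hnorm H x"
    using assms by (intro mult_right_mono) auto
  finally show ?thesis by (simp add: power2_eq_square)
qed

lemma spectrum_in_mono: "spectrum_in H T I \<Longrightarrow> I \<subseteq> J \<Longrightarrow> spectrum_in H T J"
  by blast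

text \<open>Both the norm square and the quadratic form split into the two components, so the
  spectrum is located by adding the form bounds of the blocks.\<close>

lemma block_diagonal_exists:
  fixes H :: "'a inner_space" and K :: "'b inner_space" and L :: "'c inner_space"
  assumes H: "hilbert_space H" and K: "hilbert_space K" and sum: "orthogonal_sum H K L i1 p1 i2 p2"
    and S: "selfadjoint_op H S" "spectrum_in H S {a..b}" and T: "selfadjoint_op K T" "spectrum_in K T {a..b}"
  obtains D where "selfadjoint_op L D" "spectrum_in L D {a..b}"
    "\<And>x. x \<in> carrier H \<Longrightarrow> D (i1 x) = i1 (S x)" "\<And>y. y \<in> carrier K \<Longrightarrow> D (i2 y) = i2 (T y)"
proof -
  note L = orthogonal_sumD(1)[OF sum] and 1 = orthogonal_sumD(2)[OF sum] and 2 = orthogonal_sumD(3)[OF sum]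
    and pi = orthogonal_sumD(4-7)[OF sum] and dec = orthogonal_sumD(8)[OF sum]
  interpret H: hilbert_space H by fact
  interpret K: hilbert_space K by fact
  interpret L: hilbert_space L by fact
  have Sb: "adjoint_pair H H S S" and Tb: "adjoint_pair K K T T"
    using S T by (auto simp: H.selfadjoint_op_iff K.selfadjoint_op_iff)
  note D1 = adjoint_pairD[OF 1] and D2 = adjoint_pairD[OF 2]
  note [simp] = blin_closed[OF D1(1)] blin_closed[OF D1(2)] blin_closed[OF D2(1)] blin_closed[OF D2(2)]
    blin_closed[OF adjoint_pairD(1)[OF Sb]] blin_closed[OF adjoint_pairD(1)[OF Tb]]
  define Y where "Y z = i1 (S (p1 z)) \<oplus>\<^bsub>L\<^esub> i2 (T (p2 z))" for z
  have Yb: "blin L L Y"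
    unfolding Y_def
    by (intro L.blin_plus blin_comp[OF L H L _ D1(1)] blin_comp[OF L K L _ D2(1)]
        blin_comp[OF L H H D1(2) adjoint_pairD(1)[OF Sb]] blin_comp[OF L K K D2(2) adjoint_pairD(1)[OF Tb]])
  have [simp]: "Y z \<in> carrier L" if "z \<in> carrier L" for z using that by (simp add: Y_def)
  have sw: "ip L w (i1 x) = ip H (p1 w) x" "ip L w (i2 y) = ip K (p2 w) y" if "w \<in> carrier L" "x \<in> carrier H" "y \<in> carrier K" for w x y
    using adjoint_pairD(3)[OF adjoint_pair_sym[OF H L 1], of w x] adjoint_pairD(3)[OF adjoint_pair_sym[OF K L 2], of w y] that by auto
  have ipY: "ip L (Y z) w = ip H (S (p1 z)) (p1 w) + ip K (T (p2 z)) (p2 w)" if "z \<in> carrier L" "w \<in> carrier L" for z w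
    using that by (simp add: Y_def L.ip_simps D1(3) D2(3))
  have ipY': "ip L z (Y w) = ip H (p1 z) (S (p1 w)) + ip K (p2 z) (T (p2 w))" if "z \<in> carrier L" "w \<in> carrier L" for z w
    using that by (simp add: Y_def L.ip_simps sw[of z "S (p1 w)" "T (p2 w)"])
  have YY: "adjoint_pair L L Y Y"
    using Yb adjoint_pairD(3)[OF Sb] adjoint_pairD(3)[OF Tb] by (simp add: adjoint_pair_def ipY ipY')
  have nz: "(hnorm L z)\<^sup>2 = (hnorm H (p1 z))\<^sup>2 + (hnorm K (p2 z))\<^sup>2" if z: "z \<in> carrier L" for z
  proof -
    have "ip L z z = ip L (i1 (p1 z) \<oplus>\<^bsub>L\<^esub> i2 (p2 z)) z" using dec[OF z] by simp
    also have "\<dots> = ip H (p1 z) (p1 z) + ip K (p2 z) (p2 z)" using z by (simp add: L.ip_simps D1(3) D2(3))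
    finally show ?thesis using z by (simp add: L.hnorm_sq H.hnorm_sq K.hnorm_sq)
  qed
  define D where "D = restrict Y (carrier L)"
  have D: "selfadjoint_op L D" unfolding D_def by (rule L.selfadjoint_restrict[OF YY])
  show thesis
  proof (rule that[OF D])
    show "spectrum_in L D {a..b}"
    proof (rule L.spectrum_in_form[OF D])
      fix z assume z: "z \<in> carrier L"
      show "a * (hnorm L z)\<^sup>2 \<le> Re (ip L (D z) z)"
        using H.form_bounds(1)[OF S, of "p1 z"] K.form_bounds(1)[OF T, of "p2 z"] z
        by (simp add: D_def ipY nz distrib_left)
      show "Re (ip L (D z) z) \<le> b * (hnorm L z)\<^sup>2"
        using H.form_bounds(2)[OF S, of "p1 z"] K.form_bounds(2)[OF T, of "p2 z"] z
        by (simp add: D_def ipY nz distrib_left)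
    qed
    show "D (i1 x) = i1 (S x)" if "x \<in> carrier H" for x
      using that pi blin_zero[OF K K adjoint_pairD(1)[OF Tb]] blin_zero[OF K L D2(1)] by (simp add: D_def Y_def)
    show "D (i2 y) = i2 (T y)" if "y \<in> carrier K" for y
      using that pi blin_zero[OF H H adjoint_pairD(1)[OF Sb]] blin_zero[OF H L D1(1)] by (simp add: D_def Y_def)
  qed
qed

section \<open>Operator monotone functions\<close>

text \<open>Monotonicity in the shape used below: forms instead of operators, and bounded intervals,
  because the calculus rules work on compact ones.\<close>

lemma operator_monotone_form_le:
  fixes L :: "'a inner_space"
  assumes mono: "operator_monotone TYPE('a) {0..} f" and L: "hilbert_space L"
    and A: "selfadjoint_op L A" "spectrum_in L A {0..a}" and B: "selfadjoint_op L B" "spectrum_in L B {0..b}"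
    and le: "\<And>z. z \<in> carrier L \<Longrightarrow> Re (ip L (A z) z) \<le> Re (ip L (B z) z)" and z: "z \<in> carrier L"
  shows "Re (ip L (cfc L f A z) z) \<le> Re (ip L (cfc L f B z) z)"
proof -
  interpret L: hilbert_space L by fact
  have cont: "continuous_on {0..c} f" for c
    using mono continuous_on_subset[of "{0..}" f "{0..c}"] by (auto simp: operator_monotone_def)
  have "spectrum_in L A {0..}" "spectrum_in L B {0..}"
    using A(2) B(2) by auto
  moreover have "op_le L A B" using le by (simp add: L.op_le_iff[OF A(1) B(1)])
  ultimately have "op_le L (cfc L f A) (cfc L f B)"
    using mono L A(1) B(1) unfolding operator_monotone_def by blast
  then show ?thesis
    using z by (simp add: L.op_le_iff L.cfc_selfadjoint[OF A cont] L.cfc_selfadjoint[OF B cont])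
qed

text \<open>Dilate \<open>G\<close> to the isometry \<open>W = (G, (1 - G\<^sup>*G)\<^sup>1\<^sup>/\<^sup>2)\<close> into the orthogonal sum. For large \<open>c\<close> the
  operator \<open>diag(P, 0)\<close> is dominated by \<open>B = W(Z + e)W\<^sup>* + c(1 - WW\<^sup>*)\<close>, and \<open>f(B)W = W f(Z + e)\<close>.
  The shift by \<open>e\<close> absorbs the off-diagonal blocks and is removed by continuity.\<close>

lemma operator_monotone_contraction:
  fixes H K :: "'a inner_space"
  assumes mono: "operator_monotone TYPE('a) {0..} f" and fpos: "\<And>t. t \<ge> 0 \<Longrightarrow> f t \<ge> 0"
    and H: "hilbert_space H" and K: "hilbert_space K" and b: "b \<ge> 0"
    and P: "selfadjoint_op H P" "spectrum_in H P {0..b}"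
    and Z: "selfadjoint_op K Z" "spectrum_in K Z {0..b}"
    and G: "adjoint_pair K H G G'" and contr: "\<And>k. k \<in> carrier K \<Longrightarrow> hnorm H (G k) \<le> hnorm K k"
    and le: "\<And>k. k \<in> carrier K \<Longrightarrow> Re (ip H (P (G k)) (G k)) \<le> Re (ip K (Z k) k)"
    and k0: "k0 \<in> carrier K"
  shows "Re (ip H (cfc H f P (G k0)) (G k0)) \<le> Re (ip K (cfc K f Z k0) k0)"
proof -
  interpret H: hilbert_space H by fact
  interpret K: hilbert_space K by fact
  have cont: "continuous_on {0..c} f" for c
    using mono continuous_on_subset[of "{0..}" f "{0..c}"] by (auto simp: operator_monotone_def)
  obtain L :: "'a inner_space" and i1 p1 i2 p2 where sum: "orthogonal_sum H K L i1 p1 i2 p2"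
    using direct_sum_exists[OF H K] by blast
  note L = orthogonal_sumD(1)[OF sum] and 1 = orthogonal_sumD(2)[OF sum] and 2 = orthogonal_sumD(3)[OF sum]
    and pi = orthogonal_sumD(4-7)[OF sum]
  interpret L: hilbert_space L by fact
  note D1 = adjoint_pairD[OF 1] and D2 = adjoint_pairD[OF 2] and GD = adjoint_pairD[OF G]
  have PP: "adjoint_pair H H P P" using P by (simp add: H.selfadjoint_op_iff)
  have ZZ: "adjoint_pair K K Z Z" using Z by (simp add: K.selfadjoint_op_iff)
  note [simp] = blin_closed[OF D1(1)] blin_closed[OF D1(2)] blin_closed[OF D2(1)] blin_closed[OF D2(2)]
    blin_closed[OF GD(1)] blin_closed[OF GD(2)] blin_closed[OF adjoint_pairD(1)[OF PP]] blin_closed[OF adjoint_pairD(1)[OF ZZ]]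
  define O0 where "O0 = restrict (\<lambda>k. \<zero>\<^bsub>K\<^esub>) (carrier K)"
  have O0: "selfadjoint_op K O0"
    unfolding O0_def
    by (rule K.selfadjoint_restrict) (simp add: adjoint_pair_def blin_const_zero K K.ip_simps)
  have O0s: "spectrum_in K O0 {0..b}"
    using b by (intro K.spectrum_in_form[OF O0]) (auto simp: O0_def K.ip_simps)
  obtain Y where Y: "selfadjoint_op L Y" "spectrum_in L Y {0..b}"
    and Yi: "\<And>x. x \<in> carrier H \<Longrightarrow> Y (i1 x) = i1 (P x)" "\<And>y. y \<in> carrier K \<Longrightarrow> Y (i2 y) = i2 (O0 y)"
    using block_diagonal_exists[OF H K sum P O0 O0s] by metis
  have YY: "adjoint_pair L L Y Y" using Y by (simp add: L.selfadjoint_op_iff)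
  note YD = adjoint_pairD[OF YY]
  \<comment> \<open>\<open>N\<close> is the defect \<open>1 - G' G\<close>; contractivity puts its
    spectrum in [0, 1]. Its square root \<open>S\<close> gives
    \<open>|G k|^2 + |S k|^2 = |k|^2\<close>, so that \<open>W\<close> is isometric.\<close>
  define N where "N = restrict (\<lambda>k. k \<ominus>\<^bsub>K\<^esub> G' (G k)) (carrier K)"
  have "blin K K (\<lambda>k. k \<ominus>\<^bsub>K\<^esub> G' (G k))"
    by (intro K.blin_diff blin_id blin_comp[OF K H K GD(1,2)])
  then have "adjoint_pair K K (\<lambda>k. k \<ominus>\<^bsub>K\<^esub> G' (G k)) (\<lambda>k. k \<ominus>\<^bsub>K\<^esub> G' (G k))"
    using adjoint_pairD(3)[OF adjoint_pair_comp[OF K H K G adjoint_pair_sym[OF K H G]]]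
    by (simp add: adjoint_pair_def K.ip_simps)
  then have N: "selfadjoint_op K N" unfolding N_def by (rule K.selfadjoint_restrict)
  have Nform: "Re (ip K (N k) k) = (hnorm K k)\<^sup>2 - (hnorm H (G k))\<^sup>2" if "k \<in> carrier K" for k
    using that adjoint_pairD(3)[OF adjoint_pair_sym[OF K H G], of "G k" k]
    by (simp add: N_def K.ip_simps K.hnorm_sq H.hnorm_sq)
  have Ns: "spectrum_in K N {0..1}"
  proof (rule K.spectrum_in_form[OF N])
    fix k assume k: "k \<in> carrier K"
    show "0 * (hnorm K k)\<^sup>2 \<le> Re (ip K (N k) k)"
      using power_mono[OF contr[OF k], of 2] k by (simp add: Nform)
    show "Re (ip K (N k) k) \<le> 1 * (hnorm K k)\<^sup>2" using k by (simp add: Nform)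
  qed
  have csq: "continuous_on {0..1} sqrt" by (intro continuous_intros)
  define S where "S = cfc K sqrt N"
  have SS: "adjoint_pair K K S S"
    using K.cfc_selfadjoint[OF N Ns csq] by (simp add: S_def K.selfadjoint_op_iff)
  note SD = adjoint_pairD[OF SS]
  note [simp] = blin_closed[OF SD(1)] blin_closed[OF YD(1)]
  have S2: "S (S k) = k \<ominus>\<^bsub>K\<^esub> G' (G k)" if k: "k \<in> carrier K" for k
  proof -
    have "S (S k) = cfc K (\<lambda>t. sqrt t * sqrt t) N k"
      unfolding S_def by (rule K.cfc_square[OF N Ns csq k, symmetric])
    also have "\<dots> = cfc K (poly [:0, 1:]) N k"
      by (rule K.cfc_cong[OF N Ns _ _ k]) (auto intro!: continuous_intros)
    also have "\<dots> = N k"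
    proof -
      have Nb: "blin K K N" using N K.BH_blin by (auto simp: K.selfadjoint_op_iff)
      show ?thesis
        using k blin_closed[OF Nb k] unfolding K.cfc_poly[OF N Ns k] cpoly_hom map_poly_0
        by (simp add: K.poly_apply_linear[OF Nb k] K.scale_minus_one_zero K.scale_simps)
    qed
    finally show ?thesis using k by (simp add: N_def)
  qed
  define W where "W k = i1 (G k) \<oplus>\<^bsub>L\<^esub> i2 (S k)" for k
  define W' where "W' z = G' (p1 z) \<oplus>\<^bsub>K\<^esub> S (p2 z)" for z
  have one: "1 \<odot>\<^bsub>L\<^esub> z = z" if "z \<in> carrier L" for z using that by (rule L.scale_simps)
  have Wb: "blin K L W"
  proof -
    have "blin K L (\<lambda>k. 1 \<odot>\<^bsub>L\<^esub> i1 (G k) \<oplus>\<^bsub>L\<^esub> 1 \<odot>\<^bsub>L\<^esub> i2 (S k))"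
      by (intro blin_lincomb[OF K L] blin_comp[OF K H L GD(1) D1(1)] blin_comp[OF K K L SD(1) D2(1)])
    then show ?thesis
      using blin_cong[OF K, of "\<lambda>k. 1 \<odot>\<^bsub>L\<^esub> i1 (G k) \<oplus>\<^bsub>L\<^esub> 1 \<odot>\<^bsub>L\<^esub> i2 (S k)" W L] by (simp add: W_def one)
  qed
  have [simp]: "W k \<in> carrier L" if "k \<in> carrier K" for k
    using that by (simp add: W_def)
  have [simp]: "W' z \<in> carrier K" if "z \<in> carrier L" for z
    using that by (simp add: W'_def)
  have WW: "adjoint_pair K L W W'"
    by (rule adjoint_pairI[OF K L Wb])
      (simp_all add: W_def W'_def L.ip_simps K.ip_simps D1(3) D2(3) GD(3) SD(3))
  note WD = adjoint_pairD[OF WW]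
  have iso: "W' (W k) = k" if k: "k \<in> carrier K" for k
  proof -
    have "p1 (W k) = G k" "p2 (W k) = S k"
      using k pi by (simp_all add: W_def blin_add[OF D1(2)] blin_add[OF D2(2)])
    then show ?thesis
      using k by (auto intro!: K.ip_eqI simp: W'_def S2 K.ip_simps)
  qed
  have nW: "hnorm L (W k) = hnorm K k" if k: "k \<in> carrier K" for k
    using WD(3)[of k "W k"] k by (simp add: hnorm_def iso)
  \<comment> \<open>As \<open>Y\<close> is block-diagonal with blocks \<open>P\<close> and 0,
    testing \<open>f(Y)\<close> on \<open>W k\<close> gives the wanted form plus the form of
    \<open>f(0)\<close> at \<open>S k\<close>, which is dropped because \<open>f\<close> is
    nonnegative.\<close>
  have fYW: "Re (ip H (cfc H f P (G k)) (G k)) \<le> Re (ip L (cfc L f Y (W k)) (W k))" if k: "k \<in> carrier K" for k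
  proof -
    note cY = L.cfc_approx(1)[OF Y cont] and cP = H.cfc_approx(1)[OF P cont] and cO = K.cfc_approx(1)[OF O0 O0s cont]
    note [simp] = L.BH_closed[OF cY] H.BH_closed[OF cP] K.BH_closed[OF cO]
    have "cfc L f Y (i1 (G k)) = i1 (cfc H f P (G k))"
      using k by (intro H.cfc_intertwine[OF P L Y cont D1(1)] Yi) auto
    moreover have "cfc L f Y (i2 (S k)) = i2 (cfc K f O0 (S k))"
      using k by (intro K.cfc_intertwine[OF O0 O0s L Y cont D2(1)] Yi) auto
    moreover have "cfc L f Y (W k) = cfc L f Y (i1 (G k)) \<oplus>\<^bsub>L\<^esub> cfc L f Y (i2 (S k))"
      using k by (simp add: W_def blin_add[OF L.BH_blin[OF cY]])
    ultimately have "ip L (cfc L f Y (W k)) (W k) = ip H (cfc H f P (G k)) (G k) + ip K (cfc K f O0 (S k)) (S k)"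
      using k pi by (simp add: L.ip_simps H.ip_simps K.ip_simps D1(3) D2(3) W_def blin_add[OF D1(2)] blin_add[OF D2(2)])
    moreover have "0 \<le> Re (ip K (cfc K f O0 (S k)) (S k))"
      using k fpos by (intro K.cfc_nonneg[OF O0 O0s cont]) auto
    ultimately show ?thesis by simp
  qed
  obtain n where n: "n \<ge> 0" "\<And>z. z \<in> carrier L \<Longrightarrow> hnorm L (Y z) \<le> n * hnorm L z"
    using blin_bound[OF YD(1)] by blast
  have shift: "Re (ip H (cfc H f P (G k0)) (G k0)) \<le> Re (ip K (cfc K (\<lambda>t. f (e + 1 * t)) Z k0) k0)"
    if e: "0 < e" "e \<le> 1" for e
  proof -
    define Ze where "Ze = restrict (\<lambda>k. complex_of_real e \<odot>\<^bsub>K\<^esub> k \<oplus>\<^bsub>K\<^esub> Z k) (carrier K)"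
    have "blin K K (\<lambda>k. complex_of_real e \<odot>\<^bsub>K\<^esub> k \<oplus>\<^bsub>K\<^esub> Z k)"
      by (intro K.blin_plus K.blin_scale blin_id adjoint_pairD(1)[OF ZZ])
    then have Ze: "selfadjoint_op K Ze"
      unfolding Ze_def using adjoint_pairD(3)[OF ZZ]
      by (intro K.selfadjoint_restrict) (simp add: adjoint_pair_def K.ip_simps)
    have ZeZe: "adjoint_pair K K Ze Ze" using Ze by (simp add: K.selfadjoint_op_iff)
    note ZeD = adjoint_pairD[OF ZeZe]
    note [simp] = blin_closed[OF ZeD(1)]
    have Zeform: "Re (ip K (Ze k) k) = e * (hnorm K k)\<^sup>2 + Re (ip K (Z k) k)" if "k \<in> carrier K" for k
      using that by (simp add: Ze_def K.ip_simps K.hnorm_sq)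
    have Zes: "spectrum_in K Ze {0..b + 1}"
    proof (rule K.spectrum_in_form[OF Ze])
      fix k assume k: "k \<in> carrier K"
      show "0 * (hnorm K k)\<^sup>2 \<le> Re (ip K (Ze k) k)"
        using K.form_bounds(1)[OF Z k] e k by (simp add: Zeform)
      have "e * (hnorm K k)\<^sup>2 \<le> 1 * (hnorm K k)\<^sup>2" using e by (intro mult_right_mono) auto
      then show "Re (ip K (Ze k) k) \<le> (b + 1) * (hnorm K k)\<^sup>2"
        using K.form_bounds(2)[OF Z k] k by (simp add: Zeform distrib_right)
    qed
    \<comment> \<open>\<open>n^2 / e\<close> pays for the cross terms of \<open>Y\<close> between
      the range of \<open>W\<close> and its complement, by Young's inequality with weight
      \<open>e\<close>; the summand \<open>n\<close> pays for \<open>Y\<close> on the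
      complement.\<close>
    define c where "c = n\<^sup>2 / e + n"
    have c: "c \<ge> 0" using n e by (simp add: c_def)
    define B where "B = restrict (\<lambda>z. W (Ze (W' z)) \<oplus>\<^bsub>L\<^esub> complex_of_real c \<odot>\<^bsub>L\<^esub> (z \<ominus>\<^bsub>L\<^esub> W (W' z))) (carrier L)"
    have Bb: "blin L L (\<lambda>z. W (Ze (W' z)) \<oplus>\<^bsub>L\<^esub> complex_of_real c \<odot>\<^bsub>L\<^esub> (z \<ominus>\<^bsub>L\<^esub> W (W' z)))"
      by (intro L.blin_plus L.blin_scale L.blin_diff blin_id blin_comp[OF L K L WD(2,1)]
          blin_comp[OF L K L _ WD(1)] blin_comp[OF L K K WD(2) ZeD(1)])
    have sw: "ip L z (W k) = ip K (W' z) k" if "z \<in> carrier L" "k \<in> carrier K" for z k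
      using adjoint_pairD(3)[OF adjoint_pair_sym[OF K L WW], of z k] that by simp
    have B: "selfadjoint_op L B"
      unfolding B_def using Bb
      by (intro L.selfadjoint_restrict) (simp add: adjoint_pair_def L.ip_simps WD(3) sw ZeD(3))
    have Bform: "Re (ip L (B z) z) = Re (ip K (Ze (W' z)) (W' z)) + c * (hnorm L (z \<ominus>\<^bsub>L\<^esub> W (W' z)))\<^sup>2"
      if z: "z \<in> carrier L" for z
      using z by (simp add: B_def L.ip_simps K.ip_simps WD(3) sw L.hnorm_sq iso blin_minus[OF L K WD(2)])
    \<comment> \<open>Split \<open>z = W k + v\<close> with \<open>k = W' z\<close> and
      \<open>v\<close> orthogonal to the range of \<open>W\<close>. On the range \<open>Y\<close> is
      dominated by \<open>Z\<close> through \<open>le\<close>; \<open>Ze\<close> contributes a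
      surplus \<open>e * |k|^2\<close> for the cross terms.\<close>
    have YB: "Re (ip L (Y z) z) \<le> Re (ip L (B z) z)" if z: "z \<in> carrier L" for z
    proof -
      define k where "k = W' z"
      define v where "v = z \<ominus>\<^bsub>L\<^esub> W k"
      have k [simp]: "k \<in> carrier K" and v [simp]: "v \<in> carrier L" using z by (simp_all add: k_def v_def)
      have zkv: "z = W k \<oplus>\<^bsub>L\<^esub> v" using z by (intro L.ip_eqI) (auto simp: v_def L.ip_simps)
      have "ip L (Y v) (W k) = ip L v (Y (W k))" by (simp add: YD(3))
      then have yv: "Re (ip L (Y v) (W k)) = Re (ip L (Y (W k)) v)" by (simp add: L.Re_ip_commute)
      have "Re (ip L (Y z) z) = Re (ip L (Y (W k)) (W k)) + 2 * Re (ip L (Y (W k)) v) + Re (ip L (Y v) v)"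
        unfolding zkv using yv by (simp add: blin_add[OF YD(1)] L.ip_simps)
      moreover have "Re (ip L (Y (W k)) (W k)) \<le> Re (ip K (Z k) k)"
      proof -
        have "Y (W k) = i1 (P (G k))"
          using Yi blin_zero[OF K L D2(1)] by (simp add: W_def blin_add[OF YD(1)] O0_def)
        then have "ip L (Y (W k)) (W k) = ip H (P (G k)) (G k)"
          using pi by (simp add: D1(3) W_def blin_add[OF D1(2)])
        then show ?thesis using le[OF k] by simp
      qed
      moreover have "2 * Re (ip L (Y (W k)) v) \<le> e * (hnorm K k)\<^sup>2 + n\<^sup>2 / e * (hnorm L v)\<^sup>2"
      proof -
        have "Re (ip L (Y (W k)) v) \<le> hnorm L (Y (W k)) * hnorm L v"
          by (intro L.Re_cauchy_schwarz) auto
        also have "\<dots> \<le> n * hnorm K k * hnorm L v"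
          using n(2)[of "W k"] by (intro mult_right_mono) (auto simp: nW)
        finally have "2 * Re (ip L (Y (W k)) v) \<le> 2 * (n * hnorm K k * hnorm L v)" by simp
        also have "\<dots> \<le> e * (hnorm K k)\<^sup>2 + n\<^sup>2 / e * (hnorm L v)\<^sup>2"
        proof -
          have "0 \<le> (e * hnorm K k - n * hnorm L v)\<^sup>2 / e" using e by simp
          also have "\<dots> = (e * (e * (hnorm K k)\<^sup>2 - 2 * (n * hnorm K k * hnorm L v)) + n\<^sup>2 * (hnorm L v)\<^sup>2) / e"
            by (simp add: power2_eq_square algebra_simps)
          also have "\<dots> = e * (hnorm K k)\<^sup>2 - 2 * (n * hnorm K k * hnorm L v) + n\<^sup>2 / e * (hnorm L v)\<^sup>2"
            using e by (simp add: add_divide_distrib)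
          finally show ?thesis by simp
        qed
        finally show ?thesis .
      qed
      moreover have "Re (ip L (Y v) v) \<le> n * (hnorm L v)\<^sup>2"
        by (rule L.form_le_norm[OF YD(1) n(2) v])
      moreover have "Re (ip L (B z) z) = e * (hnorm K k)\<^sup>2 + Re (ip K (Z k) k) + c * (hnorm L v)\<^sup>2"
        using Bform[OF z] by (simp add: k_def[symmetric] v_def[symmetric] Zeform)
      ultimately show ?thesis by (simp add: c_def distrib_right)
    qed
    have Bbl: "blin L L B" using B L.BH_blin by (auto simp: L.selfadjoint_op_iff)
    obtain m where m: "m \<ge> 0" "\<And>z. z \<in> carrier L \<Longrightarrow> hnorm L (B z) \<le> m * hnorm L z"
      using blin_bound[OF Bbl] by blast
    have Bs: "spectrum_in L B {0..m}"
    proof (rule L.spectrum_in_form[OF B])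
      fix z assume z: "z \<in> carrier L"
      show "0 * (hnorm L z)\<^sup>2 \<le> Re (ip L (B z) z)"
        using YB[OF z] L.form_bounds(1)[OF Y z] by simp
      show "Re (ip L (B z) z) \<le> m * (hnorm L z)\<^sup>2" by (rule L.form_le_norm[OF Bbl m(2) z])
    qed
    \<comment> \<open>\<open>cfc_intertwine\<close> asks for a single interval containing the
      spectra of \<open>B\<close> and \<open>Ze\<close>.\<close>
    define M where "M = max m (b + 1)"
    have Bs': "spectrum_in L B {0..M}" and Zes': "spectrum_in K Ze {0..M}"
      by (rule spectrum_in_mono[OF Bs], simp add: M_def) (rule spectrum_in_mono[OF Zes], simp add: M_def)
    note cZe = K.cfc_approx(1)[OF Ze Zes' cont]
    note [simp] = K.BH_closed[OF cZe]
    have BW: "B (W k) = W (Ze k)" if "k \<in> carrier K" for k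
      using that by (auto intro!: L.ip_eqI simp: B_def iso L.ip_simps)
    have "cfc L f B (W k0) = W (cfc K f Ze k0)"
      by (rule K.cfc_intertwine[OF Ze Zes' L B Bs' cont Wb BW k0])
    then have fBW: "ip L (cfc L f B (W k0)) (W k0) = ip K (cfc K f Ze k0) k0"
      using k0 by (simp add: WD(3) iso)
    have "cfc K f Ze k0 = cfc K (\<lambda>t. f (e + 1 * t)) Z k0"
      using e k0 by (intro K.cfc_affine[OF Z Ze Zes cont]) (auto simp: Ze_def K.scale_simps)
    then have "Re (ip L (cfc L f B (W k0)) (W k0)) = Re (ip K (cfc K (\<lambda>t. f (e + 1 * t)) Z k0) k0)"
      by (simp add: fBW)
    moreover have "Re (ip L (cfc L f Y (W k0)) (W k0)) \<le> Re (ip L (cfc L f B (W k0)) (W k0))"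
      using k0 by (intro operator_monotone_form_le[OF mono L Y B Bs YB]) auto
    ultimately show ?thesis using fYW[OF k0] by simp
  qed
  show ?thesis
  proof (rule field_le_epsilon)
    fix r :: real assume r: "r > 0"
    define r' where "r' = r / ((hnorm K k0)\<^sup>2 + 1)"
    have pos: "(hnorm K k0)\<^sup>2 + 1 > 0" by (simp add: add_nonneg_pos)
    have r': "r' > 0" "r' * (hnorm K k0)\<^sup>2 \<le> r"
      using r pos by (auto simp: r'_def field_simps)
    \<comment> \<open>Removing the shift: for \<open>t\<close> in [0, b] and \<open>e <= 1\<close>
      both \<open>t\<close> and \<open>e + t\<close> lie in [0, b + 1], where \<open>f\<close> is
      uniformly continuous, so the calculus values differ by at most \<open>r'\<close> in
      norm.\<close>
    have "uniformly_continuous_on {0..b + 1} f"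
      by (intro compact_uniformly_continuous cont) auto
    then obtain d where d: "d > 0" "\<And>s t. s \<in> {0..b + 1} \<Longrightarrow> t \<in> {0..b + 1} \<Longrightarrow> dist s t < d \<Longrightarrow> dist (f s) (f t) < r'"
      using r'(1) unfolding uniformly_continuous_on_def by metis
    define e where "e = min 1 (d / 2)"
    have e: "0 < e" "e \<le> 1" "e < d" using d(1) by (auto simp: e_def)
    have ce: "continuous_on {0..b} (\<lambda>t. f (e + 1 * t))"
      using e by (intro continuous_on_compose2[OF cont[of "b + 1"]]) (auto intro!: continuous_intros)
    note c1 = K.cfc_approx(1)[OF Z ce] and c2 = K.cfc_approx(1)[OF Z cont]
    note [simp] = K.BH_closed[OF c1] K.BH_closed[OF c2]
    have "hnorm K (cfc K (\<lambda>t. f (e + 1 * t)) Z k0 \<ominus>\<^bsub>K\<^esub> cfc K f Z k0) \<le> r' * hnorm K k0"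
    proof (rule K.cfc_close[OF Z ce cont _ _ k0])
      fix t assume "t \<in> {0..b}"
      then show "\<bar>f (e + 1 * t) - f t\<bar> \<le> r'"
        using d(2)[of "e + t" t] e by (simp add: dist_real_def)
    qed (use r' in simp)
    then have "hnorm K (cfc K (\<lambda>t. f (e + 1 * t)) Z k0 \<ominus>\<^bsub>K\<^esub> cfc K f Z k0) * hnorm K k0 \<le> r' * hnorm K k0 * hnorm K k0"
      using k0 by (intro mult_right_mono) auto
    moreover have "Re (ip K (cfc K (\<lambda>t. f (e + 1 * t)) Z k0 \<ominus>\<^bsub>K\<^esub> cfc K f Z k0) k0)
        \<le> hnorm K (cfc K (\<lambda>t. f (e + 1 * t)) Z k0 \<ominus>\<^bsub>K\<^esub> cfc K f Z k0) * hnorm K k0"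
      by (intro K.Re_cauchy_schwarz K.minus_closed K.BH_closed[OF c1] K.BH_closed[OF c2] k0)
    ultimately have "Re (ip K (cfc K (\<lambda>t. f (e + 1 * t)) Z k0 \<ominus>\<^bsub>K\<^esub> cfc K f Z k0) k0) \<le> r' * (hnorm K k0)\<^sup>2"
      by (simp add: power2_eq_square mult.assoc)
    then have "Re (ip K (cfc K (\<lambda>t. f (e + 1 * t)) Z k0) k0) - Re (ip K (cfc K f Z k0) k0) \<le> r' * (hnorm K k0)\<^sup>2"
      unfolding K.ip_minus_left[OF K.BH_closed[OF c1 k0] K.BH_closed[OF c2 k0] k0] by simp
    then show "Re (ip H (cfc H f P (G k0)) (G k0)) \<le> Re (ip K (cfc K f Z k0) k0) + r"
      using shift[OF e(1,2)] r'(2) by linarith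
  qed
qed

text \<open>Quantifying over \<open>f\<close> covers at once \<open>V\<^sup>*V\<close> (\<open>f = 1\<close>), \<open>V\<^sup>*QV\<close> (\<open>f = id\<close>) and \<open>V\<^sup>*f(Q/2)V\<close>, and
  lets the induction on \<open>n\<close> use binary sums only.\<close>

lemma column_exists:
  fixes H :: "'a inner_space" and n :: nat
  assumes H: "hilbert_space H" and mM: "m \<le> M"
  shows "(\<And>i. i \<in> {1..n} \<Longrightarrow> selfadjoint_op H (A i) \<and> spectrum_in H (A i) {m..M} \<and> C i \<in> carrier (BH H)) \<Longrightarrow>
    \<exists>(K :: 'a inner_space) V Q. hilbert_space K \<and> blin H K V \<and> selfadjoint_op K Q \<and> spectrum_in K Q {m..M} \<and>
      (\<forall>f. continuous_on {m..M} f \<longrightarrow> (\<forall>x\<in>carrier H.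
        ip K (cfc K f Q (V x)) (V x) = (\<Sum>i\<in>{1..n}. ip H (cfc H f (A i) (C i x)) (C i x))))"
proof (induction n)
  case 0
  interpret H: hilbert_space H by fact
  \<comment> \<open>For the empty sum \<open>V\<close> is zero, but \<open>Q\<close> still needs its
    spectrum in [m, M]; the scalar operator \<open>m\<close> provides it.\<close>
  define Q where "Q = restrict (\<lambda>x. complex_of_real m \<odot>\<^bsub>H\<^esub> x) (carrier H)"
  have Q: "selfadjoint_op H Q"
    unfolding Q_def by (rule H.selfadjoint_restrict) (simp add: adjoint_pair_def H.ip_simps H.blin_scale blin_id)
  have Qs: "spectrum_in H Q {m..M}"
    using mM by (intro H.spectrum_in_form[OF Q]) (auto simp: Q_def H.ip_simps H.hnorm_sq[symmetric] intro!: mult_right_mono)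
  show ?case
    using H Q Qs blin_const_zero[OF H H] H.cfc_approx(1)[OF Q Qs]
    by (intro exI[of _ H] exI[of _ "\<lambda>x. \<zero>\<^bsub>H\<^esub>"] exI[of _ Q]) (auto simp: H.ip_zero_right H.BH_closed)
next
  case (Suc n)
  interpret H: hilbert_space H by fact
  obtain K :: "'a inner_space" and V Q where K: "hilbert_space K" and V: "blin H K V"
    and Q: "selfadjoint_op K Q" "spectrum_in K Q {m..M}"
    and sum: "\<And>f x. continuous_on {m..M} f \<Longrightarrow> x \<in> carrier H \<Longrightarrow>
        ip K (cfc K f Q (V x)) (V x) = (\<Sum>i\<in>{1..n}. ip H (cfc H f (A i) (C i x)) (C i x))"
    using Suc.IH Suc.prems by auto
  interpret K: hilbert_space K by fact
  have A: "selfadjoint_op H (A (Suc n))" "spectrum_in H (A (Suc n)) {m..M}" and C: "C (Suc n) \<in> carrier (BH H)"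
    using Suc.prems[of "Suc n"] by auto
  obtain L :: "'a inner_space" and i1 p1 i2 p2 where osum: "orthogonal_sum K H L i1 p1 i2 p2"
    using direct_sum_exists[OF K H] by blast
  note L = orthogonal_sumD(1)[OF osum] and D1 = adjoint_pairD[OF orthogonal_sumD(2)[OF osum]]
    and D2 = adjoint_pairD[OF orthogonal_sumD(3)[OF osum]] and pi = orthogonal_sumD(4-7)[OF osum]
  interpret L: hilbert_space L by fact
  obtain D where D: "selfadjoint_op L D" "spectrum_in L D {m..M}"
    and Di: "\<And>x. x \<in> carrier K \<Longrightarrow> D (i1 x) = i1 (Q x)" "\<And>y. y \<in> carrier H \<Longrightarrow> D (i2 y) = i2 (A (Suc n) y)"
    using block_diagonal_exists[OF K H osum Q A] by metis
  note [simp] = blin_closed[OF D1(1)] blin_closed[OF D1(2)] blin_closed[OF D2(1)] blin_closed[OF D2(2)]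
    blin_closed[OF V] H.BH_closed[OF C]
  \<comment> \<open>The factors 1 fit the shape of \<open>blin_lincomb\<close>; \<open>Wx\<close>
    removes them.\<close>
  define W where "W x = 1 \<odot>\<^bsub>L\<^esub> i1 (V x) \<oplus>\<^bsub>L\<^esub> 1 \<odot>\<^bsub>L\<^esub> i2 (C (Suc n) x)" for x
  have Wb: "blin H L W"
    unfolding W_def
    by (intro blin_lincomb[OF H L] blin_comp[OF H K L V D1(1)] blin_comp[OF H H L H.BH_blin[OF C] D2(1)])
  have Wx: "W x = i1 (V x) \<oplus>\<^bsub>L\<^esub> i2 (C (Suc n) x)" if "x \<in> carrier H" for x
    using that by (simp add: W_def L.scale_simps)
  have "ip L (cfc L f D (W x)) (W x) = (\<Sum>i\<in>{1..Suc n}. ip H (cfc H f (A i) (C i x)) (C i x))"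
    if f: "continuous_on {m..M} f" and x: "x \<in> carrier H" for f x
  proof -
    note cD = L.cfc_approx(1)[OF D f] and cQ = K.cfc_approx(1)[OF Q f] and cA = H.cfc_approx(1)[OF A f]
    note [simp] = L.BH_closed[OF cD] K.BH_closed[OF cQ] H.BH_closed[OF cA]
    have 1: "cfc L f D (i1 (V x)) = i1 (cfc K f Q (V x))"
      using x by (intro K.cfc_intertwine[OF Q L D f D1(1)] Di) auto
    have 2: "cfc L f D (i2 (C (Suc n) x)) = i2 (cfc H f (A (Suc n)) (C (Suc n) x))"
      using x by (intro H.cfc_intertwine[OF A L D f D2(1)] Di) auto
    have "cfc L f D (W x) = i1 (cfc K f Q (V x)) \<oplus>\<^bsub>L\<^esub> i2 (cfc H f (A (Suc n)) (C (Suc n) x))"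
      using x by (simp add: Wx blin_add[OF L.BH_blin[OF cD]] 1 2)
    then have "ip L (cfc L f D (W x)) (W x) = ip K (cfc K f Q (V x)) (V x) + ip H (cfc H f (A (Suc n)) (C (Suc n) x)) (C (Suc n) x)"
      using x pi by (simp add: L.ip_simps H.ip_simps K.ip_simps D1(3) D2(3) Wx blin_add[OF D1(2)] blin_add[OF D2(2)])
    then show ?thesis using sum[OF f x] by simp
  qed
  then show ?case using L Wb D by blast
qed

text \<open>Polarise at the vector \<open>y = S x - T x\<close>: agreement of the forms at
  \<open>x\<close>, \<open>y\<close> and their sum gives equal real parts of \<open><S x, y>\<close>
  and \<open><T x, y>\<close>, that is \<open>|y|^2 = 0\<close>.\<close>

lemma (in hilbert_space) selfadjoint_form_eqI:
  assumes S: "selfadjoint_op H S" and T: "selfadjoint_op H T"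
    and form: "\<And>x. x \<in> carrier H \<Longrightarrow> Re (ip H (S x) x) = Re (ip H (T x) x)" and x: "x \<in> carrier H"
  shows "S x = T x"
proof -
  have SS: "adjoint_pair H H S S" and TT: "adjoint_pair H H T T" using S T by (auto simp: selfadjoint_op_iff)
  note SD = adjoint_pairD[OF SS] and TD = adjoint_pairD[OF TT]
  note [simp] = blin_closed[OF SD(1)] blin_closed[OF TD(1)]
  define y where "y = S x \<ominus> T x"
  have y: "y \<in> carrier H" using x by (simp add: y_def)
  have "Re (ip H (S y) x) = Re (ip H (S x) y)" "Re (ip H (T y) x) = Re (ip H (T x) y)"
    using SD(3)[of y x] TD(3)[of y x] Re_ip_commute[of "S x" y] Re_ip_commute[of "T x" y] x y by simp_all
  then have "Re (ip H (S x) y) = Re (ip H (T x) y)"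
    using form[of "x \<oplus> y"] form[OF x] form[OF y] x y by (simp add: blin_add[OF SD(1)] blin_add[OF TD(1)] ip_simps)
  then have "(hnorm H y)\<^sup>2 = 0"
    using x y ip_minus_left[of "S x" "T x" y] by (simp add: hnorm_sq y_def[symmetric])
  then have "y = \<zero>" using y by (simp add: hnorm_eq_0)
  then show ?thesis
    using x ip_minus_left[of "S x" "T x"] by (intro ip_eqI) (auto simp: y_def[symmetric] ip_zero_left)
qed

text \<open>The core inequality. The link between \<open>P\<close> and \<open>Q\<close> is stated
  through quadratic forms, since that is the information which \<open>column_exists\<close>
  supplies.\<close>

lemma isometry_reverse_jensen:
  fixes H K :: "'a inner_space"
  assumes mono: "operator_monotone TYPE('a) {0..} f" and fpos: "\<And>t. t \<ge> 0 \<Longrightarrow> f t \<ge> 0"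
    and H: "hilbert_space H" and K: "hilbert_space K"
    and m: "m > 0" and mM: "(m + M)\<^sup>2 \<le> 8 * m * M"
    and Q: "selfadjoint_op K Q" "spectrum_in K Q {m..M}" and V: "blin H K V"
    and iso: "\<And>x. x \<in> carrier H \<Longrightarrow> hnorm K (V x) = hnorm H x"
    and P: "selfadjoint_op H P" and PQ: "\<And>x. x \<in> carrier H \<Longrightarrow> Re (ip H (P x) x) = Re (ip K (Q (V x)) (V x))"
    and x0: "x0 \<in> carrier H"
  shows "Re (ip H (cfc H f P x0) x0) \<le> 2 * Re (ip K (cfc K (\<lambda>t. f (0 + 1 / 2 * t)) Q (V x0)) (V x0))"
proof -
  interpret H: hilbert_space H by fact
  interpret K: hilbert_space K by fact
  have cont: "continuous_on {0..c} f" for c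
    using mono continuous_on_subset[of "{0..}" f "{0..c}"] by (auto simp: operator_monotone_def)
  have M0: "M \<ge> 0"
  proof -
    have "0 \<le> 8 * m * M" using mM zero_le_power2[of "m + M"] by linarith
    then show ?thesis using m by (simp add: zero_le_mult_iff)
  qed
  obtain V' where VV: "adjoint_pair H K V V'" using adjoint_exists[OF H K V] .
  have PB: "P \<in> carrier (BH H)" and PP: "adjoint_pair H H P P" using P by (auto simp: H.selfadjoint_op_iff)
  have QQ: "adjoint_pair K K Q Q" using Q by (auto simp: K.selfadjoint_op_iff)
  note VD = adjoint_pairD[OF VV] and PD = adjoint_pairD[OF PP] and QD = adjoint_pairD[OF QQ]
  note [simp] = blin_closed[OF VD(1)] blin_closed[OF VD(2)] blin_closed[OF PD(1)] blin_closed[OF QD(1)]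
  have Vsw: "ip H (V' k) x = ip K k (V x)" if "k \<in> carrier K" "x \<in> carrier H" for k x
    using adjoint_pairD(3)[OF adjoint_pair_sym[OF H K VV] that] .
  have Pform: "m * (hnorm H x)\<^sup>2 \<le> Re (ip H (P x) x)" "Re (ip H (P x) x) \<le> M * (hnorm H x)\<^sup>2" if "x \<in> carrier H" for x
    using K.form_bounds(1,2)[OF Q, of "V x"] that by (simp_all add: PQ iso)
  have Ps: "spectrum_in H P {m..M}"
    by (rule H.spectrum_in_form[OF P Pform])
  have Ps0: "spectrum_in H P {0..M}" by (rule spectrum_in_mono[OF Ps]) (use m in auto)
  \<comment> \<open>Equality of forms is upgraded to the operator identity
    \<open>P = V' Q V\<close>, which is needed to compute \<open>G V\<close>.\<close>
  have PV: "P x = V' (Q (V x))" if x: "x \<in> carrier H" for x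
  proof -
    have "adjoint_pair H H (\<lambda>x. V' (Q (V x))) (\<lambda>x. V' (Q (V x)))"
      using blin_comp[OF H K H blin_comp[OF H K K V QD(1)] VD(2)]
      by (simp add: adjoint_pair_def Vsw QD(3) VD(3))
    then have "selfadjoint_op H (restrict (\<lambda>x. V' (Q (V x))) (carrier H))" by (rule H.selfadjoint_restrict)
    from H.selfadjoint_form_eqI[OF P this _ x] show ?thesis
      using x by (simp add: PQ Vsw)
  qed
  have "P \<in> Units (BH H)"
  proof (rule H.form_bounded_below_Units[OF PB m])
    fix x assume "x \<in> carrier H"
    then show "m * (hnorm H x)\<^sup>2 \<le> cmod (ip H (P x) x)"
      using Pform(1)[of x] complex_Re_le_cmod[of "ip H (P x) x"] by linarith
  qed
  then obtain R where RB: "R \<in> carrier (BH H)" and RP: "\<And>x. x \<in> carrier H \<Longrightarrow> R (P x) = x" "\<And>x. x \<in> carrier H \<Longrightarrow> P (R x) = x"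
    using H.Units_BHD by metis
  note Rb = H.BH_blin[OF RB]
  note [simp] = blin_closed[OF Rb]
  have Rsw: "ip H (R x) y = ip H x (R y)" if "x \<in> carrier H" "y \<in> carrier H" for x y
    using PD(3)[of "R x" "R y"] that by (simp add: RP)
  define c where "c = complex_of_real (1 / sqrt 2)"
  have "c * c = complex_of_real (1 / sqrt 2 * (1 / sqrt 2))"
    by (simp only: c_def of_real_mult)
  then have cc: "cnj c = c" "c * (c * z) = z / 2" for z
    by (simp_all add: c_def mult.assoc[symmetric])
  define G where "G k = c \<odot>\<^bsub>H\<^esub> R (V' (Q k))" for k
  define G' where "G' h = c \<odot>\<^bsub>K\<^esub> Q (V (R h))" for h
  have [simp]: "G k \<in> carrier H" if "k \<in> carrier K" for k using that by (simp add: G_def)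
  have [simp]: "G' h \<in> carrier K" if "h \<in> carrier H" for h using that by (simp add: G'_def)
  have Gb: "blin K H G"
  proof -
    have "blin K H (\<lambda>k. R (V' (Q k)))"
      by (rule blin_comp[OF K H H blin_comp[OF K K H QD(1) VD(2)] Rb])
    from blin_comp[OF K H H this H.blin_scale[OF blin_id, of c]] show ?thesis by (simp add: G_def[abs_def])
  qed
  have GG: "adjoint_pair K H G G'"
    by (rule adjoint_pairI[OF K H Gb]) (simp_all add: G_def G'_def H.ip_simps K.ip_simps cc Rsw Vsw QD(3))
  note GD = adjoint_pairD[OF GG]
  \<comment> \<open>Contractivity is shown for the adjoint, where the substitution
    \<open>x = P^-1 h\<close> makes the bound of \<open>|Q V x|\<close> by \<open>|P x|\<close>
    applicable; \<open>Gcontr\<close> transfers it to \<open>G\<close>.\<close>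
  have G'contr: "hnorm K (G' h) \<le> hnorm H h" if h: "h \<in> carrier H" for h
  proof (rule power2_le_imp_le)
    define x where "x = R h"
    have x [simp]: "x \<in> carrier H" and Px: "P x = h" using h RP by (simp_all add: x_def)
    have "(hnorm K (G' h))\<^sup>2 = (hnorm K (Q (V x)))\<^sup>2 / 2"
      using h by (simp add: G'_def K.hnorm_smult power_mult_distrib c_def norm_divide power_divide x_def[symmetric])
    also have "(hnorm K (Q (V x)))\<^sup>2 \<le> (m + M) * Re (ip H (P x) x) - m * M * (hnorm H x)\<^sup>2"
      using K.form_bounds(3)[OF Q, of "V x"] by (simp add: PQ iso)
    also have "\<dots> \<le> (m + M) * (hnorm H h * hnorm H x) - m * M * (hnorm H x)\<^sup>2"
      using H.Re_cauchy_schwarz[of "P x" x] m M0 h by (simp add: Px mult_left_mono)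
    also have "\<dots> \<le> 2 * (hnorm H h)\<^sup>2"
    proof -
      \<comment> \<open>The claim is that a quadratic form in \<open>|h|\<close> and
        \<open>|x|\<close> is nonnegative. Its discriminant is \<open>(m + M)^2 - 8 * m * M\<close>,
        and the display is the completed square.\<close>
      have "0 \<le> (4 * hnorm H h - (m + M) * hnorm H x)\<^sup>2 + (8 * m * M - (m + M)\<^sup>2) * (hnorm H x)\<^sup>2"
        using mM by simp
      also have "\<dots> = 8 * (2 * (hnorm H h)\<^sup>2 - (m + M) * (hnorm H h * hnorm H x) + m * M * (hnorm H x)\<^sup>2)"
        by (simp add: power2_eq_square algebra_simps)
      finally show ?thesis by simp
    qed
    finally show "(hnorm K (G' h))\<^sup>2 \<le> (hnorm H h)\<^sup>2" by simp
  qed (use h in simp)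
  have Gcontr: "hnorm H (G k) \<le> hnorm K k" if k: "k \<in> carrier K" for k
  proof (cases "hnorm H (G k) = 0")
    case False
    have "(hnorm H (G k))\<^sup>2 = Re (ip K k (G' (G k)))" using k by (simp add: H.hnorm_sq GD(3))
    also have "\<dots> \<le> hnorm K k * hnorm K (G' (G k))" using k by (intro K.Re_cauchy_schwarz) auto
    also have "\<dots> \<le> hnorm K k * hnorm H (G k)" using k G'contr[of "G k"] by (intro mult_left_mono) auto
    finally have "hnorm H (G k) * hnorm H (G k) \<le> hnorm K k * hnorm H (G k)" by (simp add: power2_eq_square)
    moreover have "hnorm H (G k) > 0" using False k H.hnorm_nonneg[of "G k"] by (simp add: less_le)
    ultimately show ?thesis by simp
  qed (use k in simp)
  have GV: "G (V x) = c \<odot>\<^bsub>H\<^esub> x" if "x \<in> carrier H" for x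
    using that by (simp add: G_def PV[symmetric] RP)
  define Z where "Z = restrict (\<lambda>k. complex_of_real (1 / 2) \<odot>\<^bsub>K\<^esub> Q k) (carrier K)"
  have Z: "selfadjoint_op K Z"
    unfolding Z_def
    by (rule K.selfadjoint_restrict) (simp add: adjoint_pair_def K.blin_scale[OF QD(1)] K.ip_simps QD(3))
  have Zform: "Re (ip K (Z k) k) = Re (ip K (Q k) k) / 2" if "k \<in> carrier K" for k
    using that by (simp add: Z_def K.ip_simps)
  \<comment> \<open>The interval is widened to [0, M] because
    \<open>operator_monotone_contraction\<close> takes one interval for \<open>P\<close> and
    \<open>Z\<close>.\<close>
  have Zs: "spectrum_in K Z {0..M}"
  proof (rule K.spectrum_in_form[OF Z])
    fix k assume k: "k \<in> carrier K"
    have "0 \<le> m * (hnorm K k)\<^sup>2" "0 \<le> M * (hnorm K k)\<^sup>2" using m M0 by simp_all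
    then show "0 * (hnorm K k)\<^sup>2 \<le> Re (ip K (Z k) k)" "Re (ip K (Z k) k) \<le> M * (hnorm K k)\<^sup>2"
      using K.form_bounds(1,2)[OF Q k] k by (simp_all add: Zform)
  qed
  \<comment> \<open>A Schur complement argument: for \<open>h = P^-1 V' Q k\<close>, the vector
    \<open>V h\<close> is the projection of \<open>k\<close> onto the range of \<open>V\<close> with
    respect to the form of \<open>Q\<close>. Positivity of \<open>Q\<close> at
    \<open>k - V h\<close> then reads \<open><V' Q k, h> <= <Q k, k>\<close>, and both sides are
    halved.\<close>
  have le: "Re (ip H (P (G k)) (G k)) \<le> Re (ip K (Z k) k)" if k: "k \<in> carrier K" for k
  proof -
    define u where "u = V' (Q k)"
    define h where "h = R u"
    have u [simp]: "u \<in> carrier H" and h [simp]: "h \<in> carrier H" using k by (simp_all add: u_def h_def)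
    have Ph: "P h = u" by (simp add: h_def RP)
    have 1: "ip H (P (G k)) (G k) = ip H u h / 2"
      by (simp add: G_def u_def[symmetric] h_def[symmetric] blin_smult[OF PD(1)] Ph H.ip_simps cc)
    have "0 \<le> m * (hnorm K (k \<ominus>\<^bsub>K\<^esub> V h))\<^sup>2" using m by simp
    then have "0 \<le> Re (ip K (Q (k \<ominus>\<^bsub>K\<^esub> V h)) (k \<ominus>\<^bsub>K\<^esub> V h))"
      using K.form_bounds(1)[OF Q, of "k \<ominus>\<^bsub>K\<^esub> V h"] k by simp
    also have "\<dots> = Re (ip K (Q k) k) - Re (ip K (Q k) (V h)) - Re (ip K (Q (V h)) k) + Re (ip K (Q (V h)) (V h))"
      using k by (simp add: blin_minus[OF K K QD(1)] K.ip_simps)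
    also have "ip K (Q k) (V h) = ip H u h" using k by (simp add: u_def Vsw)
    also have "Re (ip K (Q (V h)) k) = Re (ip H u h)"
      using k by (simp add: QD(3) VD(3) u_def H.Re_ip_commute)
    also have "ip K (Q (V h)) (V h) = ip H u h" using Vsw[of "Q (V h)" h] by (simp add: PV[symmetric] Ph)
    finally show ?thesis using k by (simp add: 1 Zform)
  qed
  \<comment> \<open>Compression by \<open>V\<close> amounts to evaluation at \<open>V x0\<close>,
    where \<open>G\<close> acts as multiplication by \<open>1 / sqrt 2\<close>; the form of
    \<open>f(P)\<close> thereby picks up the factor \<open>1 / 2\<close>.\<close>
  have "Re (ip H (cfc H f P (G (V x0))) (G (V x0))) \<le> Re (ip K (cfc K f Z (V x0)) (V x0))"
    using x0 by (intro operator_monotone_contraction[OF mono fpos H K M0 P Ps0 Z Zs GG Gcontr le]) auto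
  moreover have "Re (ip H (cfc H f P (G (V x0))) (G (V x0))) = Re (ip H (cfc H f P x0) x0) / 2"
    using x0 H.BH_closed[OF H.cfc_approx(1)[OF P Ps0 cont] x0]
    by (simp add: GV blin_smult[OF H.BH_blin[OF H.cfc_approx(1)[OF P Ps0 cont]]] H.ip_simps cc)
  moreover have "cfc K f Z (V x0) = cfc K (\<lambda>t. f (0 + 1 / 2 * t)) Q (V x0)"
    using x0 m by (intro K.cfc_affine[OF Q Z Zs cont]) (auto simp: Z_def K.scale_minus_one_zero)
  ultimately show ?thesis by simp
qed

section \<open>Sums of congruences and the inequality for several operators\<close>

context hilbert_space
begin

lemma congruence_sum:
  assumes I: "finite I" and T: "\<And>i. i \<in> I \<Longrightarrow> selfadjoint_op H (T i)" and C: "\<And>i. i \<in> I \<Longrightarrow> C i \<in> carrier (BH H)"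
  defines "S \<equiv> \<Oplus>\<^bsub>BH H\<^esub>i\<in>I. adj H (C i) \<otimes>\<^bsub>BH H\<^esub> T i \<otimes>\<^bsub>BH H\<^esub> C i"
  shows "selfadjoint_op H S"
    "x \<in> carrier H \<Longrightarrow> y \<in> carrier H \<Longrightarrow> ip H (S x) y = (\<Sum>i\<in>I. ip H (T i (C i x)) (C i y))"
proof -
  have TB: "T i \<in> carrier (BH H)" if "i \<in> I" for i using T[OF that] by (simp add: selfadjoint_op_def)
  have F: "adj H (C i) \<otimes>\<^bsub>BH H\<^esub> T i \<otimes>\<^bsub>BH H\<^esub> C i \<in> carrier (BH H)" if "i \<in> I" for i
    using that TB C by (intro BH_mult adj_BH(1)) auto
  have SB: "S \<in> carrier (BH H)" unfolding S_def using F by (intro BH.finsum_closed) auto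
  have ipS: "ip H (S x) y = (\<Sum>i\<in>I. ip H (T i (C i x)) (C i y))" if x: "x \<in> carrier H" and y: "y \<in> carrier H" for x y
  proof -
    have "ip H (S x) y = (\<Sum>i\<in>I. ip H ((adj H (C i) \<otimes>\<^bsub>BH H\<^esub> T i \<otimes>\<^bsub>BH H\<^esub> C i) x) y)"
      unfolding S_def using I F x y by (intro ip_finsum_BH)
    also have "\<dots> = (\<Sum>i\<in>I. ip H (T i (C i x)) (C i y))"
    proof (rule sum.cong[OF refl])
      fix i assume i: "i \<in> I"
      have "ip H (adj H (C i) (T i (C i x))) y = ip H (T i (C i x)) (C i y)"
        using adjoint_pairD(3)[OF adjoint_pair_sym[OF hilbert_space_axioms hilbert_space_axioms adj_BH(2)[OF C[OF i]]]]
          x y BH_closed[OF C[OF i]] BH_closed[OF TB[OF i]] by simp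
      then show "ip H ((adj H (C i) \<otimes>\<^bsub>BH H\<^esub> T i \<otimes>\<^bsub>BH H\<^esub> C i) x) y = ip H (T i (C i x)) (C i y)"
        using x BH_closed[OF C[OF i] x] by (simp add: BH_apply)
    qed
    finally show ?thesis .
  qed
  show "x \<in> carrier H \<Longrightarrow> y \<in> carrier H \<Longrightarrow> ip H (S x) y = (\<Sum>i\<in>I. ip H (T i (C i x)) (C i y))"
    by (rule ipS)
  have "ip H (S x) y = ip H x (S y)" if x: "x \<in> carrier H" and y: "y \<in> carrier H" for x y
  proof -
    have "ip H x (S y) = cnj (ip H (S y) x)" using x y BH_closed[OF SB] by (intro ip_commute) auto
    also have "\<dots> = (\<Sum>i\<in>I. cnj (ip H (T i (C i y)) (C i x)))" using x y by (simp add: ipS)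
    also have "\<dots> = (\<Sum>i\<in>I. ip H (T i (C i x)) (C i y))"
    proof (rule sum.cong[OF refl])
      fix i assume i: "i \<in> I"
      have TT: "adjoint_pair H H (T i) (T i)" using T[OF i] by (simp add: selfadjoint_op_iff)
      show "cnj (ip H (T i (C i y)) (C i x)) = ip H (T i (C i x)) (C i y)"
        using adjoint_pairD(3)[OF TT, of "C i x" "C i y"] ip_commute[of "T i (C i y)" "C i x"] x y
          BH_closed[OF C[OF i]] BH_closed[OF TB[OF i]] by simp
    qed
    finally show ?thesis using x y by (simp add: ipS)
  qed
  then show "selfadjoint_op H S"
    using SB BH_blin[OF SB] by (simp add: selfadjoint_op_iff adjoint_pair_def)
qed

lemma selfadjoint_scale:
  assumes "selfadjoint_op H T"
  shows "selfadjoint_op H (complex_of_real r \<odot>\<^bsub>BH H\<^esub> T)"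
proof -
  have T: "T \<in> carrier (BH H)" and TT: "adjoint_pair H H T T" using assms by (auto simp: selfadjoint_op_iff)
  show ?thesis
    using BH_smult[OF T] BH_blin[OF BH_smult[OF T]] BH_closed[OF T] adjoint_pairD(3)[OF TT]
    by (simp add: selfadjoint_op_iff adjoint_pair_def BH_apply ip_simps)
qed

lemma cfc_scale:
  assumes T: "selfadjoint_op H T" and sp: "spectrum_in H T {a..b}" and a: "a \<ge> 0" and r: "r \<ge> 0"
    and f: "continuous_on {0..r * b} f"
  shows "selfadjoint_op H (cfc H f (complex_of_real r \<odot>\<^bsub>BH H\<^esub> T))"
    "x \<in> carrier H \<Longrightarrow> cfc H f (complex_of_real r \<odot>\<^bsub>BH H\<^esub> T) x = cfc H (\<lambda>t. f (0 + r * t)) T x"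
proof -
  define S where "S = complex_of_real r \<odot>\<^bsub>BH H\<^esub> T"
  have TB: "T \<in> carrier (BH H)" using T by (simp add: selfadjoint_op_def)
  have S: "selfadjoint_op H S" unfolding S_def by (rule selfadjoint_scale[OF T])
  have Sx: "S x = complex_of_real r \<odot> T x" if "x \<in> carrier H" for x using that by (simp add: S_def BH_apply)
  have Ss: "spectrum_in H S {0..r * b}"
  proof (rule spectrum_in_form[OF S])
    fix x assume x: "x \<in> carrier H"
    have form: "Re (ip H (S x) x) = r * Re (ip H (T x) x)" using x BH_closed[OF TB x] by (simp add: Sx ip_simps)
    have "0 \<le> a * (hnorm H x)\<^sup>2" using a by simp
    then show "0 * (hnorm H x)\<^sup>2 \<le> Re (ip H (S x) x)"
      using form_bounds(1)[OF T sp x] r by (simp add: form)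
    show "Re (ip H (S x) x) \<le> r * b * (hnorm H x)\<^sup>2"
      using mult_left_mono[OF form_bounds(2)[OF T sp x] r] by (simp add: form mult.assoc)
  qed
  show "selfadjoint_op H (cfc H f S)" by (rule cfc_selfadjoint[OF S Ss f])
  show "x \<in> carrier H \<Longrightarrow> cfc H f S x = cfc H (\<lambda>t. f (0 + r * t)) T x"
    using BH_closed[OF TB] a r
    by (intro cfc_affine[OF T sp S Ss f]) (auto simp: Sx scale_minus_one_zero intro!: mult_left_mono)
qed

end

text \<open>Part (ii) for an interval [m, M] with the quadratic condition in place of a fixed ratio;
  the column of the \<open>C i\<close> reduces it to a single isometry, and \<open>n = 1\<close>
  yields part (i).\<close>

lemma operator_monotone_reverse_jensen:
  fixes H :: "'a inner_space"
  assumes H: "hilbert_space H" and fpos: "\<And>t. t \<ge> 0 \<Longrightarrow> f t \<ge> 0"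
    and mono: "operator_monotone TYPE('a) {0..} f"
    and m: "m > 0" and mM: "m \<le> M" "(m + M)\<^sup>2 \<le> 8 * m * M"
    and A: "\<And>i. i \<in> {1..n} \<Longrightarrow> selfadjoint_op H (A i)" "\<And>i. i \<in> {1..n} \<Longrightarrow> spectrum_in H (A i) {m..M}"
    and C: "\<And>i. i \<in> {1..n} \<Longrightarrow> C i \<in> carrier (BH H)"
    and one: "(\<Oplus>\<^bsub>BH H\<^esub>i\<in>{1..n::nat}. adj H (C i) \<otimes>\<^bsub>BH H\<^esub> C i) = \<one>\<^bsub>BH H\<^esub>"
  shows "op_le H (cfc H f (\<Oplus>\<^bsub>BH H\<^esub>i\<in>{1..n}. adj H (C i) \<otimes>\<^bsub>BH H\<^esub> A i \<otimes>\<^bsub>BH H\<^esub> C i))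
    (2 \<odot>\<^bsub>BH H\<^esub> (\<Oplus>\<^bsub>BH H\<^esub>i\<in>{1..n}. adj H (C i) \<otimes>\<^bsub>BH H\<^esub> cfc H f ((1 / 2) \<odot>\<^bsub>BH H\<^esub> A i) \<otimes>\<^bsub>BH H\<^esub> C i))"
proof -
  interpret H: hilbert_space H by fact
  have cont: "continuous_on {0..c} f" for c
    using mono continuous_on_subset[of "{0..}" f "{0..c}"] by (auto simp: operator_monotone_def)
  define g where "g t = f (0 + 1 / 2 * t)" for t
  have g: "continuous_on {m..M} g"
    unfolding g_def using m by (intro continuous_on_compose2[OF cont[of M]]) (auto intro!: continuous_intros)
  define P where "P = (\<Oplus>\<^bsub>BH H\<^esub>i\<in>{1..n}. adj H (C i) \<otimes>\<^bsub>BH H\<^esub> A i \<otimes>\<^bsub>BH H\<^esub> C i)"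
  define S where "S = (\<Oplus>\<^bsub>BH H\<^esub>i\<in>{1..n}. adj H (C i) \<otimes>\<^bsub>BH H\<^esub> cfc H f ((1 / 2) \<odot>\<^bsub>BH H\<^esub> A i) \<otimes>\<^bsub>BH H\<^esub> C i)"
  have half: "selfadjoint_op H (cfc H f ((1 / 2) \<odot>\<^bsub>BH H\<^esub> A i))"
    "\<And>x. x \<in> carrier H \<Longrightarrow> cfc H f ((1 / 2) \<odot>\<^bsub>BH H\<^esub> A i) x = cfc H g (A i) x" if "i \<in> {1..n}" for i
    using H.cfc_scale[OF A[OF that] less_imp_le[OF m] _ cont, of "1 / 2"] by (simp_all add: g_def[abs_def])
  have P: "selfadjoint_op H P" "\<And>x y. x \<in> carrier H \<Longrightarrow> y \<in> carrier H \<Longrightarrow> ip H (P x) y = (\<Sum>i\<in>{1..n}. ip H (A i (C i x)) (C i y))"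
    unfolding P_def using H.congruence_sum[of "{1..n}" A C, OF _ A(1) C] by simp_all
  have S: "selfadjoint_op H S" "\<And>x y. x \<in> carrier H \<Longrightarrow> y \<in> carrier H \<Longrightarrow>
      ip H (S x) y = (\<Sum>i\<in>{1..n}. ip H (cfc H f ((1 / 2) \<odot>\<^bsub>BH H\<^esub> A i) (C i x)) (C i y))"
    unfolding S_def using H.congruence_sum[of "{1..n}" "\<lambda>i. cfc H f ((1 / 2) \<odot>\<^bsub>BH H\<^esub> A i)" C, OF _ half(1) C] by simp_all
  obtain K :: "'a inner_space" and V Q where K: "hilbert_space K" and V: "blin H K V"
    and Q: "selfadjoint_op K Q" "spectrum_in K Q {m..M}"
    and sum: "\<And>f x. continuous_on {m..M} f \<Longrightarrow> x \<in> carrier H \<Longrightarrow>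
        ip K (cfc K f Q (V x)) (V x) = (\<Sum>i\<in>{1..n}. ip H (cfc H f (A i) (C i x)) (C i x))"
    using column_exists[OF H mM(1), of n A C] A C by blast
  interpret K: hilbert_space K by fact
  \<comment> \<open>The functions 1 and \<open>t\<close> enter as polynomials, on \<open>H\<close>
    as well as on \<open>K\<close>. Fed into the column identity, 1 shows that \<open>V\<close>
    preserves norms and \<open>t\<close> that \<open>P\<close> and \<open>Q\<close> have matching
    forms.\<close>
  have id: "cfc G (poly [:0, 1:]) T x = T x" "cfc G (poly [:1:]) T x = x"
    if G: "hilbert_space G" and T: "selfadjoint_op G T" "spectrum_in G T {m..M}" and x: "x \<in> carrier G" for G :: "'a inner_space" and T x
  proof -
    interpret G: hilbert_space G by fact
    have Tb: "blin G G T" using T(1) G.BH_blin by (auto simp: G.selfadjoint_op_iff)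
    show "cfc G (poly [:0, 1:]) T x = T x"
      unfolding G.cfc_poly[OF T x] cpoly_hom map_poly_0
      using x blin_closed[OF Tb x] by (simp add: G.poly_apply_linear[OF Tb x] G.scale_minus_one_zero G.scale_simps)
    show "cfc G (poly [:1:]) T x = x"
      unfolding G.cfc_poly[OF T x] cpoly_hom map_poly_0
      using x blin_zero[OF G G Tb] by (simp add: G.poly_apply_pCons[OF Tb x] G.poly_apply_0 G.scale_simps)
  qed
  have nV: "hnorm K (V x) = hnorm H x" if x: "x \<in> carrier H" for x
  proof -
    have F: "adj H (C i) \<otimes>\<^bsub>BH H\<^esub> C i \<in> carrier (BH H)" if "i \<in> {1..n}" for i
      using that C by (intro H.BH_mult H.adj_BH(1)) auto
    have "ip K (V x) (V x) = ip K (cfc K (poly [:1:]) Q (V x)) (V x)"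
      using id(2)[OF K Q] blin_closed[OF V x] by simp
    also have "\<dots> = (\<Sum>i\<in>{1..n}. ip H (cfc H (poly [:1:]) (A i) (C i x)) (C i x))"
      by (rule sum[OF _ x]) (intro continuous_intros)
    also have "\<dots> = (\<Sum>i\<in>{1..n}. ip H ((adj H (C i) \<otimes>\<^bsub>BH H\<^esub> C i) x) x)"
    proof (rule sum.cong[OF refl])
      fix i assume i: "i \<in> {1..n}"
      have Cx: "C i x \<in> carrier H" using H.BH_closed[OF C[OF i] x] .
      have "ip H (adj H (C i) (C i x)) x = ip H (C i x) (C i x)"
        using adjoint_pairD(3)[OF adjoint_pair_sym[OF H H H.adj_BH(2)[OF C[OF i]]] Cx x] .
      then show "ip H (cfc H (poly [:1:]) (A i) (C i x)) (C i x) = ip H ((adj H (C i) \<otimes>\<^bsub>BH H\<^esub> C i) x) x"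
        using id(2)[OF H A(1)[OF i] A(2)[OF i] Cx] x by (simp add: H.BH_apply)
    qed
    also have "\<dots> = ip H x x"
      using H.ip_finsum_BH[of "{1..n}" "\<lambda>i. adj H (C i) \<otimes>\<^bsub>BH H\<^esub> C i", OF _ F x x] x
      unfolding one by (simp add: H.BH_apply)
    finally show ?thesis by (simp add: hnorm_def)
  qed
  have PQ: "Re (ip H (P x) x) = Re (ip K (Q (V x)) (V x))" if x: "x \<in> carrier H" for x
  proof -
    have "ip K (Q (V x)) (V x) = ip K (cfc K (poly [:0, 1:]) Q (V x)) (V x)"
      using id(1)[OF K Q] blin_closed[OF V x] by simp
    also have "\<dots> = (\<Sum>i\<in>{1..n}. ip H (cfc H (poly [:0, 1:]) (A i) (C i x)) (C i x))"
      by (rule sum[OF _ x]) (intro continuous_intros)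
    also have "\<dots> = (\<Sum>i\<in>{1..n}. ip H (A i (C i x)) (C i x))"
      using id(1)[OF H A] H.BH_closed[OF C x] by simp
    finally show ?thesis using P(2)[OF x x] by simp
  qed
  have Ps: "spectrum_in H P {m..M}"
  proof (rule H.spectrum_in_form[OF P(1)])
    fix x assume x: "x \<in> carrier H"
    show "m * (hnorm H x)\<^sup>2 \<le> Re (ip H (P x) x)" "Re (ip H (P x) x) \<le> M * (hnorm H x)\<^sup>2"
      using K.form_bounds(1,2)[OF Q blin_closed[OF V x]] x by (simp_all add: PQ nV)
  qed
  have fP: "selfadjoint_op H (cfc H f P)"
    by (rule H.cfc_selfadjoint[OF P(1) Ps]) (rule continuous_on_subset[OF cont[of M]], use m in auto)
  have S2: "selfadjoint_op H (2 \<odot>\<^bsub>BH H\<^esub> S)"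
    using H.selfadjoint_scale[OF S(1), of 2] by simp
  have "Re (ip H (cfc H f P x) x) \<le> Re (ip H ((2 \<odot>\<^bsub>BH H\<^esub> S) x) x)" if x: "x \<in> carrier H" for x
  proof -
    have "Re (ip H (cfc H f P x) x) \<le> 2 * Re (ip K (cfc K g Q (V x)) (V x))"
      unfolding g_def[abs_def]
      by (rule isometry_reverse_jensen[OF mono fpos H K m mM(2) Q V nV P(1) PQ x])
    also have "ip K (cfc K g Q (V x)) (V x) = ip H (S x) x"
      using sum[OF g x] S(2)[OF x x] half(2) H.BH_closed[OF C x] by simp
    finally show ?thesis
      using S(1) x H.BH_closed[of S x] by (simp add: H.BH_apply H.ip_simps selfadjoint_op_def)
  qed
  then show ?thesis
    unfolding P_def[symmetric] S_def[symmetric] by (simp add: H.op_le_iff[OF fP S2])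
qed

theorem theorem2p4:
  fixes H :: "'a inner_space" and f :: "real \<Rightarrow> real" and lam :: real
    and A :: "'a \<Rightarrow> 'a" and As :: "nat \<Rightarrow> 'a \<Rightarrow> 'a" and n :: nat
  assumes "hilbert_space H"
    and "\<And>t. t \<ge> 0 \<Longrightarrow> f t \<ge> 0"
    and "operator_monotone TYPE('a) {0..} f"
    and "lam > 0"
    and "positive_op H A" and "spectrum_in H A {lam..(1 + 2 * sqrt 2) * lam}"
    and "\<And>i. i \<in> {1..n} \<Longrightarrow> positive_op H (As i)"
    and "\<And>i. i \<in> {1..n} \<Longrightarrow> spectrum_in H (As i) {lam..(1 + 2 * sqrt 2) * lam}"
  shows "(\<forall>C. isometry_op H C \<longrightarrow>
      op_le H (cfc H f (adj H C \<otimes>\<^bsub>BH H\<^esub> A \<otimes>\<^bsub>BH H\<^esub> C))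
        (2 \<odot>\<^bsub>BH H\<^esub> (adj H C \<otimes>\<^bsub>BH H\<^esub> cfc H f ((1 / 2) \<odot>\<^bsub>BH H\<^esub> A) \<otimes>\<^bsub>BH H\<^esub> C))) \<and>
    (\<forall>Cs :: nat \<Rightarrow> 'a \<Rightarrow> 'a. (\<forall>i\<in>{1..n}. Cs i \<in> carrier (BH H)) \<and>
      (\<Oplus>\<^bsub>BH H\<^esub>i\<in>{1..n}. adj H (Cs i) \<otimes>\<^bsub>BH H\<^esub> Cs i) = \<one>\<^bsub>BH H\<^esub> \<longrightarrow>
      op_le H (cfc H f (\<Oplus>\<^bsub>BH H\<^esub>i\<in>{1..n}. adj H (Cs i) \<otimes>\<^bsub>BH H\<^esub> As i \<otimes>\<^bsub>BH H\<^esub> Cs i))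
        (2 \<odot>\<^bsub>BH H\<^esub> (\<Oplus>\<^bsub>BH H\<^esub>i\<in>{1..n}.
           adj H (Cs i) \<otimes>\<^bsub>BH H\<^esub> cfc H f ((1 / 2) \<odot>\<^bsub>BH H\<^esub> As i) \<otimes>\<^bsub>BH H\<^esub> Cs i)))"
proof -
  interpret H: hilbert_space H by fact
  define M where "M = (1 + 2 * sqrt 2) * lam"
  have mM: "lam \<le> M" using assms(4) by (simp add: M_def)
  \<comment> \<open>For \<open>M = s * lam\<close> the gap is
    \<open>(6 * s - 1 - s^2) * lam^2\<close>; at \<open>s = 1 + 2 * sqrt 2\<close> the coefficient
    is \<open>8 * sqrt 2 - 4\<close>.\<close>
  have quad: "(lam + M)\<^sup>2 \<le> 8 * lam * M"
  proof -
    have "8 * lam * M - (lam + M)\<^sup>2 = (8 * (1 + 2 * sqrt 2) - (2 + 2 * sqrt 2)\<^sup>2) * lam\<^sup>2"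
      by (simp add: M_def power2_eq_square algebra_simps)
    also have "\<dots> = (8 * sqrt 2 - 4) * lam\<^sup>2"
      by (simp add: power2_eq_square algebra_simps)
    also have "\<dots> \<ge> 0"
    proof (rule mult_nonneg_nonneg)
      have "1 \<le> sqrt 2" by simp
      then show "0 \<le> 8 * sqrt 2 - 4" by linarith
    qed simp
    finally show ?thesis by simp
  qed
  note jensen = operator_monotone_reverse_jensen[OF assms(1-4) mM quad]
  \<comment> \<open>Part (i) is the case of one summand with constant families. Collapsing the sum
    over \<open>{1..1}\<close> requires each summand to lie in the carrier, which the closure facts
    \<open>cl\<close> below provide.\<close>
  have single: "(\<Oplus>\<^bsub>BH H\<^esub>i\<in>{1..1::nat}. F i) = F 1" if "F 1 \<in> carrier (BH H)" for F
    using H.BH.finsum_insert[of "{}" 1 F] that by simp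
  show ?thesis
  proof (intro conjI allI impI)
    fix C assume "isometry_op H C"
    then have C: "C \<in> carrier (BH H)" "adj H C \<otimes>\<^bsub>BH H\<^esub> C = \<one>\<^bsub>BH H\<^esub>" by (auto simp: isometry_op_def)
    have SA: "selfadjoint_op H A" using assms(5) by (rule H.positive_imp_selfadjoint)
    have sp: "spectrum_in H A {lam..M}" using assms(6) by (simp add: M_def)
    have "continuous_on {0..1 / 2 * M} f"
      using assms(3) continuous_on_subset[of "{0..}" f "{0..1 / 2 * M}"] by (auto simp: operator_monotone_def)
    then have fA: "selfadjoint_op H (cfc H f ((1 / 2) \<odot>\<^bsub>BH H\<^esub> A))"
      using H.cfc_scale(1)[OF SA sp, of "1 / 2" f] assms(4) by simp
    have cl: "adj H C \<otimes>\<^bsub>BH H\<^esub> C \<in> carrier (BH H)" "adj H C \<otimes>\<^bsub>BH H\<^esub> A \<otimes>\<^bsub>BH H\<^esub> C \<in> carrier (BH H)"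
      "adj H C \<otimes>\<^bsub>BH H\<^esub> cfc H f ((1 / 2) \<odot>\<^bsub>BH H\<^esub> A) \<otimes>\<^bsub>BH H\<^esub> C \<in> carrier (BH H)"
      using SA fA C(1) by (auto simp: selfadjoint_op_def intro!: H.BH_mult H.adj_BH(1))
    show "op_le H (cfc H f (adj H C \<otimes>\<^bsub>BH H\<^esub> A \<otimes>\<^bsub>BH H\<^esub> C))
        (2 \<odot>\<^bsub>BH H\<^esub> (adj H C \<otimes>\<^bsub>BH H\<^esub> cfc H f ((1 / 2) \<odot>\<^bsub>BH H\<^esub> A) \<otimes>\<^bsub>BH H\<^esub> C))"
      using jensen[of 1 "\<lambda>_. A" "\<lambda>_. C"] SA sp C cl by (simp only: single)
  next
    fix Cs :: "nat \<Rightarrow> 'a \<Rightarrow> 'a"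
    assume "(\<forall>i\<in>{1..n}. Cs i \<in> carrier (BH H)) \<and>
      (\<Oplus>\<^bsub>BH H\<^esub>i\<in>{1..n}. adj H (Cs i) \<otimes>\<^bsub>BH H\<^esub> Cs i) = \<one>\<^bsub>BH H\<^esub>"
    then show "op_le H (cfc H f (\<Oplus>\<^bsub>BH H\<^esub>i\<in>{1..n}. adj H (Cs i) \<otimes>\<^bsub>BH H\<^esub> As i \<otimes>\<^bsub>BH H\<^esub> Cs i))
        (2 \<odot>\<^bsub>BH H\<^esub> (\<Oplus>\<^bsub>BH H\<^esub>i\<in>{1..n}.
           adj H (Cs i) \<otimes>\<^bsub>BH H\<^esub> cfc H f ((1 / 2) \<odot>\<^bsub>BH H\<^esub> As i) \<otimes>\<^bsub>BH H\<^esub> Cs i))"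
      using assms(7,8) H.positive_imp_selfadjoint by (intro jensen) (auto simp: M_def)
  qed
qed

end
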